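(* Assume the hypotheses in the context, with $c'(z)\le -m_0$ for all $z$ and $\psi_1(y)\ge\psi_0$ for all $y$. Then there exist constants $\lambda_0>0$, $\delta>0$ and $M>0$ such that for every $\lambda$ with $|\lambda|\le\lambda_0$ the problem \[ U_{1\tau}+\Lambda_+U_{1y}=G_1,\quad U_{2\tau}+\Lambda_-U_{2y}=G_2,\quad U_{3\tau}+\Lambda_+U_{3y}=G_3,\quad U_{4\tau}+\Lambda_-U_{4y}=G_4, \] with $U_i(0,y)=U_{i\tau}(0,y)=0$ ($i=1,2,3,4$, $y\in\mathbb{R}$), has a classical solution $\mathbf U=(U_1,U_2,U_3,U_4)^T$ on $[0,\delta]\times\mathbb{R}$ belonging to the function class $\mathcal F(M,\delta)$.
   Context: Hypotheses: $c,a:\mathbb{R}\to\mathbb{R}$ smooth with $c^{(l)},a^{(l)}$ bounded for $l=1,2,3$, $|a(z)|\ge m_0>0$; $\varphi_1$ a constant with $c(\varphi_1)=0$; $\varphi_2,\psi_1,\psi_2$ smooth with $\varphi_2^{(j)}$ ($j=1,\dots,4$), $\psi_1^{(k)},\psi_2^{(k)}$ ($k=0,\dots,3$) bounded. Let $u_*(\tau)$ be defined by $c(u_*(\tau))=-\tau$, $u_*(0)=\varphi_1$ (well defined as $c$ is strictly decreasing); below $c',a,a'$ denote $c'(u_*(\tau)),a(u_*(\tau)),a'(u_*(\tau))$. Define $f_{11}=a(\varphi_1)a'(\varphi_1)\psi_2^2+2\lambda a(\varphi_1)a'(\varphi_1)\varphi_2'$, $f_{21}=c'(\varphi_1)\psi_1\varphi_2'-\frac{2a'(\varphi_1)}{a(\varphi_1)}\psi_1\psi_2$,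 $f_{22}=-c'(\varphi_1)\psi_1\varphi_2'-\frac{2a'(\varphi_1)}{a(\varphi_1)}\psi_1\psi_2$ and $g_{1i}$... precisely $g_{11}=-\frac{f_{11}}{c'(\varphi_1)\psi_1}$, $g_{21}=-\frac{f_{21}}{c'(\varphi_1)\psi_1}$, $g_{22}=-\frac{f_{22}}{c'(\varphi_1)\psi_1}$ (functions of $y$). Given $\mathbf U$, set $R_1=U_1+\psi_1+g_{11}\tau$, $S_1=U_2+\psi_1+g_{11}\tau$, $R_2=U_3+\psi_2+g_{21}\tau$, $S_2=U_4+\psi_2+g_{22}\tau$, and $\Lambda_+=-\frac{\tau}{c'S_1}$, $\Lambda_-=\frac{\tau}{c'R_1}$. Define $G_1=\frac{(R_1+S_1)(R_1-S_1)}{4S_1\tau}+\frac{\lambda aa'(R_2-S_2)}{c'S_1\tau}-\frac{a^2(R_2-S_2)^2}{4S_1\tau}-\frac{aa'R_2S_2}{c'S_1}-g_{11}+\frac{\tau(\psi_1'+g_{11}'\tau)}{c'S_1}$, $G_2=\frac{(R_1+S_1)(S_1-R_1)}{4R_1\tau}+\frac{\lambda aa'(R_2-S_2)}{c'R_1\tau}-\frac{a^2(R_2-S_2)^2}{4R_1\tau}-\frac{aa'R_2S_2}{c'R_1}-g_{11}-\frac{\tau(\psi_1'+g_{11}'\tau)}{c'R_1}$, $G_3=\frac{R_1(R_2-S_2)}{2S_1\tau}-\frac{\lambda a'(R_1-S_1)}{ac'S_1\tau}+\frac{a'(R_1S_2+R_2S_1)}{ac'S_1}-g_{21}+\frac{\tau(\psi_2'+g_{21}'\tau)}{c'S_1}$,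 $G_4=\frac{S_1(S_2-R_2)}{2R_1\tau}-\frac{\lambda a'(R_1-S_1)}{ac'R_1\tau}+\frac{a'(R_1S_2+R_2S_1)}{ac'R_1}-g_{22}-\frac{\tau(\psi_2'+g_{22}'\tau)}{c'R_1}$. (This is the degenerate system for $R_1,S_1,R_2,S_2$ written in the partial hodograph variables $\tau=-c(u(t,x))$, $y=x$, after subtracting the first-order Taylor expansion in $\tau$ of the initial data.) Function class: $\mathcal F(M,\delta)$ is the set of continuously differentiable $\mathbf u=(u_1,u_2,u_3,u_4)^T:[0,\delta]\times\mathbb{R}\to\mathbb{R}^4$ such that (P1) $u_j(0,y)=u_{j\tau}(0,y)=0$ for $j=1,\dots,4$; (P2) $\sum_{j=1}^4\|u_j/\tau^2\|_{L^\infty}\le M$; (P3) $\sum_{j=1}^4\|u_{jy}/\tau^2\|_{L^\infty}\le M$; (P4) each $u_{jy}$ is Lipschitz continuous in $y$ and $\sum_{j=1}^4\|u_{jyy}/\tau^2\|_{L^\infty}\le M$. *)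

theory Defs
  imports "HOL-Analysis.Analysis"
begin

definition smooth_fun :: "(real \<Rightarrow> real) \<Rightarrow> bool" where
  "smooth_fun f \<longleftrightarrow> (\<forall>k x. ((deriv ^^ k) f) differentiable (at x))"

text \<open>u_*(tau): the solution of c(u_*(tau)) = -tau (c is a bijection since c' <= -m0 < 0).\<close>
definition ustar :: "(real \<Rightarrow> real) \<Rightarrow> real \<Rightarrow> real" where
  "ustar c \<tau> = inv c (- \<tau>)"

definition f11 :: "(real \<Rightarrow> real) \<Rightarrow> real \<Rightarrow> (real \<Rightarrow> real) \<Rightarrow> (real \<Rightarrow> real) \<Rightarrow> real \<Rightarrow> real \<Rightarrow> real" where
  "f11 a \<phi>1 \<phi>2 \<psi>2 lam y =
     a \<phi>1 * deriv a \<phi>1 * (\<psi>2 y)\<^sup>2 + 2 * lam * a \<phi>1 * deriv a \<phi>1 * deriv \<phi>2 y"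

definition f21 :: "(real \<Rightarrow> real) \<Rightarrow> (real \<Rightarrow> real) \<Rightarrow> real \<Rightarrow> (real \<Rightarrow> real) \<Rightarrow> (real \<Rightarrow> real) \<Rightarrow> (real \<Rightarrow> real) \<Rightarrow> real \<Rightarrow> real" where
  "f21 c a \<phi>1 \<phi>2 \<psi>1 \<psi>2 y =
     deriv c \<phi>1 * \<psi>1 y * deriv \<phi>2 y - 2 * deriv a \<phi>1 / a \<phi>1 * \<psi>1 y * \<psi>2 y"

definition f22 :: "(real \<Rightarrow> real) \<Rightarrow> (real \<Rightarrow> real) \<Rightarrow> real \<Rightarrow> (real \<Rightarrow> real) \<Rightarrow> (real \<Rightarrow> real) \<Rightarrow> (real \<Rightarrow> real) \<Rightarrow> real \<Rightarrow> real" where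
  "f22 c a \<phi>1 \<phi>2 \<psi>1 \<psi>2 y =
     - deriv c \<phi>1 * \<psi>1 y * deriv \<phi>2 y - 2 * deriv a \<phi>1 / a \<phi>1 * \<psi>1 y * \<psi>2 y"

definition g11 :: "(real \<Rightarrow> real) \<Rightarrow> (real \<Rightarrow> real) \<Rightarrow> real \<Rightarrow> (real \<Rightarrow> real) \<Rightarrow> (real \<Rightarrow> real) \<Rightarrow> (real \<Rightarrow> real) \<Rightarrow> real \<Rightarrow> real \<Rightarrow> real" where
  "g11 c a \<phi>1 \<phi>2 \<psi>1 \<psi>2 lam y = - f11 a \<phi>1 \<phi>2 \<psi>2 lam y / (deriv c \<phi>1 * \<psi>1 y)"

definition g21 :: "(real \<Rightarrow> real) \<Rightarrow> (real \<Rightarrow> real) \<Rightarrow> real \<Rightarrow> (real \<Rightarrow> real) \<Rightarrow> (real \<Rightarrow> real) \<Rightarrow> (real \<Rightarrow> real) \<Rightarrow> real \<Rightarrow> real" where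
  "g21 c a \<phi>1 \<phi>2 \<psi>1 \<psi>2 y = - f21 c a \<phi>1 \<phi>2 \<psi>1 \<psi>2 y / (deriv c \<phi>1 * \<psi>1 y)"

definition g22 :: "(real \<Rightarrow> real) \<Rightarrow> (real \<Rightarrow> real) \<Rightarrow> real \<Rightarrow> (real \<Rightarrow> real) \<Rightarrow> (real \<Rightarrow> real) \<Rightarrow> (real \<Rightarrow> real) \<Rightarrow> real \<Rightarrow> real" where
  "g22 c a \<phi>1 \<phi>2 \<psi>1 \<psi>2 y = - f22 c a \<phi>1 \<phi>2 \<psi>1 \<psi>2 y / (deriv c \<phi>1 * \<psi>1 y)"

text \<open>The degenerate hodograph system. Given the values u = (u 1, u 2, u 3, u 4) of U at (tau, y)
  and the partial derivatives ut, uy, the predicate says that the four equations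
  U_{i tau} + Lambda_{+/-} U_{i y} = G_i hold at (tau, y).\<close>
definition hodograph_eqs ::
  "(real \<Rightarrow> real) \<Rightarrow> (real \<Rightarrow> real) \<Rightarrow> real \<Rightarrow> (real \<Rightarrow> real) \<Rightarrow> (real \<Rightarrow> real) \<Rightarrow> (real \<Rightarrow> real)
   \<Rightarrow> real \<Rightarrow> real \<Rightarrow> real \<Rightarrow> (nat \<Rightarrow> real) \<Rightarrow> (nat \<Rightarrow> real) \<Rightarrow> (nat \<Rightarrow> real) \<Rightarrow> bool" where
  "hodograph_eqs c a \<phi>1 \<phi>2 \<psi>1 \<psi>2 lam \<tau> y u ut uy \<longleftrightarrow>
    (let G11 = g11 c a \<phi>1 \<phi>2 \<psi>1 \<psi>2 lam;
         G21 = g21 c a \<phi>1 \<phi>2 \<psi>1 \<psi>2;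
         G22 = g22 c a \<phi>1 \<phi>2 \<psi>1 \<psi>2;
         R1 = u 1 + \<psi>1 y + G11 y * \<tau>;
         S1 = u 2 + \<psi>1 y + G11 y * \<tau>;
         R2 = u 3 + \<psi>2 y + G21 y * \<tau>;
         S2 = u 4 + \<psi>2 y + G22 y * \<tau>;
         cp = deriv c (ustar c \<tau>);
         A = a (ustar c \<tau>);
         Ap = deriv a (ustar c \<tau>);
         Lp = - \<tau> / (cp * S1);
         Lm = \<tau> / (cp * R1);
         Gr1 = (R1 + S1) * (R1 - S1) / (4 * S1 * \<tau>) + lam * A * Ap * (R2 - S2) / (cp * S1 * \<tau>)
               - A\<^sup>2 * (R2 - S2)\<^sup>2 / (4 * S1 * \<tau>) - A * Ap * R2 * S2 / (cp * S1) - G11 y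
               + \<tau> * (deriv \<psi>1 y + deriv G11 y * \<tau>) / (cp * S1);
         Gr2 = (R1 + S1) * (S1 - R1) / (4 * R1 * \<tau>) + lam * A * Ap * (R2 - S2) / (cp * R1 * \<tau>)
               - A\<^sup>2 * (R2 - S2)\<^sup>2 / (4 * R1 * \<tau>) - A * Ap * R2 * S2 / (cp * R1) - G11 y
               - \<tau> * (deriv \<psi>1 y + deriv G11 y * \<tau>) / (cp * R1);
         Gr3 = R1 * (R2 - S2) / (2 * S1 * \<tau>) - lam * Ap * (R1 - S1) / (A * cp * S1 * \<tau>)
               + Ap * (R1 * S2 + R2 * S1) / (A * cp * S1) - G21 y
               + \<tau> * (deriv \<psi>2 y + deriv G21 y * \<tau>) / (cp * S1);
         Gr4 = S1 * (S2 - R2) / (2 * R1 * \<tau>) - lam * Ap * (R1 - S1) / (A * cp * R1 * \<tau>)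
               + Ap * (R1 * S2 + R2 * S1) / (A * cp * R1) - G22 y
               - \<tau> * (deriv \<psi>2 y + deriv G22 y * \<tau>) / (cp * R1)
     in ut 1 + Lp * uy 1 = Gr1 \<and> ut 2 + Lm * uy 2 = Gr2 \<and>
        ut 3 + Lp * uy 3 = Gr3 \<and> ut 4 + Lm * uy 4 = Gr4)"

definition C1_strip :: "real \<Rightarrow> (real \<Rightarrow> real \<Rightarrow> real) \<Rightarrow> (real \<Rightarrow> real \<Rightarrow> real) \<Rightarrow> (real \<Rightarrow> real \<Rightarrow> real) \<Rightarrow> bool" where
  "C1_strip \<delta> u ut uy \<longleftrightarrow>
     continuous_on ({0..\<delta>} \<times> UNIV) (\<lambda>p. ut (fst p) (snd p)) \<and>
     continuous_on ({0..\<delta>} \<times> UNIV) (\<lambda>p. uy (fst p) (snd p)) \<and>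
     (\<forall>p \<in> {0..\<delta>} \<times> UNIV.
        ((\<lambda>q. u (fst q) (snd q)) has_derivative
           (\<lambda>h. ut (fst p) (snd p) * fst h + uy (fst p) (snd p) * snd h))
        (at p within ({0..\<delta>} \<times> UNIV)))"

text \<open>The function class F(M,delta) for U = (U 1, .., U 4) with partial derivatives Ut j, Uy j.
  The L-infinity bounds (P2),(P3) are written as: there are constants K j with
  |f j| <= K j * tau^2 on the strip and sum K j <= M (equivalent to sum of sup-norms <= M).
  (P4): U_{jy} is Lipschitz in y, and the L-infinity norm of U_{jyy}/tau^2 (the a.e. derivative
  of the Lipschitz function) is expressed through the Lipschitz constants K j * tau^2.\<close>
definition class_F :: "real \<Rightarrow> real \<Rightarrow> (nat \<Rightarrow> real \<Rightarrow> real \<Rightarrow> real) \<Rightarrow> (nat \<Rightarrow> real \<Rightarrow> real \<Rightarrow> real)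
    \<Rightarrow> (nat \<Rightarrow> real \<Rightarrow> real \<Rightarrow> real) \<Rightarrow> bool" where
  "class_F M \<delta> U Ut Uy \<longleftrightarrow>
     (\<forall>j \<in> {1..4}. C1_strip \<delta> (U j) (Ut j) (Uy j)) \<and>
     (\<forall>j \<in> {1..4}. \<forall>y. U j 0 y = 0 \<and> Ut j 0 y = 0) \<and>
     (\<exists>K. (\<forall>j \<in> {1..4}. \<forall>\<tau> \<in> {0..\<delta>}. \<forall>y. \<bar>U j \<tau> y\<bar> \<le> K j * \<tau>\<^sup>2) \<and> (\<Sum>j=1..4. K j) \<le> M) \<and>
     (\<exists>K. (\<forall>j \<in> {1..4}. \<forall>\<tau> \<in> {0..\<delta>}. \<forall>y. \<bar>Uy j \<tau> y\<bar> \<le> K j * \<tau>\<^sup>2) \<and> (\<Sum>j=1..4. K j) \<le> M) \<and>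
     (\<exists>K. (\<forall>j \<in> {1..4}. \<forall>\<tau> \<in> {0..\<delta>}. \<forall>y1 y2.
             \<bar>Uy j \<tau> y1 - Uy j \<tau> y2\<bar> \<le> K j * \<tau>\<^sup>2 * \<bar>y1 - y2\<bar>) \<and> (\<Sum>j=1..4. K j) \<le> M)"

end

theory Submission
  imports Defs
begin

text \<open>
  Substituting \<open>U = \<tau>\<^sup>2 V\<close> removes the singularity at \<open>\<tau> = 0\<close>: the first-order terms of the expansion were chosen such that
  \<open>G\<^sub>i = \<tau> g\<^sub>i(\<tau>, y, V)\<close> with \<open>g\<^sub>i\<close> regular, and for small \<open>\<tau>\<close> and \<open>\<lambda>\<close> the function \<open>g\<^sub>i\<close> differs from
  \<open>\<plusminus> (V\<^sub>1 - V\<^sub>2) / 2\<close> or \<open>\<plusminus> (V\<^sub>3 - V\<^sub>4) / 2\<close> by a function with small Lipschitz constant in \<open>V\<close>.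

  The solution and its characteristics are constructed together, as the fixed point of
  \<open>V\<^sub>i(\<tau>, y) = \<integral>\<^sub>0\<^sup>1 \<rho> g\<^sub>i d\<rho>\<close> and
  \<open>X\<^sub>i(\<sigma>, \<tau>, y) = y - \<tau>\<^sup>2 \<integral>\<^bsub>\<sigma>\<^esub>\<^bsup>1\<^esup> \<rho> l\<^sub>i d\<rho>\<close>,
  the integrands being evaluated at time \<open>\<tau> \<rho>\<close> on the characteristic \<open>X\<^sub>i(\<rho>, \<tau>, y)\<close>.
  This map contracts in the supremum norm and preserves bounds on \<open>V\<close>, on its Lipschitz constant in \<open>y\<close>, and on its
  second differences in \<open>y\<close>. These bounds pass to limits and integrals without differentiating anything, and a
  continuous function on the line with \<open>|f(m + h) + f(m - h) - 2 f(m)| \<le> C h\<^sup>2\<close> is automatically differentiable with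
  Lipschitz derivative. Differentiability in \<open>\<tau>\<close> and the equations follow from the flow property of the characteristics.
\<close>

subsection \<open>Second differences and differentiability\<close>

text \<open>The obstacle is the factor \<open>1 / \<tau>\<close> in G: after the substitution it
  leaves the coupling +-(V1 - V2) / 2, whose coefficient no small \<tau> reduces. In the supremum
  norm this coupling has Lipschitz constant 1; the weight \<rho> halves it, and all other terms
  together are granted a budget of 1 / 2 before the halving. The term with lam is of the same order
  in \<tau>, so lam itself must be small; everything else sees V only through \<tau> V.

  The constants are chosen in an order that avoids circularity. The coefficients are estimated for
  |\<tau> V| <= 1, whatever the size of V, which gives K; then come the bound on V,
  \<open>B1\<close>, \<open>B2\<close>, the weight \<open>N\<close>, and \<delta> last.

  With the characteristics among the unknowns, no ordinary differential equation has to be solved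
  for each iterate and no dependence of its solution on V has to be studied. Contraction is asked
  for in the supremum norm only, because transport compares V at different points, so that
  differences of iterates lose one derivative.\<close>

lemma second_difference_le_chord:
  fixes f :: "real \<Rightarrow> real"
  assumes cont: "continuous_on {a..b} f" and x: "a < x" "x < b"
    and sd: "\<And>m h. f (m + h) + f (m - h) - 2 * f m \<ge> - C * h\<^sup>2"
  shows "f x - (f a * (b - x) + f b * (x - a)) / (b - a) \<le> C / 2 * (x - a) * (b - x)"
proof -
  define k where "k = (f b - f a) / (b - a)"
  \<comment> \<open>Subtracting the parabola adds \<open>C * h\<^sup>2\<close> to the second
    differences. So w is midpoint convex and vanishes at both ends, and the claim is a discrete
    maximum principle.\<close>
  define w where "w t = f t - (f a + k * (t - a)) - C / 2 * (t - a) * (b - t)" for t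
  have ab: "a < b" using x by simp
  have wa: "w a = 0" and wb: "w b = 0" using ab by (simp_all add: w_def k_def)
  have "continuous_on {a..b} w" unfolding w_def using ab by (intro continuous_intros cont) auto
  then obtain z where z: "z \<in> {a..b}" and zmax: "\<And>t. t \<in> {a..b} \<Longrightarrow> w t \<le> w z"
    using continuous_attains_sup[of "{a..b}" w] ab by fastforce
  \<comment> \<open>The largest symmetric step inside the interval: one of z + h, z - h is an end
    point, where w is 0, and midpoint convexity at a maximum forces the maximal value there.\<close>
  define h where "h = min (z - a) (b - z)"
  have zh: "z + h \<in> {a..b}" "z - h \<in> {a..b}" using z by (auto simp: h_def)
  have "w (z + h) + w (z - h) - 2 * w z = f (z + h) + f (z - h) - 2 * f z + C * h\<^sup>2"
    by (simp add: w_def field_simps power2_eq_square)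
  then have "w (z + h) + w (z - h) \<ge> 2 * w z" using sd[where m = z and h = h] by simp
  then have "w (z + h) = w z" "w (z - h) = w z" using zmax[OF zh(1)] zmax[OF zh(2)] by simp_all
  moreover have "z - h = a \<or> z + h = b" by (auto simp: h_def min_def)
  ultimately have "w z = 0" using wa wb by auto
  then have "w x \<le> 0" using zmax[of x] x by simp
  moreover have "(f a * (b - x) + f b * (x - a)) / (b - a) = f a + k * (x - a)"
    using ab by (simp add: k_def divide_simps) (simp add: algebra_simps)
  ultimately show ?thesis by (simp add: w_def)
qed

text \<open>A second divided difference is symmetric in its nodes, so the bound on increasing triples
  compares the difference quotients of \<open>f\<close> at \<open>y\<close> for arbitrary increments.\<close>

lemma second_difference_quotient_bound:
  fixes f :: "real \<Rightarrow> real"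
  assumes cont: "continuous_on UNIV f"
    and sd: "\<And>m h. \<bar>f (m + h) + f (m - h) - 2 * f m\<bar> \<le> C * h\<^sup>2"
    and hk: "h \<noteq> 0" "k \<noteq> 0"
  shows "\<bar>(f (y + h) - f y) / h - (f (y + k) - f y) / k\<bar> \<le> C / 2 * \<bar>h - k\<bar>"
proof -
  \<comment> \<open>In the Lagrange form the symmetry in the nodes is plain commutativity.\<close>
  define dd where "dd p q r = f p / ((p - q) * (p - r)) + f q / ((q - p) * (q - r)) + f r / ((r - p) * (r - q))" for p q r
  have sym: "dd p q r = dd q p r" "dd p q r = dd p r q" for p q r
    by (auto simp: dd_def mult.commute)
  have sorted: "\<bar>dd p q r\<bar> \<le> C / 2" if "p < q" "q < r" for p q r
  proof -
    \<comment> \<open>The chord estimate is one-sided; applied to both f and - f it bounds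
      \<open>dd\<close> from both sides.\<close>
    have c: "continuous_on {p..r} f" "continuous_on {p..r} (\<lambda>x. - f x)"
      using cont by (auto intro: continuous_on_subset continuous_intros)
    have sd1: "f (m + h) + f (m - h) - 2 * f m \<ge> - C * h\<^sup>2" for m h using sd[of m h] by (simp add: abs_le_iff)
    have sd2: "- f (m + h) + - f (m - h) - 2 * - f m \<ge> - C * h\<^sup>2" for m h using sd[of m h] by (simp add: abs_le_iff)
    have eq: "f q - (f p * (r - q) + f r * (q - p)) / (r - p) = - dd p q r * ((q - p) * (r - q))"
    proof -
      have "p - q \<noteq> 0" "p - r \<noteq> 0" "q - r \<noteq> 0" using that by auto
      then show ?thesis unfolding dd_def by (simp add: divide_simps) (simp add: algebra_simps)
    qed
    have "f q - (f p * (r - q) + f r * (q - p)) / (r - p) \<le> C / 2 * (q - p) * (r - q)"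
      by (rule second_difference_le_chord[OF c(1) that sd1])
    then have 1: "- dd p q r * ((q - p) * (r - q)) \<le> C / 2 * ((q - p) * (r - q))" using eq by (simp add: mult.assoc)
    have "- f q - (- f p * (r - q) + - f r * (q - p)) / (r - p) \<le> C / 2 * (q - p) * (r - q)"
      by (rule second_difference_le_chord[OF c(2) that sd2])
    moreover have "- f q - (- f p * (r - q) + - f r * (q - p)) / (r - p) = - (f q - (f p * (r - q) + f r * (q - p)) / (r - p))"
      using that by (simp add: field_simps)
    ultimately have 2: "dd p q r * ((q - p) * (r - q)) \<le> C / 2 * ((q - p) * (r - q))"
      using eq unfolding mult.assoc by linarith
    have "(q - p) * (r - q) > 0" using that by simp
    then have "- dd p q r \<le> C / 2" "dd p q r \<le> C / 2"
      using 1 2 mult_le_cancel_right_pos by blast+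
    then show ?thesis by linarith
  qed
  have all: "\<bar>dd p q r\<bar> \<le> C / 2" if "p \<noteq> q" "q \<noteq> r" "p \<noteq> r" for p q r
  proof -
    consider "p < q \<and> q < r" | "p < r \<and> r < q" | "q < p \<and> p < r" | "q < r \<and> r < p" | "r < p \<and> p < q" | "r < q \<and> q < p"
      using \<open>p \<noteq> q\<close> \<open>q \<noteq> r\<close> \<open>p \<noteq> r\<close> by linarith
    then show ?thesis using sorted sym by cases metis+
  qed
  show ?thesis
  proof (cases "h = k")
    case False
    have "(f (y + h) - f y) / h - (f (y + k) - f y) / k = dd y (y + h) (y + k) * (h - k)"
      unfolding dd_def using False hk by (simp add: divide_simps) (simp add: algebra_simps)
    then show ?thesis using all[of y "y + h" "y + k"] False hk by (simp add: abs_mult mult_right_mono)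
  qed simp
qed

text \<open>The difference quotients at y are Lipschitz in the increment with constant C / 2. Hence
  they are Cauchy as the increment tends to 0, and letting only one of two increments tend to 0
  leaves the remainder estimate. The remainder is uniform in y; differentiability, the Lipschitz
  bound for g and its joint continuity are all read off from it later.\<close>

lemma second_difference_taylor:
  fixes f :: "real \<Rightarrow> real"
  assumes cont: "continuous_on UNIV f"
    and sd: "\<And>m h. \<bar>f (m + h) + f (m - h) - 2 * f m\<bar> \<le> C * h\<^sup>2"
  obtains g where "\<And>y h. \<bar>f (y + h) - f y - g y * h\<bar> \<le> C / 2 * h\<^sup>2"
proof -
  define q where "q y h = (f (y + h) - f y) / h" for y h
  have C: "C \<ge> 0" using sd[of 0 1] by simp
  have qq: "\<bar>q y h - q y k\<bar> \<le> C / 2 * \<bar>h - k\<bar>" if "h \<noteq> 0" "k \<noteq> 0" for y h k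
    unfolding q_def by (rule second_difference_quotient_bound[OF cont sd that])
  have "\<exists>l. (\<lambda>n. q y (1 / real (Suc n))) \<longlonglongrightarrow> l" for y
  proof -
    have "Cauchy (\<lambda>n. q y (1 / real (Suc n)))"
    proof (rule metric_CauchyI)
      fix e :: real assume e: "e > 0"
      have "(\<lambda>n. 1 / real (Suc n)) \<longlonglongrightarrow> 0" by (rule LIMSEQ_Suc[OF lim_1_over_n])
      then have c: "Cauchy (\<lambda>n. 1 / real (Suc n))" by (rule LIMSEQ_imp_Cauchy)
      have "e / (C + 1) > 0" using e C by simp
      then obtain M where M: "\<And>m n. m \<ge> M \<Longrightarrow> n \<ge> M \<Longrightarrow> dist (1 / real (Suc m)) (1 / real (Suc n)) < e / (C + 1)"
        using metric_CauchyD[OF c] by blast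
      have "dist (q y (1 / real (Suc m))) (q y (1 / real (Suc n))) < e" if "m \<ge> M" "n \<ge> M" for m n
      proof -
        have d: "\<bar>1 / real (Suc m) - 1 / real (Suc n)\<bar> < e / (C + 1)" using M[OF that] by (simp add: dist_real_def)
        have "\<bar>q y (1 / real (Suc m)) - q y (1 / real (Suc n))\<bar> \<le> C / 2 * \<bar>1 / real (Suc m) - 1 / real (Suc n)\<bar>"
          by (rule qq) auto
        also have "\<dots> \<le> (C + 1) * \<bar>1 / real (Suc m) - 1 / real (Suc n)\<bar>" using C by (intro mult_right_mono) auto
        also have "\<dots> < e" using d C by (simp add: field_simps)
        finally show ?thesis by (simp add: dist_real_def)
      qed
      then show "\<exists>M. \<forall>m\<ge>M. \<forall>n\<ge>M. dist (q y (1 / real (Suc m))) (q y (1 / real (Suc n))) < e" by blast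
    qed
    then show ?thesis by (simp add: Cauchy_convergent_iff convergent_def)
  qed
  then obtain g where g: "\<And>y. (\<lambda>n. q y (1 / real (Suc n))) \<longlonglongrightarrow> g y" by metis
  have "\<bar>f (y + h) - f y - g y * h\<bar> \<le> C / 2 * h\<^sup>2" for y h
  proof (cases "h = 0")
    case False
    have "(\<lambda>n. \<bar>q y h - q y (1 / real (Suc n))\<bar>) \<longlonglongrightarrow> \<bar>q y h - g y\<bar>"
      by (intro tendsto_intros g)
    moreover have "(\<lambda>n. C / 2 * \<bar>h - 1 / real (Suc n)\<bar>) \<longlonglongrightarrow> C / 2 * \<bar>h - 0\<bar>"
      by (intro tendsto_intros LIMSEQ_Suc[OF lim_1_over_n])
    ultimately have "\<bar>q y h - g y\<bar> \<le> C / 2 * \<bar>h - 0\<bar>"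
      by (rule LIMSEQ_le) (intro exI[of _ 0] allI impI qq False, simp)
    then have qg: "\<bar>q y h - g y\<bar> * \<bar>h\<bar> \<le> C / 2 * \<bar>h\<bar> * \<bar>h\<bar>"
      by (intro mult_right_mono) simp_all
    have "(q y h - g y) * h = f (y + h) - f y - g y * h"
      using False unfolding q_def left_diff_distrib by simp
    then have "\<bar>q y h - g y\<bar> * \<bar>h\<bar> = \<bar>f (y + h) - f y - g y * h\<bar>" by (simp only: abs_mult[symmetric])
    then show ?thesis using qg by (simp add: power2_eq_square mult.assoc)
  qed simp
  then show thesis by (rule that)
qed

section \<open>Fixed points of a coupled contraction\<close>

text \<open>Banach iteration for a pair, in the norm where the second component is weighted by
  \<open>1 / \<omega>\<close>. It is stated with an invariant P closed under uniform limits, not in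
  a complete space of functions: the characteristics are unbounded, only their increments are
  bounded, and values outside A and B are irrelevant.\<close>

lemma coupled_contraction_fixpoint:
  fixes TV :: "('a \<Rightarrow> real) \<Rightarrow> ('b \<Rightarrow> real) \<Rightarrow> 'a \<Rightarrow> real"
    and TX :: "('a \<Rightarrow> real) \<Rightarrow> ('b \<Rightarrow> real) \<Rightarrow> 'b \<Rightarrow> real"
  assumes P0: "P V0 X0"
    and step: "\<And>V X. P V X \<Longrightarrow> P (TV V X) (TX V X)"
    and init: "\<And>a. a \<in> A \<Longrightarrow> \<bar>TV V0 X0 a - V0 a\<bar> \<le> d0" "\<And>b. b \<in> B \<Longrightarrow> \<bar>TX V0 X0 b - X0 b\<bar> \<le> \<omega> * d0"
    and contr: "\<And>V X V' X' d. \<lbrakk>P V X; P V' X'; d \<ge> 0; \<And>a. a \<in> A \<Longrightarrow> \<bar>V a - V' a\<bar> \<le> d;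
        \<And>b. b \<in> B \<Longrightarrow> \<bar>X b - X' b\<bar> \<le> \<omega> * d\<rbrakk> \<Longrightarrow>
        (\<forall>a\<in>A. \<bar>TV V X a - TV V' X' a\<bar> \<le> \<kappa> * d) \<and> (\<forall>b\<in>B. \<bar>TX V X b - TX V' X' b\<bar> \<le> \<omega> * (\<kappa> * d))"
    and \<kappa>: "0 \<le> \<kappa>" "\<kappa> < 1" and \<omega>: "\<omega> > 0" and d0: "d0 \<ge> 0"
    and closed: "\<And>Vn Xn V X. \<lbrakk>\<And>n::nat. P (Vn n) (Xn n); uniform_limit A Vn V sequentially;
        uniform_limit B Xn X sequentially\<rbrakk> \<Longrightarrow> P V X"
  shows "\<exists>V X. P V X \<and> (\<forall>a\<in>A. TV V X a = V a) \<and> (\<forall>b\<in>B. TX V X b = X b)"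
proof -
  define F where "F n = ((\<lambda>(V, X). (TV V X, TX V X)) ^^ n) (V0, X0)" for n
  define Vn where "Vn n = fst (F n)" for n
  define Xn where "Xn n = snd (F n)" for n
  have Vn0: "Vn 0 = V0" "Xn 0 = X0" by (simp_all add: Vn_def Xn_def F_def)
  have VnS: "Vn (Suc n) = TV (Vn n) (Xn n)" "Xn (Suc n) = TX (Vn n) (Xn n)" for n
    by (simp_all add: Vn_def Xn_def F_def split_beta)
  have Pn: "P (Vn n) (Xn n)" for n by (induction n) (use P0 step in \<open>simp_all add: Vn0 VnS\<close>)
  have diff: "(\<forall>a\<in>A. \<bar>Vn (Suc n) a - Vn n a\<bar> \<le> \<kappa> ^ n * d0) \<and> (\<forall>b\<in>B. \<bar>Xn (Suc n) b - Xn n b\<bar> \<le> \<omega> * (\<kappa> ^ n * d0))" for n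
  proof (induction n)
    case 0 then show ?case using init by (simp add: Vn0 VnS)
  next
    case (Suc n)
    have "(\<forall>a\<in>A. \<bar>TV (Vn (Suc n)) (Xn (Suc n)) a - TV (Vn n) (Xn n) a\<bar> \<le> \<kappa> * (\<kappa> ^ n * d0)) \<and>
          (\<forall>b\<in>B. \<bar>TX (Vn (Suc n)) (Xn (Suc n)) b - TX (Vn n) (Xn n) b\<bar> \<le> \<omega> * (\<kappa> * (\<kappa> ^ n * d0)))"
      by (rule contr[OF Pn Pn]) (use Suc d0 \<kappa> in auto)
    then show ?case by (simp add: VnS mult.assoc)
  qed
  \<comment> \<open>Only the increments are summable, so the M-test is applied to the telescoping
    series and the possibly unbounded initial function is added back.\<close>
  have lim: "\<exists>f. uniform_limit S Fn f sequentially"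
    if "\<And>n x. x \<in> S \<Longrightarrow> \<bar>Fn (Suc n) x - Fn n x\<bar> \<le> c * (\<kappa> ^ n * d0)"
    for S :: "'c set" and Fn :: "nat \<Rightarrow> 'c \<Rightarrow> real" and c
  proof -
    have "summable (\<lambda>n. c * (\<kappa> ^ n * d0))"
      using \<kappa> by (intro summable_mult summable_mult2 summable_geometric) auto
    then have "uniformly_convergent_on S (\<lambda>n x. \<Sum>i<n. Fn (Suc i) x - Fn i x)"
      by (intro Weierstrass_m_test'[where M = "\<lambda>n. c * (\<kappa> ^ n * d0)"]) (use that in auto)
    moreover have "(\<Sum>i<n. Fn (Suc i) x - Fn i x) = Fn n x - Fn 0 x" for n x
      by (rule sum_lessThan_telescope[of "\<lambda>i. Fn i x"])
    ultimately have "uniformly_convergent_on S (\<lambda>n x. Fn n x - Fn 0 x)" by simp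
    then obtain l where "uniform_limit S (\<lambda>n x. Fn n x - Fn 0 x) l sequentially"
      by (auto simp: uniformly_convergent_on_def)
    then have "uniform_limit S (\<lambda>n x. (Fn n x - Fn 0 x) + Fn 0 x) (\<lambda>x. l x + Fn 0 x) sequentially"
      by (intro uniform_limit_intros)
    then show ?thesis by auto
  qed
  obtain V where V: "uniform_limit A Vn V sequentially" using lim[of A Vn 1] diff by auto
  obtain X where X: "uniform_limit B Xn X sequentially" using lim[of B Xn \<omega>] diff by auto
  have PVX: "P V X" by (rule closed[OF Pn V X])
  \<comment> \<open>The maps are not assumed continuous; the contraction estimate between the limit
    and a late iterate takes the place of continuity.\<close>
  have small: "(\<forall>a\<in>A. \<bar>TV V X a - V a\<bar> \<le> e) \<and> (\<forall>b\<in>B. \<bar>TX V X b - X b\<bar> \<le> 2 * \<omega> * e)" if e: "e > 0" for e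
  proof -
    obtain N1 where N1: "\<And>n a. n \<ge> N1 \<Longrightarrow> a \<in> A \<Longrightarrow> dist (Vn n a) (V a) < e / 2"
      using uniform_limitD[OF V, of "e / 2"] e by (auto simp: eventually_sequentially)
    obtain N2 where N2: "\<And>n b. n \<ge> N2 \<Longrightarrow> b \<in> B \<Longrightarrow> dist (Xn n b) (X b) < \<omega> * (e / 2)"
      using uniform_limitD[OF X, of "\<omega> * (e / 2)"] e \<omega> by (auto simp: eventually_sequentially)
    define n where "n = max N1 N2"
    have n: "n \<ge> N1" "Suc n \<ge> N1" "n \<ge> N2" "Suc n \<ge> N2" by (auto simp: n_def)
    have cl: "\<And>a. a \<in> A \<Longrightarrow> \<bar>V a - Vn n a\<bar> \<le> e / 2" "\<And>b. b \<in> B \<Longrightarrow> \<bar>X b - Xn n b\<bar> \<le> \<omega> * (e / 2)"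
      "\<And>a. a \<in> A \<Longrightarrow> \<bar>V a - Vn (Suc n) a\<bar> \<le> e / 2" "\<And>b. b \<in> B \<Longrightarrow> \<bar>X b - Xn (Suc n) b\<bar> \<le> \<omega> * (e / 2)"
      using N1[OF n(1)] N1[OF n(2)] N2[OF n(3)] N2[OF n(4)]
      by (simp_all only: dist_real_def abs_minus_commute less_imp_le)
    have T: "(\<forall>a\<in>A. \<bar>TV V X a - TV (Vn n) (Xn n) a\<bar> \<le> \<kappa> * (e / 2)) \<and>
          (\<forall>b\<in>B. \<bar>TX V X b - TX (Vn n) (Xn n) b\<bar> \<le> \<omega> * (\<kappa> * (e / 2)))"
      by (rule contr[OF PVX Pn]) (use e cl in auto)
    have k: "\<kappa> * (e / 2) \<le> e / 2" using e \<kappa> by simp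
    then have k': "\<omega> * (\<kappa> * (e / 2)) \<le> \<omega> * (e / 2)" using \<omega> by (intro mult_left_mono) auto
    show ?thesis
    proof (intro conjI ballI)
      fix a assume a: "a \<in> A"
      have "\<bar>TV V X a - Vn (Suc n) a\<bar> \<le> \<kappa> * (e / 2)" using T a by (simp add: VnS)
      then show "\<bar>TV V X a - V a\<bar> \<le> e" using cl(3)[OF a] k by linarith
    next
      fix b assume b: "b \<in> B"
      have "\<bar>TX V X b - Xn (Suc n) b\<bar> \<le> \<omega> * (\<kappa> * (e / 2))" using T b by (simp add: VnS)
      then have "\<bar>TX V X b - X b\<bar> \<le> \<omega> * (e / 2) + \<omega> * (e / 2)" using cl(4)[OF b] k' by linarith
      also have "\<dots> \<le> 2 * \<omega> * e" using e \<omega> by simp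
      finally show "\<bar>TX V X b - X b\<bar> \<le> 2 * \<omega> * e" .
    qed
  qed
  have "TV V X a = V a" if "a \<in> A" for a
  proof -
    have "\<bar>TV V X a - V a\<bar> \<le> 0" by (rule field_le_epsilon) (use small that in auto)
    then show ?thesis by simp
  qed
  moreover have "TX V X b = X b" if "b \<in> B" for b
  proof -
    have "\<bar>TX V X b - X b\<bar> \<le> 0 + e" if "e > 0" for e
      using small[of "e / (2 * \<omega>)"] \<open>b \<in> B\<close> \<omega> that by (auto simp: field_simps)
    then have "\<bar>TX V X b - X b\<bar> \<le> 0" by (rule field_le_epsilon)
    then show ?thesis by simp
  qed
  ultimately show ?thesis using PVX by blast
qed

text \<open>The weight \<rho> has integral \<open>(1 - \<sigma>\<^sup>2) / 2\<close> over
  \<open>{\<sigma>..1}\<close>. To exploit this, the bounds along characteristics are all stated as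
  \<rho> times a constant.\<close>

lemma weighted_integral_bound:
  fixes f :: "real \<Rightarrow> real"
  assumes f: "continuous_on {\<sigma>..1} f" and \<sigma>: "0 \<le> \<sigma>" "\<sigma> \<le> 1"
    and b: "\<And>\<rho>. \<rho> \<in> {\<sigma>..1} \<Longrightarrow> \<bar>f \<rho>\<bar> \<le> \<rho> * C"
  shows "\<bar>integral {\<sigma>..1} f\<bar> \<le> C / 2"
proof -
  have C: "C \<ge> 0" using order_trans[OF abs_ge_zero b[of 1]] \<sigma> by simp
  have i: "((\<lambda>\<rho>. \<rho> * C) has_integral (1 * C * 1 / 2 - \<sigma> * C * \<sigma> / 2)) {\<sigma>..1}"
    by (rule fundamental_theorem_of_calculus[OF \<sigma>(2)])
      (auto intro!: derivative_eq_intros simp: has_real_derivative_iff_has_vector_derivative[symmetric])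
  have "norm (integral {\<sigma>..1} f) \<le> integral {\<sigma>..1} (\<lambda>\<rho>. \<rho> * C)"
  proof (rule integral_norm_bound_integral)
    show "f integrable_on {\<sigma>..1}" by (rule integrable_continuous_real[OF f])
    show "(\<lambda>\<rho>. \<rho> * C) integrable_on {\<sigma>..1}" using i by (rule has_integral_integrable)
    show "norm (f \<rho>) \<le> \<rho> * C" if "\<rho> \<in> {\<sigma>..1}" for \<rho> using b[OF that] by simp
  qed
  also have "\<dots> = C / 2 - \<sigma> * \<sigma> * C / 2" using integral_unique[OF i] by (simp add: algebra_simps)
  also have "\<dots> \<le> C / 2" using C by simp
  finally show ?thesis by simp
qed

subsection \<open>The degenerate transport system\<close>

text \<open>The system \<open>U\<^sub>i\<^sub>\<tau> + \<tau> l\<^sub>i(\<tau>, y, V) U\<^sub>i\<^sub>y = \<tau> g\<^sub>i(\<tau>, y, V)\<close> for \<open>U = \<tau>\<^sup>2 V\<close>. Since \<open>\<integral> s ds = \<tau>\<^sup>2 / 2\<close>, integration along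
  characteristics halves the Lipschitz constant \<open>3 / 2\<close> of \<open>g\<close> in \<open>V\<close>; this is what makes the iteration contract.
  \<open>B0\<close>, \<open>B1\<close>, \<open>B2\<close> bound \<open>V\<close>, its Lipschitz constant in \<open>y\<close> and its second differences, and \<open>N\<close> weights the
  characteristics in the metric.\<close>

locale degenerate_transport =
  fixes J :: "nat set" and g l :: "nat \<Rightarrow> real \<Rightarrow> real \<Rightarrow> (nat \<Rightarrow> real) \<Rightarrow> real"
    and \<delta> K B0 B1 B2 N :: real
  assumes K: "K > 0" and B0: "B0 > 0"
    and B1_def: "B1 = 4 * K" and B2_def: "B2 = 6 * (K * (3 + 2 * B1\<^sup>2) + 2 * B1)"
    and N_def: "N = 4 * (K + 2 * B1) + 1"
    and \<delta>: "\<delta> > 0" and \<delta>_small: "\<delta>\<^sup>2 * (K * (3 + B1\<^sup>2 + B1 + 2 * B2 + N)) \<le> 1 / 10"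
    and g_bound: "\<And>i \<tau> y v. \<lbrakk>i \<in> J; \<tau> \<in> {0..\<delta>}; \<And>j. j \<in> J \<Longrightarrow> \<bar>v j\<bar> \<le> B0\<rbrakk> \<Longrightarrow> \<bar>g i \<tau> y v\<bar> \<le> 2 * B0"
    and g_lip: "\<And>i \<tau> y y' v v' d. \<lbrakk>i \<in> J; \<tau> \<in> {0..\<delta>}; \<And>j. j \<in> J \<Longrightarrow> \<bar>v j\<bar> \<le> B0; \<And>j. j \<in> J \<Longrightarrow> \<bar>v' j\<bar> \<le> B0;
        \<And>j. j \<in> J \<Longrightarrow> \<bar>v j - v' j\<bar> \<le> d\<rbrakk> \<Longrightarrow> \<bar>g i \<tau> y v - g i \<tau> y' v'\<bar> \<le> K * \<bar>y - y'\<bar> + 3 / 2 * d"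
    and g_sd: "\<And>i \<tau> y y' ym v v' vm dy dv ey ev. \<lbrakk>i \<in> J; \<tau> \<in> {0..\<delta>};
        \<And>j. j \<in> J \<Longrightarrow> \<bar>v j\<bar> \<le> B0; \<And>j. j \<in> J \<Longrightarrow> \<bar>v' j\<bar> \<le> B0; \<And>j. j \<in> J \<Longrightarrow> \<bar>vm j\<bar> \<le> B0;
        \<bar>y - ym\<bar> \<le> dy; \<bar>y' - ym\<bar> \<le> dy; \<bar>y + y' - 2 * ym\<bar> \<le> ey;
        \<And>j. j \<in> J \<Longrightarrow> \<bar>v j - vm j\<bar> \<le> dv; \<And>j. j \<in> J \<Longrightarrow> \<bar>v' j - vm j\<bar> \<le> dv;
        \<And>j. j \<in> J \<Longrightarrow> \<bar>v j + v' j - 2 * vm j\<bar> \<le> ev\<rbrakk> \<Longrightarrow>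
        \<bar>g i \<tau> y v + g i \<tau> y' v' - 2 * g i \<tau> ym vm\<bar> \<le> K * (dy\<^sup>2 + dv\<^sup>2 + ey) + 3 / 2 * ev"
    and l_bound: "\<And>i \<tau> y v. \<lbrakk>i \<in> J; \<tau> \<in> {0..\<delta>}; \<And>j. j \<in> J \<Longrightarrow> \<bar>v j\<bar> \<le> B0\<rbrakk> \<Longrightarrow> \<bar>l i \<tau> y v\<bar> \<le> K"
    and l_lip: "\<And>i \<tau> y y' v v' d. \<lbrakk>i \<in> J; \<tau> \<in> {0..\<delta>}; \<And>j. j \<in> J \<Longrightarrow> \<bar>v j\<bar> \<le> B0; \<And>j. j \<in> J \<Longrightarrow> \<bar>v' j\<bar> \<le> B0;
        \<And>j. j \<in> J \<Longrightarrow> \<bar>v j - v' j\<bar> \<le> d\<rbrakk> \<Longrightarrow> \<bar>l i \<tau> y v - l i \<tau> y' v'\<bar> \<le> K * (\<bar>y - y'\<bar> + d)"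
    and l_sd: "\<And>i \<tau> y y' ym v v' vm dy dv ey ev. \<lbrakk>i \<in> J; \<tau> \<in> {0..\<delta>};
        \<And>j. j \<in> J \<Longrightarrow> \<bar>v j\<bar> \<le> B0; \<And>j. j \<in> J \<Longrightarrow> \<bar>v' j\<bar> \<le> B0; \<And>j. j \<in> J \<Longrightarrow> \<bar>vm j\<bar> \<le> B0;
        \<bar>y - ym\<bar> \<le> dy; \<bar>y' - ym\<bar> \<le> dy; \<bar>y + y' - 2 * ym\<bar> \<le> ey;
        \<And>j. j \<in> J \<Longrightarrow> \<bar>v j - vm j\<bar> \<le> dv; \<And>j. j \<in> J \<Longrightarrow> \<bar>v' j - vm j\<bar> \<le> dv;
        \<And>j. j \<in> J \<Longrightarrow> \<bar>v j + v' j - 2 * vm j\<bar> \<le> ev\<rbrakk> \<Longrightarrow>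
        \<bar>l i \<tau> y v + l i \<tau> y' v' - 2 * l i \<tau> ym vm\<bar> \<le> K * (dy\<^sup>2 + dv\<^sup>2 + ey + ev)"
    and gl_cont: "\<And>i S t \<eta> v. \<lbrakk>i \<in> J; continuous_on S t; continuous_on S \<eta>; \<And>j. j \<in> J \<Longrightarrow> continuous_on S (v j);
        \<And>p. p \<in> S \<Longrightarrow> t p \<in> {0..\<delta>}; \<And>p j. p \<in> S \<Longrightarrow> j \<in> J \<Longrightarrow> \<bar>v j p\<bar> \<le> B0\<rbrakk> \<Longrightarrow>
        continuous_on (S :: (real \<times> real \<times> real) set) (\<lambda>p. g i (t p) (\<eta> p) (\<lambda>j. v j p)) \<and>
        continuous_on S (\<lambda>p. l i (t p) (\<eta> p) (\<lambda>j. v j p))"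
begin

section \<open>Estimates along characteristics\<close>

lemma constants_pos: "B1 > 0" "B2 > 0" "N > 1"
proof -
  show B1: "B1 > 0" using K by (simp add: B1_def)
  have "0 \<le> K * (3 + 2 * B1\<^sup>2)" using K by simp
  then show "B2 > 0" unfolding B2_def using B1 by (simp add: add_nonneg_pos)
  show "N > 1" unfolding N_def using B1 K by simp
qed

lemma scaled_time: "\<tau> \<in> {0..\<delta>} \<Longrightarrow> \<rho> \<in> {0..1} \<Longrightarrow> \<tau> * \<rho> \<in> {0..\<delta>}"
  using mult_mono[of \<tau> \<delta> \<rho> 1] by auto

text \<open>\<open>along h V X i (\<rho>, \<tau>, y)\<close> is \<open>\<rho> h\<^sub>i\<close> at time \<open>\<tau> \<rho>\<close> on the characteristic that ends in \<open>(\<tau>, y)\<close>: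
  time is rescaled by \<open>\<tau>\<close>, which makes the integral equations regular at \<open>\<tau> = 0\<close>.\<close>

definition along :: "(nat \<Rightarrow> real \<Rightarrow> real \<Rightarrow> (nat \<Rightarrow> real) \<Rightarrow> real) \<Rightarrow> (nat \<times> real \<times> real \<Rightarrow> real)
    \<Rightarrow> (nat \<times> real \<times> real \<times> real \<Rightarrow> real) \<Rightarrow> nat \<Rightarrow> real \<times> real \<times> real \<Rightarrow> real" where
  "along h V X i = (\<lambda>(\<rho>, \<tau>, y). \<rho> * h i (\<tau> * \<rho>) (X (i, \<rho>, \<tau>, y)) (\<lambda>j. V (j, \<tau> * \<rho>, X (i, \<rho>, \<tau>, y))))"

text \<open>The factor \<open>\<tau>\<^sup>2\<close> that s = \<tau> \<rho> produces in the integral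
  of s g ds is the one in U = \<open>\<tau>\<^sup>2\<close> V, so it cancels here. For the
  characteristics nothing cancels, and the remaining \<open>\<tau>\<^sup>2\<close> in
  \<open>TX\<close> is what makes their estimates small.\<close>

definition TV where
  "TV V X = (\<lambda>(i, \<tau>, y). integral {0..1} (\<lambda>\<rho>. along g V X i (\<rho>, \<tau>, y)))"

definition TX where
  "TX V X = (\<lambda>(i, \<sigma>, \<tau>, y). y - \<tau>\<^sup>2 * integral {\<sigma>..1} (\<lambda>\<rho>. along l V X i (\<rho>, \<tau>, y)))"

text \<open>The bounds for X leave room around the identity, whose Lipschitz constant is 1 and whose
  second differences vanish: one step of the iteration perturbs it by at most 1 / 10. All clauses
  are continuity or weak inequalities between finitely many values, hence closed under uniform
  limits.\<close>

definition admissible :: "(nat \<times> real \<times> real \<Rightarrow> real) \<Rightarrow> (nat \<times> real \<times> real \<times> real \<Rightarrow> real) \<Rightarrow> bool" where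
  "admissible V X \<longleftrightarrow> (\<forall>i\<in>J.
     continuous_on ({0..\<delta>} \<times> UNIV) (\<lambda>p. V (i, p)) \<and>
     continuous_on ({0..1} \<times> {0..\<delta>} \<times> UNIV) (\<lambda>p. X (i, p)) \<and>
     (\<forall>\<tau>\<in>{0..\<delta>}. (\<forall>y. \<bar>V (i, \<tau>, y)\<bar> \<le> B0) \<and>
        (\<forall>y y'. \<bar>V (i, \<tau>, y) - V (i, \<tau>, y')\<bar> \<le> B1 * \<bar>y - y'\<bar>) \<and>
        (\<forall>m h. \<bar>V (i, \<tau>, m + h) + V (i, \<tau>, m - h) - 2 * V (i, \<tau>, m)\<bar> \<le> B2 * h\<^sup>2) \<and>
        (\<forall>\<sigma>\<in>{0..1}. (\<forall>y y'. \<bar>X (i, \<sigma>, \<tau>, y) - X (i, \<sigma>, \<tau>, y')\<bar> \<le> 11 / 10 * \<bar>y - y'\<bar>) \<and>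
           (\<forall>m h. \<bar>X (i, \<sigma>, \<tau>, m + h) + X (i, \<sigma>, \<tau>, m - h) - 2 * X (i, \<sigma>, \<tau>, m)\<bar> \<le> h\<^sup>2))))"

context
  fixes V X assumes adm: "admissible V X"
begin

lemma V_cont: "i \<in> J \<Longrightarrow> continuous_on ({0..\<delta>} \<times> UNIV) (\<lambda>p. V (i, p))"
  and X_cont: "i \<in> J \<Longrightarrow> continuous_on ({0..1} \<times> {0..\<delta>} \<times> UNIV) (\<lambda>p. X (i, p))"
  and V_bound: "i \<in> J \<Longrightarrow> \<tau> \<in> {0..\<delta>} \<Longrightarrow> \<bar>V (i, \<tau>, y)\<bar> \<le> B0"
  and V_lip: "i \<in> J \<Longrightarrow> \<tau> \<in> {0..\<delta>} \<Longrightarrow> \<bar>V (i, \<tau>, y) - V (i, \<tau>, y')\<bar> \<le> B1 * \<bar>y - y'\<bar>"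
  and V_sd: "i \<in> J \<Longrightarrow> \<tau> \<in> {0..\<delta>} \<Longrightarrow> \<bar>V (i, \<tau>, m + h) + V (i, \<tau>, m - h) - 2 * V (i, \<tau>, m)\<bar> \<le> B2 * h\<^sup>2"
  and X_lip: "i \<in> J \<Longrightarrow> \<tau> \<in> {0..\<delta>} \<Longrightarrow> \<sigma> \<in> {0..1} \<Longrightarrow> \<bar>X (i, \<sigma>, \<tau>, y) - X (i, \<sigma>, \<tau>, y')\<bar> \<le> 11 / 10 * \<bar>y - y'\<bar>"
  and X_sd: "i \<in> J \<Longrightarrow> \<tau> \<in> {0..\<delta>} \<Longrightarrow> \<sigma> \<in> {0..1} \<Longrightarrow>
    \<bar>X (i, \<sigma>, \<tau>, m + h) + X (i, \<sigma>, \<tau>, m - h) - 2 * X (i, \<sigma>, \<tau>, m)\<bar> \<le> h\<^sup>2"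
  using adm unfolding admissible_def by simp_all

text \<open>Characteristics carry a symmetric triple to one that is only nearly symmetric. With q
  the true midpoint of p and p', the second difference around q costs \<open>B2 * r\<^sup>2\<close>,
  and moving the centre from q to m costs \<open>2 * B1 * \<bar>q - m\<bar>\<close>, at most
  \<open>B1 * s\<close>.\<close>

lemma V_sd_triple:
  assumes i: "i \<in> J" and \<tau>: "\<tau> \<in> {0..\<delta>}" and r: "\<bar>p - p'\<bar> \<le> 2 * r" and s: "\<bar>p + p' - 2 * m\<bar> \<le> s"
  shows "\<bar>V (i, \<tau>, p) + V (i, \<tau>, p') - 2 * V (i, \<tau>, m)\<bar> \<le> B2 * r\<^sup>2 + B1 * s"
proof -
  define q where "q = (p + p') / 2"
  define h where "h = (p - p') / 2"
  have pq: "p = q + h" "p' = q - h" by (simp_all add: q_def h_def field_simps)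
  have "\<bar>V (i, \<tau>, p) + V (i, \<tau>, p') - 2 * V (i, \<tau>, q)\<bar> \<le> B2 * h\<^sup>2" unfolding pq by (rule V_sd[OF i \<tau>])
  also have "\<dots> \<le> B2 * r\<^sup>2"
  proof -
    have "\<bar>h\<bar> \<le> r" using r by (simp add: h_def)
    then have "h\<^sup>2 \<le> r\<^sup>2" by (simp flip: abs_le_square_iff)
    then show ?thesis using constants_pos by simp
  qed
  finally have 1: "\<bar>V (i, \<tau>, p) + V (i, \<tau>, p') - 2 * V (i, \<tau>, q)\<bar> \<le> B2 * r\<^sup>2" .
  have "2 * \<bar>V (i, \<tau>, q) - V (i, \<tau>, m)\<bar> \<le> B1 * (2 * \<bar>q - m\<bar>)" using V_lip[OF i \<tau>, of q m] by simp
  also have "\<dots> \<le> B1 * s"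
  proof (rule mult_left_mono)
    have "2 * (q - m) = p + p' - 2 * m" by (simp add: q_def)
    then show "2 * \<bar>q - m\<bar> \<le> s" using s by linarith
  qed (use constants_pos in simp)
  finally have 2: "\<bar>2 * (V (i, \<tau>, q) - V (i, \<tau>, m))\<bar> \<le> B1 * s" by (simp only: abs_mult abs_numeral)
  have "V (i, \<tau>, p) + V (i, \<tau>, p') - 2 * V (i, \<tau>, m) =
      (V (i, \<tau>, p) + V (i, \<tau>, p') - 2 * V (i, \<tau>, q)) + 2 * (V (i, \<tau>, q) - V (i, \<tau>, m))" by simp
  then show ?thesis using order_trans[OF abs_triangle_ineq add_mono[OF 1 2]] by (simp only:)
qed

lemma along_cont:
  assumes i: "i \<in> J"
  shows "continuous_on ({0..1} \<times> {0..\<delta>} \<times> UNIV) (along g V X i)"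
    and "continuous_on ({0..1} \<times> {0..\<delta>} \<times> UNIV) (along l V X i)"
proof -
  let ?S = "{0..1::real} \<times> {0..\<delta>} \<times> (UNIV :: real set)"
  have t: "continuous_on ?S (\<lambda>p. fst (snd p) * fst p)" by (intro continuous_intros)
  note x = X_cont[OF i]
  have tp: "fst (snd p) * fst p \<in> {0..\<delta>}" if "p \<in> ?S" for p
    using that scaled_time[of "fst (snd p)" "fst p"] by auto
  have v: "continuous_on ?S (\<lambda>p. V (j, fst (snd p) * fst p, X (i, p)))" if "j \<in> J" for j
    by (rule continuous_on_compose2[OF V_cont[OF that], of _ "\<lambda>p. (fst (snd p) * fst p, X (i, p))"])
      (use tp in \<open>auto intro!: continuous_on_Pair t x\<close>)
  have "continuous_on ?S (\<lambda>p. g i (fst (snd p) * fst p) (X (i, p)) (\<lambda>j. V (j, fst (snd p) * fst p, X (i, p)))) \<and>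
    continuous_on ?S (\<lambda>p. l i (fst (snd p) * fst p) (X (i, p)) (\<lambda>j. V (j, fst (snd p) * fst p, X (i, p))))"
    by (rule gl_cont[OF i t x]) (fact v, fact tp, rule V_bound[OF _ tp])
  then show "continuous_on ?S (along g V X i)" "continuous_on ?S (along l V X i)"
    unfolding along_def split_beta by (auto intro!: continuous_intros)
qed

lemma along_cont_slice:
  assumes "i \<in> J" "\<tau> \<in> {0..\<delta>}" "\<sigma> \<ge> 0"
  shows "continuous_on {\<sigma>..1} (\<lambda>\<rho>. along g V X i (\<rho>, \<tau>, y))"
    and "continuous_on {\<sigma>..1} (\<lambda>\<rho>. along l V X i (\<rho>, \<tau>, y))"
proof -
  have c: "continuous_on {\<sigma>..1} (\<lambda>\<rho>. (\<rho>, \<tau>, y))" by (intro continuous_intros)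
  have m: "(\<lambda>\<rho>. (\<rho>, \<tau>, y)) ` {\<sigma>..1} \<subseteq> {0..1} \<times> {0..\<delta>} \<times> UNIV" using assms by auto
  show "continuous_on {\<sigma>..1} (\<lambda>\<rho>. along g V X i (\<rho>, \<tau>, y))" "continuous_on {\<sigma>..1} (\<lambda>\<rho>. along l V X i (\<rho>, \<tau>, y))"
    by (rule continuous_on_compose2[OF along_cont(1)[OF assms(1)] c m],
        rule continuous_on_compose2[OF along_cont(2)[OF assms(1)] c m])
qed

lemma TV_cont: "i \<in> J \<Longrightarrow> continuous_on ({0..\<delta>} \<times> UNIV) (\<lambda>p. TV V X (i, p))"
proof -
  assume i: "i \<in> J"
  have "continuous_on (({0..\<delta>} \<times> UNIV) \<times> cbox 0 1) (\<lambda>(p, \<rho>). along g V X i (\<rho>, p))"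
    unfolding split_beta
    by (rule continuous_on_compose2[OF along_cont(1)[OF i]]) (auto intro!: continuous_intros)
  from integral_continuous_on_param[OF this] show ?thesis
    by (simp add: TV_def split_beta)
qed

text \<open>The variable end point is moved into the integrand:
  \<open>\<integral>\<^bsub>\<sigma>\<^esub>\<^bsup>1\<^esup> f = \<integral>\<^bsub>0\<^esub>\<^bsup>1\<^esup> f (max \<sigma> \<rho>) d\<rho> - \<sigma> f(\<sigma>)\<close>.\<close>

lemma TX_cont: "i \<in> J \<Longrightarrow> continuous_on ({0..1} \<times> {0..\<delta>} \<times> UNIV) (\<lambda>p. TX V X (i, p))"
proof -
  assume i: "i \<in> J"
  let ?S = "{0..1::real} \<times> {0..\<delta>} \<times> (UNIV :: real set)"
  have "continuous_on (?S \<times> cbox 0 1) (\<lambda>(p, \<rho>). along l V X i (max (fst p) \<rho>, snd p))"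
    unfolding split_beta
    by (rule continuous_on_compose2[OF along_cont(2)[OF i]]) (auto intro!: continuous_intros)
  from integral_continuous_on_param[OF this]
  have 1: "continuous_on ?S (\<lambda>p. integral {0..1} (\<lambda>\<rho>. along l V X i (max (fst p) \<rho>, snd p)))" by simp
  have eq: "integral {fst p..1} (\<lambda>\<rho>. along l V X i (\<rho>, snd p)) =
      integral {0..1} (\<lambda>\<rho>. along l V X i (max (fst p) \<rho>, snd p)) - fst p * along l V X i p" if p: "p \<in> ?S" for p
  proof -
    obtain \<sigma> \<tau> y where pe: "p = (\<sigma>, \<tau>, y)" by (cases p) auto
    have s: "0 \<le> \<sigma>" "\<sigma> \<le> 1" "\<tau> \<in> {0..\<delta>}" using p pe by auto
    let ?f = "\<lambda>\<rho>. along l V X i (max \<sigma> \<rho>, \<tau>, y)"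
    have "continuous_on {0..1} ?f"
      by (rule continuous_on_compose2[OF along_cont(2)[OF i]]) (use s in \<open>auto intro!: continuous_intros\<close>)
    then have "integral {0..\<sigma>} ?f + integral {\<sigma>..1} ?f = integral {0..1} ?f"
      by (intro Henstock_Kurzweil_Integration.integral_combine[OF s(1,2)] integrable_continuous_real)
    moreover have "integral {0..\<sigma>} ?f = integral {0..\<sigma>} (\<lambda>_. along l V X i p)"
      by (rule integral_cong) (simp add: pe max_absorb1)
    moreover have "integral {\<sigma>..1} ?f = integral {\<sigma>..1} (\<lambda>\<rho>. along l V X i (\<rho>, \<tau>, y))"
      by (rule integral_cong) (simp add: max_absorb2)
    ultimately show ?thesis using s by (simp add: pe)
  qed
  have "continuous_on ?S (\<lambda>p. snd (snd p) - (fst (snd p))\<^sup>2 * (integral {0..1} (\<lambda>\<rho>. along l V X i (max (fst p) \<rho>, snd p)) - fst p * along l V X i p))"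
    by (intro continuous_intros 1 along_cont(2)[OF i])
  then show ?thesis
  proof (rule continuous_on_eq)
    fix p assume "p \<in> ?S"
    from eq[OF this] show "snd (snd p) - (fst (snd p))\<^sup>2 * (integral {0..1} (\<lambda>\<rho>. along l V X i (max (fst p) \<rho>, snd p)) - fst p * along l V X i p) = TX V X (i, p)"
      by (simp add: TX_def split_beta)
  qed
qed

lemma along_bound:
  assumes i: "i \<in> J" and \<tau>: "\<tau> \<in> {0..\<delta>}" and \<rho>: "\<rho> \<in> {0..1}"
  shows "\<bar>along g V X i (\<rho>, \<tau>, y)\<bar> \<le> \<rho> * (2 * B0)" and "\<bar>along l V X i (\<rho>, \<tau>, y)\<bar> \<le> \<rho> * K"
proof -
  have \<rho>0: "\<rho> \<ge> 0" using \<rho> by simp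
  show "\<bar>along g V X i (\<rho>, \<tau>, y)\<bar> \<le> \<rho> * (2 * B0)" "\<bar>along l V X i (\<rho>, \<tau>, y)\<bar> \<le> \<rho> * K"
    unfolding along_def split_conv abs_mult abs_of_nonneg[OF \<rho>0]
    by (intro mult_left_mono[OF _ \<rho>0] g_bound l_bound i scaled_time[OF \<tau> \<rho>] V_bound; assumption)+
qed

lemma along_lip:
  assumes i: "i \<in> J" and \<tau>: "\<tau> \<in> {0..\<delta>}" and \<rho>: "\<rho> \<in> {0..1}"
  shows "\<bar>along g V X i (\<rho>, \<tau>, y) - along g V X i (\<rho>, \<tau>, y')\<bar> \<le> \<rho> * (2 * (B1 * \<bar>y - y'\<bar>))"
    and "\<bar>along l V X i (\<rho>, \<tau>, y) - along l V X i (\<rho>, \<tau>, y')\<bar> \<le> \<rho> * (11 / 10 * K * (1 + B1) * \<bar>y - y'\<bar>)"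
proof -
  have \<rho>0: "\<rho> \<ge> 0" using \<rho> by simp
  let ?x = "X (i, \<rho>, \<tau>, y)" and ?x' = "X (i, \<rho>, \<tau>, y')"
  note x = X_lip[OF i \<tau> \<rho>, of y y']
  have v: "\<bar>V (j, \<tau> * \<rho>, ?x) - V (j, \<tau> * \<rho>, ?x')\<bar> \<le> B1 * (11 / 10 * \<bar>y - y'\<bar>)" if "j \<in> J" for j
    using V_lip[OF that scaled_time[OF \<tau> \<rho>], of ?x ?x'] mult_left_mono[OF x, of B1] constants_pos by linarith
  note vb = V_bound[OF _ scaled_time[OF \<tau> \<rho>]]
  have "\<bar>g i (\<tau> * \<rho>) ?x (\<lambda>j. V (j, \<tau> * \<rho>, ?x)) - g i (\<tau> * \<rho>) ?x' (\<lambda>j. V (j, \<tau> * \<rho>, ?x'))\<bar>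
      \<le> K * \<bar>?x - ?x'\<bar> + 3 / 2 * (B1 * (11 / 10 * \<bar>y - y'\<bar>))"
    by (rule g_lip[OF i scaled_time[OF \<tau> \<rho>]]) ((rule vb v, assumption)+)
  also have "\<dots> \<le> K * (11 / 10 * \<bar>y - y'\<bar>) + 3 / 2 * (B1 * (11 / 10 * \<bar>y - y'\<bar>))"
    using mult_left_mono[OF x, of K] K by simp
  \<comment> \<open>This is what \<open>B1 = 4 * K\<close> is for: the left side is 7.7 K and the
    right side 8 K, times the distance.\<close>
  also have "\<dots> \<le> 2 * (B1 * \<bar>y - y'\<bar>)"
    using K by (simp add: B1_def)
  finally show "\<bar>along g V X i (\<rho>, \<tau>, y) - along g V X i (\<rho>, \<tau>, y')\<bar> \<le> \<rho> * (2 * (B1 * \<bar>y - y'\<bar>))"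
    unfolding along_def split_conv right_diff_distrib[symmetric] abs_mult abs_of_nonneg[OF \<rho>0]
    by (rule mult_left_mono[OF _ \<rho>0])
  have "\<bar>l i (\<tau> * \<rho>) ?x (\<lambda>j. V (j, \<tau> * \<rho>, ?x)) - l i (\<tau> * \<rho>) ?x' (\<lambda>j. V (j, \<tau> * \<rho>, ?x'))\<bar>
      \<le> K * (\<bar>?x - ?x'\<bar> + B1 * (11 / 10 * \<bar>y - y'\<bar>))"
    by (rule l_lip[OF i scaled_time[OF \<tau> \<rho>]]) ((rule vb v, assumption)+)
  also have "\<dots> \<le> K * (11 / 10 * \<bar>y - y'\<bar> + B1 * (11 / 10 * \<bar>y - y'\<bar>))"
    using x K by (intro mult_left_mono) auto
  also have "\<dots> = 11 / 10 * K * (1 + B1) * \<bar>y - y'\<bar>" by (simp add: algebra_simps)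
  finally show "\<bar>along l V X i (\<rho>, \<tau>, y) - along l V X i (\<rho>, \<tau>, y')\<bar> \<le> \<rho> * (11 / 10 * K * (1 + B1) * \<bar>y - y'\<bar>)"
    unfolding along_def split_conv right_diff_distrib[symmetric] abs_mult abs_of_nonneg[OF \<rho>0]
    by (rule mult_left_mono[OF _ \<rho>0])
qed

text \<open>The three characteristic points have spread \<open>11 / 10 * \<bar>h\<bar>\<close> and
  asymmetry at most \<open>h\<^sup>2\<close>; these are the step sizes fed into \<open>g_sd\<close>
  and \<open>l_sd\<close>.\<close>

lemma along_sd:
  assumes i: "i \<in> J" and \<tau>: "\<tau> \<in> {0..\<delta>}" and \<rho>: "\<rho> \<in> {0..1}"
  shows "\<bar>along g V X i (\<rho>, \<tau>, m + h) + along g V X i (\<rho>, \<tau>, m - h) - 2 * along g V X i (\<rho>, \<tau>, m)\<bar> \<le> \<rho> * (2 * (B2 * h\<^sup>2))"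
    and "\<bar>along l V X i (\<rho>, \<tau>, m + h) + along l V X i (\<rho>, \<tau>, m - h) - 2 * along l V X i (\<rho>, \<tau>, m)\<bar>
      \<le> \<rho> * (K * (3 + 2 * B1\<^sup>2 + B1 + 2 * B2) * h\<^sup>2)"
proof -
  have \<rho>0: "\<rho> \<ge> 0" using \<rho> by simp
  let ?p = "X (i, \<rho>, \<tau>, m + h)" and ?q = "X (i, \<rho>, \<tau>, m - h)" and ?m = "X (i, \<rho>, \<tau>, m)"
  let ?r = "11 / 10 * \<bar>h\<bar>"
  have pm: "\<bar>?p - ?m\<bar> \<le> ?r" "\<bar>?q - ?m\<bar> \<le> ?r" "\<bar>?p - ?q\<bar> \<le> 2 * ?r"
    using X_lip[OF i \<tau> \<rho>, of "m + h" m] X_lip[OF i \<tau> \<rho>, of "m - h" m] X_lip[OF i \<tau> \<rho>, of "m + h" "m - h"] by auto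
  note e = X_sd[OF i \<tau> \<rho>, of m h]
  note vb = V_bound[OF _ scaled_time[OF \<tau> \<rho>]]
  have B: "B1 > 0" "B2 > 0" using constants_pos by auto
  have v: "\<bar>V (j, \<tau> * \<rho>, ?p) - V (j, \<tau> * \<rho>, ?m)\<bar> \<le> B1 * ?r" "\<bar>V (j, \<tau> * \<rho>, ?q) - V (j, \<tau> * \<rho>, ?m)\<bar> \<le> B1 * ?r"
    if "j \<in> J" for j
    using V_lip[OF that scaled_time[OF \<tau> \<rho>], of ?p ?m] mult_left_mono[OF pm(1), of B1]
      V_lip[OF that scaled_time[OF \<tau> \<rho>], of ?q ?m] mult_left_mono[OF pm(2), of B1] B by linarith+
  have v2: "\<bar>V (j, \<tau> * \<rho>, ?p) + V (j, \<tau> * \<rho>, ?q) - 2 * V (j, \<tau> * \<rho>, ?m)\<bar> \<le> B2 * ?r\<^sup>2 + B1 * h\<^sup>2" if "j \<in> J" for j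
    by (rule V_sd_triple[OF that scaled_time[OF \<tau> \<rho>] pm(3) e])
  have r2: "?r\<^sup>2 = 121 / 100 * h\<^sup>2" "(B1 * ?r)\<^sup>2 = B1\<^sup>2 * (121 / 100 * h\<^sup>2)"
    by (simp_all add: power_mult_distrib power2_eq_square)
  have "\<bar>g i (\<tau> * \<rho>) ?p (\<lambda>j. V (j, \<tau> * \<rho>, ?p)) + g i (\<tau> * \<rho>) ?q (\<lambda>j. V (j, \<tau> * \<rho>, ?q))
      - 2 * g i (\<tau> * \<rho>) ?m (\<lambda>j. V (j, \<tau> * \<rho>, ?m))\<bar>
      \<le> K * (?r\<^sup>2 + (B1 * ?r)\<^sup>2 + h\<^sup>2) + 3 / 2 * (B2 * ?r\<^sup>2 + B1 * h\<^sup>2)"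
    by (rule g_sd[OF i scaled_time[OF \<tau> \<rho>]]) ((rule pm e | rule vb v v2, assumption)+)
  also have "\<dots> = (K * (221 / 100 + 121 / 100 * B1\<^sup>2) + 3 / 2 * B1 + 363 / 200 * B2) * h\<^sup>2"
    unfolding r2 by (simp add: algebra_simps)
  \<comment> \<open>The coefficient of \<open>B2\<close> on the left is 363 / 200 < 2. The surplus
    of 37 / 200 times \<open>B2\<close> absorbs the terms without \<open>B2\<close>, which
    determines how large \<open>B2\<close> was chosen.\<close>
  also have "\<dots> \<le> (2 * B2) * h\<^sup>2"
  proof (rule mult_right_mono)
    have "0 \<le> K * B1\<^sup>2" using K by simp
    moreover have "K * (221 / 100 + 121 / 100 * B1\<^sup>2) = 221 / 100 * K + 121 / 100 * (K * B1\<^sup>2)"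
      "B2 = 18 * K + 12 * (K * B1\<^sup>2) + 12 * B1"
      unfolding B2_def by algebra+
    ultimately show "K * (221 / 100 + 121 / 100 * B1\<^sup>2) + 3 / 2 * B1 + 363 / 200 * B2 \<le> 2 * B2"
      using K B by linarith
  qed simp
  finally have *: "\<bar>g i (\<tau> * \<rho>) ?p (\<lambda>j. V (j, \<tau> * \<rho>, ?p)) + g i (\<tau> * \<rho>) ?q (\<lambda>j. V (j, \<tau> * \<rho>, ?q))
      - 2 * g i (\<tau> * \<rho>) ?m (\<lambda>j. V (j, \<tau> * \<rho>, ?m))\<bar> \<le> 2 * (B2 * h\<^sup>2)" by simp
  have weight: "\<bar>\<rho> * A + \<rho> * B - 2 * (\<rho> * C)\<bar> = \<rho> * \<bar>A + B - 2 * C\<bar>" for A B C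
  proof -
    have "\<rho> * A + \<rho> * B - 2 * (\<rho> * C) = \<rho> * (A + B - 2 * C)" by (simp add: algebra_simps)
    then show ?thesis using \<rho>0 by (simp add: abs_mult)
  qed
  show "\<bar>along g V X i (\<rho>, \<tau>, m + h) + along g V X i (\<rho>, \<tau>, m - h) - 2 * along g V X i (\<rho>, \<tau>, m)\<bar> \<le> \<rho> * (2 * (B2 * h\<^sup>2))"
    unfolding along_def split_conv weight by (rule mult_left_mono[OF * \<rho>0])
  have "\<bar>l i (\<tau> * \<rho>) ?p (\<lambda>j. V (j, \<tau> * \<rho>, ?p)) + l i (\<tau> * \<rho>) ?q (\<lambda>j. V (j, \<tau> * \<rho>, ?q))
      - 2 * l i (\<tau> * \<rho>) ?m (\<lambda>j. V (j, \<tau> * \<rho>, ?m))\<bar>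
      \<le> K * (?r\<^sup>2 + (B1 * ?r)\<^sup>2 + h\<^sup>2 + (B2 * ?r\<^sup>2 + B1 * h\<^sup>2))"
    by (rule l_sd[OF i scaled_time[OF \<tau> \<rho>]]) ((rule pm e | rule vb v v2, assumption)+)
  also have "\<dots> = K * (221 / 100 + 121 / 100 * B1\<^sup>2 + B1 + 121 / 100 * B2) * h\<^sup>2"
    unfolding r2 by (simp add: algebra_simps)
  also have "\<dots> \<le> K * (3 + 2 * B1\<^sup>2 + B1 + 2 * B2) * h\<^sup>2"
    using K B zero_le_power2[of B1] by (intro mult_right_mono mult_left_mono zero_le_power2) linarith+
  finally have *: "\<bar>l i (\<tau> * \<rho>) ?p (\<lambda>j. V (j, \<tau> * \<rho>, ?p)) + l i (\<tau> * \<rho>) ?q (\<lambda>j. V (j, \<tau> * \<rho>, ?q))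
      - 2 * l i (\<tau> * \<rho>) ?m (\<lambda>j. V (j, \<tau> * \<rho>, ?m))\<bar> \<le> K * (3 + 2 * B1\<^sup>2 + B1 + 2 * B2) * h\<^sup>2" .
  show "\<bar>along l V X i (\<rho>, \<tau>, m + h) + along l V X i (\<rho>, \<tau>, m - h) - 2 * along l V X i (\<rho>, \<tau>, m)\<bar>
      \<le> \<rho> * (K * (3 + 2 * B1\<^sup>2 + B1 + 2 * B2) * h\<^sup>2)"
    unfolding along_def split_conv weight by (rule mult_left_mono[OF * \<rho>0])
qed

end

end

context degenerate_transport
begin

section \<open>Invariance, contraction and the fixed point\<close>

lemma small_factor:
  assumes "\<tau> \<in> {0..\<delta>}" "0 \<le> c" "c \<le> K * (3 + B1\<^sup>2 + B1 + 2 * B2 + N)"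
  shows "\<tau>\<^sup>2 * c \<le> 1 / 10"
proof -
  have "\<tau>\<^sup>2 * c \<le> \<delta>\<^sup>2 * (K * (3 + B1\<^sup>2 + B1 + 2 * B2 + N))"
    using assms by (intro mult_mono power_mono) auto
  then show ?thesis using \<delta>_small by simp
qed

text \<open>The factors by which the integral in \<open>TX\<close> changes the Lipschitz constant,
  the second differences and the distance of characteristics. In the third, N appears because a
  distance d between the functions V is N times the weighted distance between the
  characteristics.\<close>

lemma smallness:
  assumes "\<tau> \<in> {0..\<delta>}"
  shows "\<tau>\<^sup>2 * (11 / 10 * K * (1 + B1) / 2) \<le> 1 / 10" "\<tau>\<^sup>2 * (K * (3 + 2 * B1\<^sup>2 + B1 + 2 * B2) / 2) \<le> 1 / 10"
    "\<tau>\<^sup>2 * (K * (1 + N + B1) / 2) \<le> 1 / 10"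
proof -
  note c = constants_pos
  have "11 / 10 * K * (1 + B1) / 2 = K * (11 / 20 + 11 / 20 * B1)" by (simp add: field_simps)
  then show "\<tau>\<^sup>2 * (11 / 10 * K * (1 + B1) / 2) \<le> 1 / 10"
    using c K by (intro small_factor[OF assms]) (auto intro!: mult_left_mono add_increasing2)
  have "K * (3 + 2 * B1\<^sup>2 + B1 + 2 * B2) / 2 = K * (3 / 2 + B1\<^sup>2 + B1 / 2 + B2)" by (simp add: field_simps)
  moreover have "3 / 2 + B1\<^sup>2 + B1 / 2 + B2 \<le> 3 + B1\<^sup>2 + B1 + 2 * B2 + N" using c by linarith
  ultimately show "\<tau>\<^sup>2 * (K * (3 + 2 * B1\<^sup>2 + B1 + 2 * B2) / 2) \<le> 1 / 10"
    using c K by (intro small_factor[OF assms]) auto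
  have "K * (1 + N + B1) / 2 = K * (1 / 2 + N / 2 + B1 / 2)" by (simp add: field_simps)
  moreover have "1 / 2 + N / 2 + B1 / 2 \<le> 3 + B1\<^sup>2 + B1 + 2 * B2 + N" using c zero_le_power2[of B1] by linarith
  ultimately show "\<tau>\<^sup>2 * (K * (1 + N + B1) / 2) \<le> 1 / 10"
    using c K by (intro small_factor[OF assms]) auto
qed

context
  fixes V X assumes adm: "admissible V X"
begin

lemma along_integrable:
  assumes "i \<in> J" "\<tau> \<in> {0..\<delta>}" "\<sigma> \<ge> 0"
  shows "(\<lambda>\<rho>. along g V X i (\<rho>, \<tau>, y)) integrable_on {\<sigma>..1}" "(\<lambda>\<rho>. along l V X i (\<rho>, \<tau>, y)) integrable_on {\<sigma>..1}"
  by (intro integrable_continuous_real along_cont_slice[OF adm assms])+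

text \<open>Serves to bound the first increment of the iteration: characteristics are unbounded
  functions of y, but their displacement is not.\<close>

lemma TX_dist_bound:
  assumes "i \<in> J" "\<tau> \<in> {0..\<delta>}" "\<sigma> \<in> {0..1}"
  shows "\<bar>TX V X (i, \<sigma>, \<tau>, y) - y\<bar> \<le> 1"
proof -
  have "\<bar>integral {\<sigma>..1} (\<lambda>\<rho>. along l V X i (\<rho>, \<tau>, y))\<bar> \<le> K / 2"
    by (rule weighted_integral_bound[OF along_cont_slice(2)[OF adm]]) (use assms along_bound(2)[OF adm] in auto)
  then have "\<tau>\<^sup>2 * \<bar>integral {\<sigma>..1} (\<lambda>\<rho>. along l V X i (\<rho>, \<tau>, y))\<bar> \<le> \<tau>\<^sup>2 * (K / 2)" by (rule mult_left_mono) simp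
  also have "\<dots> \<le> 1 / 10"
  proof (rule small_factor[OF assms(2)])
    have "K * (1 / 2) \<le> K * (3 + B1\<^sup>2 + B1 + 2 * B2 + N)"
      using K constants_pos zero_le_power2[of B1] by (intro mult_left_mono) linarith+
    then show "K / 2 \<le> K * (3 + B1\<^sup>2 + B1 + 2 * B2 + N)" by simp
  qed (use K in simp)
  finally show ?thesis by (simp add: TX_def abs_mult)
qed

text \<open>The integrands of \<open>TV\<close> obey twice the bounds demanded of V, and the weight
  halves them; the bounds for X survive because the perturbation of the identity carries
  \<open>\<tau>\<^sup>2\<close>.\<close>

lemma admissible_step: "admissible (TV V X) (TX V X)"
  unfolding admissible_def
proof (intro ballI conjI allI)
  fix i assume i: "i \<in> J"
  show "continuous_on ({0..\<delta>} \<times> UNIV) (\<lambda>p. TV V X (i, p))" by (rule TV_cont[OF adm i])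
  show "continuous_on ({0..1} \<times> {0..\<delta>} \<times> UNIV) (\<lambda>p. TX V X (i, p))" by (rule TX_cont[OF adm i])
  fix \<tau> assume \<tau>: "\<tau> \<in> {0..\<delta>}"
  have c: "continuous_on {\<sigma>..1} (\<lambda>\<rho>. along g V X i (\<rho>, \<tau>, y))" "continuous_on {\<sigma>..1} (\<lambda>\<rho>. along l V X i (\<rho>, \<tau>, y))" if "\<sigma> \<ge> 0" for \<sigma> y
    using along_cont_slice[OF adm i \<tau> that] by auto
  note int = along_integrable[OF i \<tau>]
  show "\<bar>TV V X (i, \<tau>, y)\<bar> \<le> B0" for y
    using weighted_integral_bound[OF c(1)[of 0 y], of "2 * B0"] along_bound(1)[OF adm i \<tau>] by (simp add: TV_def)
  show "\<bar>TV V X (i, \<tau>, y) - TV V X (i, \<tau>, y')\<bar> \<le> B1 * \<bar>y - y'\<bar>" for y y'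
  proof -
    have "\<bar>integral {0..1} (\<lambda>\<rho>. along g V X i (\<rho>, \<tau>, y) - along g V X i (\<rho>, \<tau>, y'))\<bar> \<le> (2 * (B1 * \<bar>y - y'\<bar>)) / 2"
      by (rule weighted_integral_bound) (auto intro!: continuous_intros c along_lip(1)[OF adm i \<tau>])
    then show ?thesis by (simp add: TV_def integral_diff[OF int(1) int(1)])
  qed
  show "\<bar>TV V X (i, \<tau>, m + h) + TV V X (i, \<tau>, m - h) - 2 * TV V X (i, \<tau>, m)\<bar> \<le> B2 * h\<^sup>2" for m h
  proof -
    have "\<bar>integral {0..1} (\<lambda>\<rho>. along g V X i (\<rho>, \<tau>, m + h) + along g V X i (\<rho>, \<tau>, m - h) - 2 * along g V X i (\<rho>, \<tau>, m))\<bar> \<le> (2 * (B2 * h\<^sup>2)) / 2"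
      by (rule weighted_integral_bound) (auto intro!: continuous_intros c along_sd(1)[OF adm i \<tau>])
    moreover have "integral {0..1} (\<lambda>\<rho>. along g V X i (\<rho>, \<tau>, m + h) + along g V X i (\<rho>, \<tau>, m - h) - 2 * along g V X i (\<rho>, \<tau>, m))
      = TV V X (i, \<tau>, m + h) + TV V X (i, \<tau>, m - h) - 2 * TV V X (i, \<tau>, m)"
      unfolding TV_def split_conv
      by (subst integral_diff integral_add integral_mult_right; auto intro!: integrable_continuous_real continuous_intros c)+
    ultimately show ?thesis by simp
  qed
  fix \<sigma> assume \<sigma>: "\<sigma> \<in> {0..1::real}"
  then have \<sigma>0: "\<sigma> \<ge> 0" "\<sigma> \<le> 1" by auto
  show "\<bar>TX V X (i, \<sigma>, \<tau>, y) - TX V X (i, \<sigma>, \<tau>, y')\<bar> \<le> 11 / 10 * \<bar>y - y'\<bar>" for y y'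
  proof -
    let ?I = "integral {\<sigma>..1} (\<lambda>\<rho>. along l V X i (\<rho>, \<tau>, y) - along l V X i (\<rho>, \<tau>, y'))"
    have "\<bar>?I\<bar> \<le> (11 / 10 * K * (1 + B1) * \<bar>y - y'\<bar>) / 2"
      by (rule weighted_integral_bound[OF _ \<sigma>0])
        (use \<sigma>0 in \<open>auto intro!: continuous_intros c along_lip(2)[OF adm i \<tau>] simp del: times_divide_eq_left\<close>)
    then have "\<tau>\<^sup>2 * \<bar>?I\<bar> \<le> \<tau>\<^sup>2 * ((11 / 10 * K * (1 + B1) * \<bar>y - y'\<bar>) / 2)" by (rule mult_left_mono) simp
    also have "\<dots> = (\<tau>\<^sup>2 * (11 / 10 * K * (1 + B1) / 2)) * \<bar>y - y'\<bar>" by simp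
    also have "\<dots> \<le> 1 / 10 * \<bar>y - y'\<bar>" using smallness(1)[OF \<tau>] by (rule mult_right_mono) simp
    finally have s: "\<bar>\<tau>\<^sup>2 * ?I\<bar> \<le> 1 / 10 * \<bar>y - y'\<bar>" by (simp add: abs_mult)
    have "TX V X (i, \<sigma>, \<tau>, y) - TX V X (i, \<sigma>, \<tau>, y') = (y - y') - \<tau>\<^sup>2 * ?I"
      by (simp add: TX_def integral_diff[OF int(2) int(2)] \<sigma>0 algebra_simps)
    then have "\<bar>TX V X (i, \<sigma>, \<tau>, y) - TX V X (i, \<sigma>, \<tau>, y')\<bar> \<le> \<bar>y - y'\<bar> + 1 / 10 * \<bar>y - y'\<bar>"
      using order_trans[OF abs_triangle_ineq4 add_left_mono[OF s]] by (simp only:)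
    then show ?thesis by simp
  qed
  show "\<bar>TX V X (i, \<sigma>, \<tau>, m + h) + TX V X (i, \<sigma>, \<tau>, m - h) - 2 * TX V X (i, \<sigma>, \<tau>, m)\<bar> \<le> h\<^sup>2" for m h
  proof -
    let ?I = "integral {\<sigma>..1} (\<lambda>\<rho>. along l V X i (\<rho>, \<tau>, m + h) + along l V X i (\<rho>, \<tau>, m - h) - 2 * along l V X i (\<rho>, \<tau>, m))"
    have "\<bar>?I\<bar> \<le> (K * (3 + 2 * B1\<^sup>2 + B1 + 2 * B2) * h\<^sup>2) / 2"
      by (rule weighted_integral_bound[OF _ \<sigma>0])
        (use \<sigma>0 in \<open>auto intro!: continuous_intros c along_sd(2)[OF adm i \<tau>]\<close>)
    then have "\<tau>\<^sup>2 * \<bar>?I\<bar> \<le> \<tau>\<^sup>2 * ((K * (3 + 2 * B1\<^sup>2 + B1 + 2 * B2) * h\<^sup>2) / 2)" by (rule mult_left_mono) simp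
    also have "\<dots> = (\<tau>\<^sup>2 * (K * (3 + 2 * B1\<^sup>2 + B1 + 2 * B2) / 2)) * h\<^sup>2" by simp
    also have "\<dots> \<le> 1 / 10 * h\<^sup>2" using smallness(2)[OF \<tau>] by (rule mult_right_mono) simp
    finally have s: "\<bar>\<tau>\<^sup>2 * ?I\<bar> \<le> 1 / 10 * h\<^sup>2" by (simp add: abs_mult)
    have I: "?I = integral {\<sigma>..1} (\<lambda>\<rho>. along l V X i (\<rho>, \<tau>, m + h)) + integral {\<sigma>..1} (\<lambda>\<rho>. along l V X i (\<rho>, \<tau>, m - h))
        - 2 * integral {\<sigma>..1} (\<lambda>\<rho>. along l V X i (\<rho>, \<tau>, m))"
      by (subst integral_diff integral_add integral_mult_right; auto intro!: integrable_continuous_real continuous_intros c \<sigma>0)+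
    have "TX V X (i, \<sigma>, \<tau>, m + h) + TX V X (i, \<sigma>, \<tau>, m - h) - 2 * TX V X (i, \<sigma>, \<tau>, m) = - (\<tau>\<^sup>2 * ?I)"
      unfolding I TX_def split_conv by (simp add: algebra_simps)
    then show ?thesis using s zero_le_power2[of h] by linarith
  qed
qed

end

text \<open>The coupling is asymmetric. A change of X enters \<open>TV\<close> with the factor
  \<open>K + 3 / 2 * B1\<close>, which is not small but is suppressed by the weight
  \<open>1 / N\<close>; a change of V then enters \<open>TX\<close> with a factor of order K N,
  suppressed by \<open>\<tau>\<^sup>2\<close>. Hence N is fixed before \<delta>.\<close>

lemma contraction:
  assumes a: "admissible V X" "admissible V' X'" and d: "d \<ge> 0"
    and dV: "\<And>a. a \<in> J \<times> {0..\<delta>} \<times> UNIV \<Longrightarrow> \<bar>V a - V' a\<bar> \<le> d"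
    and dX: "\<And>b. b \<in> J \<times> {0..1} \<times> {0..\<delta>} \<times> UNIV \<Longrightarrow> \<bar>X b - X' b\<bar> \<le> 1 / N * d"
  shows "(\<forall>a\<in>J \<times> {0..\<delta>} \<times> UNIV. \<bar>TV V X a - TV V' X' a\<bar> \<le> 7 / 8 * d) \<and>
    (\<forall>b\<in>J \<times> {0..1} \<times> {0..\<delta>} \<times> UNIV. \<bar>TX V X b - TX V' X' b\<bar> \<le> 1 / N * (7 / 8 * d))"
proof -
  define \<omega> where "\<omega> = 1 / N * d"
  note c = constants_pos
  have al: "\<bar>along g V X i (\<rho>, \<tau>, y) - along g V' X' i (\<rho>, \<tau>, y)\<bar> \<le> \<rho> * (K * \<omega> + 3 / 2 * (d + B1 * \<omega>))"
    "\<bar>along l V X i (\<rho>, \<tau>, y) - along l V' X' i (\<rho>, \<tau>, y)\<bar> \<le> \<rho> * (K * (\<omega> + (d + B1 * \<omega>)))"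
    if i: "i \<in> J" and \<tau>: "\<tau> \<in> {0..\<delta>}" and \<rho>: "\<rho> \<in> {0..1}" for i \<tau> \<rho> y
  proof -
    have \<rho>0: "\<rho> \<ge> 0" using \<rho> by simp
    let ?x = "X (i, \<rho>, \<tau>, y)" and ?x' = "X' (i, \<rho>, \<tau>, y)"
    have t: "\<tau> * \<rho> \<in> {0..\<delta>}" by (rule scaled_time[OF \<tau> \<rho>])
    have x: "\<bar>?x - ?x'\<bar> \<le> \<omega>" using dX[of "(i, \<rho>, \<tau>, y)"] i \<tau> \<rho> by (simp add: \<omega>_def)
    have v: "\<bar>V (j, \<tau> * \<rho>, ?x) - V' (j, \<tau> * \<rho>, ?x')\<bar> \<le> d + B1 * \<omega>" if j: "j \<in> J" for j
    proof -
      \<comment> \<open>Both the function and the point change: first the point is moved in the same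
        V by the Lipschitz bound, then V is replaced at a fixed point.\<close>
      have "\<bar>V (j, \<tau> * \<rho>, ?x) - V (j, \<tau> * \<rho>, ?x')\<bar> \<le> B1 * \<omega>"
        using V_lip[OF a(1) j t, of ?x ?x'] mult_left_mono[OF x, of B1] c by linarith
      moreover have "\<bar>V (j, \<tau> * \<rho>, ?x') - V' (j, \<tau> * \<rho>, ?x')\<bar> \<le> d"
        using dV[of "(j, \<tau> * \<rho>, ?x')"] j t by simp
      ultimately show ?thesis by linarith
    qed
    note vb = V_bound[OF a(1) _ t] V_bound[OF a(2) _ t]
    have "\<bar>g i (\<tau> * \<rho>) ?x (\<lambda>j. V (j, \<tau> * \<rho>, ?x)) - g i (\<tau> * \<rho>) ?x' (\<lambda>j. V' (j, \<tau> * \<rho>, ?x'))\<bar>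
        \<le> K * \<bar>?x - ?x'\<bar> + 3 / 2 * (d + B1 * \<omega>)"
      by (rule g_lip[OF i t]; rule vb v; assumption)
    also have "\<dots> \<le> K * \<omega> + 3 / 2 * (d + B1 * \<omega>)" using mult_left_mono[OF x, of K] K by simp
    finally show "\<bar>along g V X i (\<rho>, \<tau>, y) - along g V' X' i (\<rho>, \<tau>, y)\<bar> \<le> \<rho> * (K * \<omega> + 3 / 2 * (d + B1 * \<omega>))"
      unfolding along_def split_conv right_diff_distrib[symmetric] abs_mult abs_of_nonneg[OF \<rho>0]
      by (rule mult_left_mono[OF _ \<rho>0])
    have "\<bar>l i (\<tau> * \<rho>) ?x (\<lambda>j. V (j, \<tau> * \<rho>, ?x)) - l i (\<tau> * \<rho>) ?x' (\<lambda>j. V' (j, \<tau> * \<rho>, ?x'))\<bar>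
        \<le> K * (\<bar>?x - ?x'\<bar> + (d + B1 * \<omega>))"
      by (rule l_lip[OF i t]; rule vb v; assumption)
    also have "\<dots> \<le> K * (\<omega> + (d + B1 * \<omega>))" using x K by (intro mult_left_mono) auto
    finally show "\<bar>along l V X i (\<rho>, \<tau>, y) - along l V' X' i (\<rho>, \<tau>, y)\<bar> \<le> \<rho> * (K * (\<omega> + (d + B1 * \<omega>)))"
      unfolding along_def split_conv right_diff_distrib[symmetric] abs_mult abs_of_nonneg[OF \<rho>0]
      by (rule mult_left_mono[OF _ \<rho>0])
  qed
  show ?thesis
  proof (intro conjI ballI)
    fix a' assume "a' \<in> J \<times> {0..\<delta>} \<times> (UNIV :: real set)"
    then obtain i \<tau> y where a': "a' = (i, \<tau>, y)" "i \<in> J" "\<tau> \<in> {0..\<delta>}" by auto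
    note i = a'(2) and \<tau> = a'(3)
    have "\<bar>integral {0..1} (\<lambda>\<rho>. along g V X i (\<rho>, \<tau>, y) - along g V' X' i (\<rho>, \<tau>, y))\<bar> \<le> (K * \<omega> + 3 / 2 * (d + B1 * \<omega>)) / 2"
      by (rule weighted_integral_bound)
        (use al(1)[OF i \<tau>] in \<open>auto intro!: continuous_intros along_cont_slice[OF a(1) i \<tau>] along_cont_slice[OF a(2) i \<tau>]\<close>)
    moreover have "(K * \<omega> + 3 / 2 * (d + B1 * \<omega>)) / 2 \<le> 7 / 8 * d"
    proof -
      \<comment> \<open>The choice of N makes the characteristics contribute at most d / 8 after
        halving; with the 3 / 4 from V this gives the contraction factor 7 / 8.\<close>
      have "(K + 3 / 2 * B1) * (d / N) \<le> (N / 4) * (d / N)"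
        using d c K by (intro mult_right_mono) (auto simp: N_def)
      also have "\<dots> = d / 4" using c by simp
      finally have "(K + 3 / 2 * B1) * (d / N) \<le> d / 4" .
      moreover have "(K * \<omega> + 3 / 2 * (d + B1 * \<omega>)) / 2 = 3 / 4 * d + ((K + 3 / 2 * B1) * (d / N)) / 2"
        using c by (simp add: \<omega>_def field_simps)
      moreover have "3 / 4 * d + q / 2 \<le> 7 / 8 * d" if "q \<le> d / 4" for q using that by linarith
      ultimately show ?thesis by (simp only:)
    qed
    ultimately have "\<bar>integral {0..1} (\<lambda>\<rho>. along g V X i (\<rho>, \<tau>, y) - along g V' X' i (\<rho>, \<tau>, y))\<bar> \<le> 7 / 8 * d"
      by (rule order_trans)
    then show "\<bar>TV V X a' - TV V' X' a'\<bar> \<le> 7 / 8 * d"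
      by (simp add: a'(1) TV_def integral_diff along_integrable[OF a(1) i \<tau>] along_integrable[OF a(2) i \<tau>])
  next
    fix b assume "b \<in> J \<times> {0..1::real} \<times> {0..\<delta>} \<times> (UNIV :: real set)"
    then obtain i \<sigma> \<tau> y where b: "b = (i, \<sigma>, \<tau>, y)" "i \<in> J" "\<tau> \<in> {0..\<delta>}" "\<sigma> \<ge> 0" "\<sigma> \<le> 1" by auto
    note i = b(2) and \<tau> = b(3)
    let ?I = "integral {\<sigma>..1} (\<lambda>\<rho>. along l V X i (\<rho>, \<tau>, y) - along l V' X' i (\<rho>, \<tau>, y))"
    have "\<bar>?I\<bar> \<le> (K * (\<omega> + (d + B1 * \<omega>))) / 2"
      by (rule weighted_integral_bound[OF _ b(4,5)])
        (use b(4) in \<open>auto intro!: continuous_intros along_cont_slice[OF a(1) i \<tau>] along_cont_slice[OF a(2) i \<tau>] al(2)[OF i \<tau>]\<close>)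
    then have "\<tau>\<^sup>2 * \<bar>?I\<bar> \<le> \<tau>\<^sup>2 * ((K * (\<omega> + (d + B1 * \<omega>))) / 2)" by (rule mult_left_mono) simp
    \<comment> \<open>Uses d = N \<omega> to express everything by the weighted distance.\<close>
    also have "\<dots> = (\<tau>\<^sup>2 * (K * (1 + N + B1) / 2)) * \<omega>" using c by (simp add: \<omega>_def field_simps)
    also have "\<dots> \<le> 1 / 10 * \<omega>" using smallness(3)[OF \<tau>] by (rule mult_right_mono) (use d c in \<open>simp add: \<omega>_def\<close>)
    also have "\<dots> \<le> 1 / N * (7 / 8 * d)" using d c by (simp add: \<omega>_def field_simps)
    finally have s: "\<bar>\<tau>\<^sup>2 * ?I\<bar> \<le> 1 / N * (7 / 8 * d)" by (simp add: abs_mult)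
    have "TX V X b - TX V' X' b = - (\<tau>\<^sup>2 * ?I)"
      by (simp add: b TX_def integral_diff along_integrable[OF a(1) i \<tau>] along_integrable[OF a(2) i \<tau>] algebra_simps)
    then show "\<bar>TX V X b - TX V' X' b\<bar> \<le> 1 / N * (7 / 8 * d)" using s by (simp only: abs_minus_cancel)
  qed
qed

lemma admissible_closed:
  assumes P: "\<And>n::nat. admissible (Vn n) (Xn n)"
    and V: "uniform_limit (J \<times> {0..\<delta>} \<times> UNIV) Vn V sequentially"
    and X: "uniform_limit (J \<times> {0..1} \<times> {0..\<delta>} \<times> UNIV) Xn X sequentially"
  shows "admissible V X"
  unfolding admissible_def
proof (intro ballI conjI allI)
  fix i assume i: "i \<in> J"
  have Vl: "(\<lambda>n. Vn n (i, \<tau>, y)) \<longlonglongrightarrow> V (i, \<tau>, y)" if "\<tau> \<in> {0..\<delta>}" for \<tau> y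
    by (rule tendsto_uniform_limitI[OF V]) (use i that in auto)
  have Xl: "(\<lambda>n. Xn n (i, \<sigma>, \<tau>, y)) \<longlonglongrightarrow> X (i, \<sigma>, \<tau>, y)" if "\<tau> \<in> {0..\<delta>}" "\<sigma> \<in> {0..1}" for \<sigma> \<tau> y
    by (rule tendsto_uniform_limitI[OF X]) (use i that in auto)
  show "continuous_on ({0..\<delta>} \<times> UNIV) (\<lambda>p. V (i, p))"
  proof (rule uniform_limit_theorem)
    show "\<forall>\<^sub>F n in sequentially. continuous_on ({0..\<delta>} \<times> UNIV) (\<lambda>p. Vn n (i, p))"
      using V_cont[OF P i] by simp
    show "uniform_limit ({0..\<delta>} \<times> UNIV) (\<lambda>n p. Vn n (i, p)) (\<lambda>p. V (i, p)) sequentially"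
      by (rule uniform_limit_compose'[OF V]) (use i in auto)
  qed simp
  show "continuous_on ({0..1} \<times> {0..\<delta>} \<times> UNIV) (\<lambda>p. X (i, p))"
  proof (rule uniform_limit_theorem)
    show "\<forall>\<^sub>F n in sequentially. continuous_on ({0..1} \<times> {0..\<delta>} \<times> UNIV) (\<lambda>p. Xn n (i, p))"
      using X_cont[OF P i] by simp
    show "uniform_limit ({0..1} \<times> {0..\<delta>} \<times> UNIV) (\<lambda>n p. Xn n (i, p)) (\<lambda>p. X (i, p)) sequentially"
      by (rule uniform_limit_compose'[OF X]) (use i in auto)
  qed simp
  fix \<tau> assume \<tau>: "\<tau> \<in> {0..\<delta>}"
  show "\<bar>V (i, \<tau>, y)\<bar> \<le> B0" for y
    by (rule tendsto_upperbound[OF tendsto_rabs[OF Vl[OF \<tau>]]]) (use V_bound[OF P i \<tau>] in auto)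
  show "\<bar>V (i, \<tau>, y) - V (i, \<tau>, y')\<bar> \<le> B1 * \<bar>y - y'\<bar>" for y y'
    by (rule tendsto_upperbound[OF tendsto_rabs[OF tendsto_diff[OF Vl[OF \<tau>] Vl[OF \<tau>]]]]) (use V_lip[OF P i \<tau>] in auto)
  show "\<bar>V (i, \<tau>, m + h) + V (i, \<tau>, m - h) - 2 * V (i, \<tau>, m)\<bar> \<le> B2 * h\<^sup>2" for m h
    by (rule tendsto_upperbound[OF tendsto_rabs[OF tendsto_diff[OF tendsto_add[OF Vl[OF \<tau>] Vl[OF \<tau>]] tendsto_mult_left[OF Vl[OF \<tau>]]]]])
      (use V_sd[OF P i \<tau>] in auto)
  fix \<sigma> assume \<sigma>: "\<sigma> \<in> {0..1::real}"
  show "\<bar>X (i, \<sigma>, \<tau>, y) - X (i, \<sigma>, \<tau>, y')\<bar> \<le> 11 / 10 * \<bar>y - y'\<bar>" for y y'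
    by (rule tendsto_upperbound[OF tendsto_rabs[OF tendsto_diff[OF Xl[OF \<tau> \<sigma>] Xl[OF \<tau> \<sigma>]]]])
      (rule always_eventually, rule allI, rule X_lip[OF P i \<tau> \<sigma>], simp)
  show "\<bar>X (i, \<sigma>, \<tau>, m + h) + X (i, \<sigma>, \<tau>, m - h) - 2 * X (i, \<sigma>, \<tau>, m)\<bar> \<le> h\<^sup>2" for m h
    by (rule tendsto_upperbound[OF tendsto_rabs[OF tendsto_diff[OF tendsto_add[OF Xl[OF \<tau> \<sigma>] Xl[OF \<tau> \<sigma>]] tendsto_mult_left[OF Xl[OF \<tau> \<sigma>]]]]])
      (rule always_eventually, rule allI, rule X_sd[OF P i \<tau> \<sigma>], simp)
qed

lemma solution_exists:
  obtains V X where "admissible V X"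
    and "\<And>i \<tau> y. i \<in> J \<Longrightarrow> \<tau> \<in> {0..\<delta>} \<Longrightarrow> V (i, \<tau>, y) = integral {0..1} (\<lambda>\<rho>. along g V X i (\<rho>, \<tau>, y))"
    and "\<And>i \<sigma> \<tau> y. i \<in> J \<Longrightarrow> \<tau> \<in> {0..\<delta>} \<Longrightarrow> \<sigma> \<in> {0..1} \<Longrightarrow>
      X (i, \<sigma>, \<tau>, y) = y - \<tau>\<^sup>2 * integral {\<sigma>..1} (\<lambda>\<rho>. along l V X i (\<rho>, \<tau>, y))"
proof -
  define V0 :: "nat \<times> real \<times> real \<Rightarrow> real" where "V0 = (\<lambda>_. 0)"
  define X0 :: "nat \<times> real \<times> real \<times> real \<Rightarrow> real" where "X0 = (\<lambda>(i, \<sigma>, \<tau>, y). y)"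
  have a0: "admissible V0 X0"
    using B0 constants_pos unfolding admissible_def V0_def X0_def split_beta by (auto intro!: continuous_intros)
  have "\<exists>V X. admissible V X \<and> (\<forall>a\<in>J \<times> {0..\<delta>} \<times> UNIV. TV V X a = V a) \<and> (\<forall>b\<in>J \<times> {0..1} \<times> {0..\<delta>} \<times> UNIV. TX V X b = X b)"
  \<comment> \<open>The iteration starts from V = 0 with resting characteristics. Its first
    increment is at most \<open>B0\<close> in V and 1 in X, and \<open>B0 + N\<close> dominates
    both: the weight turns it into \<open>(B0 + N) / N\<close>, which is at least 1.\<close>
  proof (rule coupled_contraction_fixpoint[where \<kappa> = "7 / 8" and \<omega> = "1 / N" and ?d0.0 = "B0 + N", OF a0 admissible_step _ _ contraction _ _ _ _ admissible_closed])
    fix a assume "a \<in> J \<times> {0..\<delta>} \<times> (UNIV :: real set)"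
    then have "\<bar>TV V0 X0 a\<bar> \<le> B0" using V_bound[OF admissible_step[OF a0]] by force
    then show "\<bar>TV V0 X0 a - V0 a\<bar> \<le> B0 + N" using constants_pos by (simp add: V0_def)
  next
    fix b assume "b \<in> J \<times> {0..1::real} \<times> {0..\<delta>} \<times> (UNIV :: real set)"
    then have "\<bar>TX V0 X0 b - X0 b\<bar> \<le> 1" using TX_dist_bound[OF a0] by (force simp: X0_def)
    moreover have "1 \<le> 1 / N * (B0 + N)" using constants_pos B0 by (simp add: field_simps)
    ultimately show "\<bar>TX V0 X0 b - X0 b\<bar> \<le> 1 / N * (B0 + N)" by linarith
  qed (use constants_pos B0 in auto)
  then obtain V X where "admissible V X" "\<forall>a\<in>J \<times> {0..\<delta>} \<times> UNIV. TV V X a = V a" "\<forall>b\<in>J \<times> {0..1} \<times> {0..\<delta>} \<times> UNIV. TX V X b = X b"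
    by blast
  then show thesis by (intro that[of V X]) (auto simp: TV_def TX_def)
qed

end

section \<open>Flow property and differentiability\<close>

lemma integral_mean_value:
  fixes f :: "real \<Rightarrow> real"
  assumes "a < b" and f: "continuous_on {a..b} f"
  obtains t where "t \<in> {a..b}" "integral {a..b} f = (b - a) * f t"
proof -
  have "\<exists>t\<in>{a<..<b}. integral {a..b} f - integral {a..a} f = (*) (f t) (b - a)"
    by (rule mvt_simple[OF assms(1), of "\<lambda>x. integral {a..x} f" "\<lambda>x. (*) (f x)"])
      (use integral_has_real_derivative[OF f] in \<open>auto simp: has_field_derivative_def\<close>)
  then obtain t where "t \<in> {a<..<b}" "integral {a..b} f = (b - a) * f t" by (auto simp: mult.commute)
  then show thesis by (intro that[of t]) auto
qed

lemma integral_rescale: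
  fixes f :: "real \<Rightarrow> real"
  assumes "k > 0" "f integrable_on {k * a..k * b}"
  shows "integral {k * a..k * b} f = k * integral {a..b} (\<lambda>s. f (k * s))"
proof -
  have "((\<lambda>x. f (k *\<^sub>R x + 0)) has_integral (integral {k * a..k * b} f /\<^sub>R k ^ DIM(real)))
      (cbox ((k * a - 0) /\<^sub>R k) ((k * b - 0) /\<^sub>R k))"
    by (rule has_integral_affinity'[OF _ assms(1)]) (use assms(2) in \<open>simp add: integrable_integral\<close>)
  then have "((\<lambda>s. f (k * s)) has_integral (integral {k * a..k * b} f / k)) {a..b}"
    using assms(1) by (simp add: field_simps)
  then show ?thesis using assms(1) by (simp add: integral_unique)
qed

lemma taylor_imp_has_field_derivative:
  fixes f :: "real \<Rightarrow> real"
  assumes "\<And>h. \<bar>f (y + h) - f y - D * h\<bar> \<le> C * h\<^sup>2"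
  shows "(f has_real_derivative D) (at y)"
  unfolding DERIV_def
proof -
  have "(\<lambda>h. (f (y + h) - f y) / h - D) \<midarrow>0\<rightarrow> 0"
  proof (rule Lim_null_comparison)
    show "\<forall>\<^sub>F h in at 0. norm ((f (y + h) - f y) / h - D) \<le> C * \<bar>h\<bar>"
    proof (rule eventually_at_filter[THEN iffD2], rule always_eventually, intro allI impI)
      fix h :: real assume "h \<noteq> 0"
      have cancel: "C * (r * r) / r = C * r" if "r \<noteq> 0" for r :: real using that by simp
      from \<open>h \<noteq> 0\<close> have "(f (y + h) - f y) / h - D = (f (y + h) - f y - D * h) / h" by (simp add: diff_divide_distrib)
      then have "\<bar>(f (y + h) - f y) / h - D\<bar> = \<bar>f (y + h) - f y - D * h\<bar> / \<bar>h\<bar>" by (simp only: abs_divide)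
      also have "\<dots> \<le> C * h\<^sup>2 / \<bar>h\<bar>" by (intro divide_right_mono assms) simp
      also have "h\<^sup>2 = \<bar>h\<bar> * \<bar>h\<bar>" by (simp add: power2_eq_square)
      also have "C * (\<bar>h\<bar> * \<bar>h\<bar>) / \<bar>h\<bar> = C * \<bar>h\<bar>" using \<open>h \<noteq> 0\<close> by (intro cancel) simp
      finally show "norm ((f (y + h) - f y) / h - D) \<le> C * \<bar>h\<bar>" by simp
    qed
    have "(\<lambda>h. C * \<bar>h\<bar>) \<midarrow>0\<rightarrow> C * \<bar>0\<bar>" by (intro tendsto_intros)
    then show "(\<lambda>h. C * \<bar>h\<bar>) \<midarrow>0\<rightarrow> 0" by simp
  qed
  then have "(\<lambda>h. (f (y + h) - f y) / h - D + D) \<midarrow>0\<rightarrow> 0 + D" by (intro tendsto_add tendsto_const)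
  then show "(\<lambda>h. (f (y + h) - f y) / h) \<midarrow>0\<rightarrow> D" by simp
qed

context degenerate_transport
begin

context
  fixes V X assumes adm: "admissible V X"
    and V_eq: "\<And>i \<tau> y. i \<in> J \<Longrightarrow> \<tau> \<in> {0..\<delta>} \<Longrightarrow> V (i, \<tau>, y) = integral {0..1} (\<lambda>\<rho>. along g V X i (\<rho>, \<tau>, y))"
    and X_eq: "\<And>i \<sigma> \<tau> y. i \<in> J \<Longrightarrow> \<tau> \<in> {0..\<delta>} \<Longrightarrow> \<sigma> \<in> {0..1} \<Longrightarrow>
      X (i, \<sigma>, \<tau>, y) = y - \<tau>\<^sup>2 * integral {\<sigma>..1} (\<lambda>\<rho>. along l V X i (\<rho>, \<tau>, y))"
begin

text \<open>As functions of \<sigma>, both sides solve the integral equation for the characteristic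
  that ends in x at time a. Uniqueness is not part of the fixed point statement, so it is proved
  directly: the largest distance d of two solutions satisfies d <= d / 10.\<close>

lemma characteristic_flow:
  assumes i: "i \<in> J" and ab: "0 < a" "a \<le> b" "b \<le> \<delta>" and s: "\<sigma> \<in> {0..1}"
  shows "X (i, a / b * \<sigma>, b, y) = X (i, \<sigma>, a, X (i, a / b, b, y))"
proof -
  define k where "k = a / b"
  define x where "x = X (i, k, b, y)"
  define F where "F = (\<lambda>\<rho>. along l V X i (\<rho>, b, y))"
  define A where "A \<sigma> = X (i, k * \<sigma>, b, y)" for \<sigma>
  define B where "B \<sigma> = X (i, \<sigma>, a, x)" for \<sigma>
  define L where "L = (\<lambda>C s. s * l i (a * s) (C s) (\<lambda>j. V (j, a * s, C s)))"
  have k: "0 < k" "k \<le> 1" "b * k = a" using ab by (auto simp: k_def)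
  have a\<delta>: "a \<in> {0..\<delta>}" and b\<delta>: "b \<in> {0..\<delta>}" using ab by auto
  have ks: "k * \<sigma> \<in> {0..1}" "k * \<sigma> \<le> k" if "\<sigma> \<in> {0..1}" for \<sigma>
    using that k mult_mono[of k 1 \<sigma> 1] mult_left_mono[of \<sigma> 1 k] by auto
  have contF: "continuous_on {\<sigma>..1} F" if "\<sigma> \<ge> 0" for \<sigma>
    unfolding F_def by (rule along_cont_slice(2)[OF adm i b\<delta> that])
  \<comment> \<open>One factor k comes from the weight inside \<open>along\<close>; rescaling the
    integral gives a second one, and together they turn \<open>b\<^sup>2\<close> into
    \<open>a\<^sup>2\<close>.\<close>
  have FL: "F (k * s) = k * L A s" for s
  proof -
    have "b * (k * s) = a * s" by (simp only: mult.assoc[symmetric] k(3))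
    then show ?thesis by (simp only: F_def L_def along_def A_def split_conv mult.assoc)
  qed
  have A: "A \<sigma> = x - a\<^sup>2 * integral {\<sigma>..1} (L A)" if \<sigma>: "\<sigma> \<in> {0..1}" for \<sigma>
  proof -
    have "integral {k * \<sigma>..k} F + integral {k..1} F = integral {k * \<sigma>..1} F"
      using ks[OF \<sigma>] k by (intro Henstock_Kurzweil_Integration.integral_combine integrable_continuous_real contF) auto
    moreover have "integral {k * \<sigma>..k * 1} F = k * integral {\<sigma>..1} (\<lambda>s. F (k * s))"
      by (rule integral_rescale[OF k(1)])
        (rule integrable_continuous_real, rule continuous_on_subset[OF contF[OF order_refl]], use ks[OF \<sigma>] k in simp)
    ultimately have "integral {k * \<sigma>..1} F = k * (k * integral {\<sigma>..1} (L A)) + integral {k..1} F" by (simp add: FL)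
    then have "b\<^sup>2 * integral {k * \<sigma>..1} F = (b * k)\<^sup>2 * integral {\<sigma>..1} (L A) + b\<^sup>2 * integral {k..1} F"
      by (simp add: power2_eq_square algebra_simps)
    then show ?thesis
      using X_eq[OF i b\<delta> ks(1)[OF \<sigma>], of y] X_eq[OF i b\<delta>, of k y] k
      by (simp add: A_def x_def F_def)
  qed
  have B: "B \<sigma> = x - a\<^sup>2 * integral {\<sigma>..1} (L B)" if \<sigma>: "\<sigma> \<in> {0..1}" for \<sigma>
    using X_eq[OF i a\<delta> \<sigma>, of x] by (simp add: B_def L_def along_def)
  have cA: "continuous_on {0..1} A" unfolding A_def
    by (rule continuous_on_compose2[OF X_cont[OF adm i], of _ "\<lambda>\<sigma>. (k * \<sigma>, b, y)"])
      (use ks b\<delta> in \<open>auto intro!: continuous_intros\<close>)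
  have cB: "continuous_on {0..1} B" unfolding B_def
    by (rule continuous_on_compose2[OF X_cont[OF adm i], of _ "\<lambda>\<sigma>. (\<sigma>, a, x)"])
      (use a\<delta> in \<open>auto intro!: continuous_intros\<close>)
  have cLA: "continuous_on {0..1} (L A)"
  proof -
    have "continuous_on {0..1} (\<lambda>s. F (k * s) / k)"
      by (rule continuous_on_divide[OF continuous_on_compose2[OF contF[of 0], of _ "\<lambda>s. k * s"]])
        (use ks k in \<open>auto intro!: continuous_intros\<close>)
    then show ?thesis using k by (simp add: FL)
  qed
  have cLB: "continuous_on {0..1} (L B)"
    using along_cont_slice(2)[OF adm i a\<delta>, of 0 x] by (simp add: B_def L_def along_def)
  have cAB: "continuous_on {0..1} (\<lambda>t. \<bar>A t - B t\<bar>)" by (intro continuous_intros cA cB)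
  \<comment> \<open>A point of maximal distance, so that the integral equation at z bounds d by a
    multiple of d itself.\<close>
  obtain z where z: "z \<in> {0..1}" and zmax: "\<And>t. t \<in> {0..1} \<Longrightarrow> \<bar>A t - B t\<bar> \<le> \<bar>A z - B z\<bar>"
    using continuous_attains_sup[OF compact_Icc _ cAB] by auto
  define d where "d = \<bar>A z - B z\<bar>"
  have "\<bar>integral {z..1} (\<lambda>s. L A s - L B s)\<bar> \<le> (K * (d + B1 * d)) / 2"
  proof (rule weighted_integral_bound)
    show "continuous_on {z..1} (\<lambda>s. L A s - L B s)"
      using z by (intro continuous_intros continuous_on_subset[OF cLA] continuous_on_subset[OF cLB]) auto
    fix s assume "s \<in> {z..1}"
    then have s: "s \<in> {0..1}" "s \<ge> 0" using z by auto
    have t: "a * s \<in> {0..\<delta>}" by (rule scaled_time[OF a\<delta> s(1)])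
    have AB: "\<bar>A s - B s\<bar> \<le> d" using zmax[OF s(1)] by (simp add: d_def)
    have v: "\<bar>V (j, a * s, A s) - V (j, a * s, B s)\<bar> \<le> B1 * d" if "j \<in> J" for j
      using V_lip[OF adm that t, of "A s" "B s"] mult_left_mono[OF AB, of B1] constants_pos by linarith
    have "\<bar>l i (a * s) (A s) (\<lambda>j. V (j, a * s, A s)) - l i (a * s) (B s) (\<lambda>j. V (j, a * s, B s))\<bar> \<le> K * (\<bar>A s - B s\<bar> + B1 * d)"
      by (rule l_lip[OF i t]; rule V_bound[OF adm _ t] v; assumption)
    also have "\<dots> \<le> K * (d + B1 * d)" using AB K by (intro mult_left_mono) auto
    finally show "\<bar>L A s - L B s\<bar> \<le> s * (K * (d + B1 * d))"
      unfolding L_def right_diff_distrib[symmetric] abs_mult abs_of_nonneg[OF s(2)] by (rule mult_left_mono[OF _ s(2)])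
  qed (use z in auto)
  then have "a\<^sup>2 * \<bar>integral {z..1} (\<lambda>s. L A s - L B s)\<bar> \<le> a\<^sup>2 * ((K * (d + B1 * d)) / 2)" by (rule mult_left_mono) simp
  also have "\<dots> = (a\<^sup>2 * (K * (1 / 2 + B1 / 2))) * d" by (simp add: field_simps)
  also have "\<dots> \<le> 1 / 10 * d"
  proof (rule mult_right_mono[OF small_factor[OF a\<delta>]])
    show "K * (1 / 2 + B1 / 2) \<le> K * (3 + B1\<^sup>2 + B1 + 2 * B2 + N)"
      using K constants_pos zero_le_power2[of B1] by (intro mult_left_mono) linarith+
  qed (use K constants_pos in \<open>auto simp: d_def\<close>)
  finally have "\<bar>a\<^sup>2 * integral {z..1} (\<lambda>s. L A s - L B s)\<bar> \<le> 1 / 10 * d" by (simp add: abs_mult)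
  moreover have "A z - B z = - (a\<^sup>2 * integral {z..1} (\<lambda>s. L A s - L B s))"
  proof -
    have e: "integral {z..1} (\<lambda>s. L A s - L B s) = integral {z..1} (L A) - integral {z..1} (L B)"
      using z by (intro integral_diff integrable_continuous_real continuous_on_subset[OF cLA] continuous_on_subset[OF cLB]) auto
    show ?thesis unfolding A[OF z] B[OF z] e by (simp add: algebra_simps)
  qed
  ultimately have "d \<le> 1 / 10 * d" by (simp only: d_def abs_minus_cancel)
  moreover have "d \<ge> 0" by (simp add: d_def)
  ultimately have "d = 0" by linarith
  then have "A \<sigma> = B \<sigma>" using zmax[OF s] by (simp add: d_def)
  then show ?thesis by (simp add: A_def B_def x_def k_def)
qed

text \<open>The transport equation in integrated form, with no derivative in time. The integral for
  time b is cut at a / b; by the flow property its lower part is the integral for time a on the same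
  characteristic, with \<open>a\<^sup>2 / b\<^sup>2\<close> as scaling factor.\<close>

lemma solution_along_characteristic:
  assumes i: "i \<in> J" and ab: "0 < a" "a < b" "b \<le> \<delta>"
  shows "b\<^sup>2 * V (i, b, y) - a\<^sup>2 * V (i, a, X (i, a / b, b, y)) = b\<^sup>2 * integral {a / b..1} (\<lambda>\<rho>. along g V X i (\<rho>, b, y))"
    and "X (i, a / b, b, y) - y = - (b\<^sup>2 * integral {a / b..1} (\<lambda>\<rho>. along l V X i (\<rho>, b, y)))"
proof -
  define k where "k = a / b"
  define G where "G = (\<lambda>\<rho>. along g V X i (\<rho>, b, y))"
  have k: "0 < k" "k \<le> 1" "b * k = a" using ab by (auto simp: k_def)
  have a\<delta>: "a \<in> {0..\<delta>}" and b\<delta>: "b \<in> {0..\<delta>}" using ab by auto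
  have contG: "continuous_on {0..1} G" unfolding G_def using along_cont_slice(1)[OF adm i b\<delta>] by simp
  have "integral {0..k} G + integral {k..1} G = integral {0..1} G"
    using k by (intro Henstock_Kurzweil_Integration.integral_combine integrable_continuous_real contG) auto
  moreover have "integral {k * 0..k * 1} G = k * integral {0..1} (\<lambda>s. G (k * s))"
    by (rule integral_rescale[OF k(1)])
      (rule integrable_continuous_real, rule continuous_on_subset[OF contG], use k in simp)
  moreover have "integral {0..1} (\<lambda>s. G (k * s)) = integral {0..1} (\<lambda>s. k * along g V X i (s, a, X (i, k, b, y)))"
  proof (rule integral_cong)
    fix s :: real assume "s \<in> {0..1}"
    then have "X (i, k * s, b, y) = X (i, s, a, X (i, k, b, y))"
      unfolding k_def using ab by (intro characteristic_flow[OF i]) auto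
    moreover have "b * (k * s) = a * s" by (simp only: mult.assoc[symmetric] k(3))
    ultimately show "G (k * s) = k * along g V X i (s, a, X (i, k, b, y))"
      by (simp only: G_def along_def split_conv mult.assoc)
  qed
  ultimately have "integral {0..1} G = k * (k * V (i, a, X (i, k, b, y))) + integral {k..1} G"
    by (simp add: V_eq[OF i a\<delta>])
  then have "b\<^sup>2 * integral {0..1} G = (b * k)\<^sup>2 * V (i, a, X (i, k, b, y)) + b\<^sup>2 * integral {k..1} G"
    by (simp add: power2_eq_square algebra_simps)
  then show "b\<^sup>2 * V (i, b, y) - a\<^sup>2 * V (i, a, X (i, a / b, b, y)) = b\<^sup>2 * integral {a / b..1} (\<lambda>\<rho>. along g V X i (\<rho>, b, y))"
    unfolding k(3) by (simp add: V_eq[OF i b\<delta>] G_def k_def)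
  show "X (i, a / b, b, y) - y = - (b\<^sup>2 * integral {a / b..1} (\<lambda>\<rho>. along l V X i (\<rho>, b, y)))"
    using X_eq[OF i b\<delta>, of k y] k by (simp add: k_def)
qed

text \<open>From (b, y) one goes back along the characteristic to (a, x) and then sideways to (a,
  y). The first leg contributes an integral of g, the second \<open>Vy\<close> times x - y, and x -
  y is an integral of l. Mean values turn the difference quotient into a continuous function at
  intermediate points, which converge as the two times merge.\<close>

lemma time_derivative:
  assumes i: "i \<in> J" and \<tau>: "\<tau> \<in> {0..\<delta>}"
    and Vy: "\<And>\<tau> y. \<tau> \<in> {0..\<delta>} \<Longrightarrow> ((\<lambda>y. V (i, \<tau>, y)) has_real_derivative Vy \<tau> y) (at y)"
    and Vy_cont: "continuous_on ({0..\<delta>} \<times> UNIV) (\<lambda>p. Vy (fst p) (snd p))"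
  shows "((\<lambda>\<tau>. \<tau>\<^sup>2 * V (i, \<tau>, y)) has_real_derivative
      \<tau> * g i \<tau> y (\<lambda>j. V (j, \<tau>, y)) - \<tau> * l i \<tau> y (\<lambda>j. V (j, \<tau>, y)) * (\<tau>\<^sup>2 * Vy \<tau> y)) (at \<tau> within {0..\<delta>})"
proof (cases "\<tau> = 0")
  \<comment> \<open>At \<tau> = 0 boundedness of V alone gives the derivative 0.\<close>
  case True
  have "((\<lambda>t. (t\<^sup>2 * V (i, t, y) - \<tau>\<^sup>2 * V (i, \<tau>, y)) / (t - \<tau>)) \<longlongrightarrow> 0) (at \<tau> within {0..\<delta>})"
  proof (rule Lim_null_comparison)
    show "\<forall>\<^sub>F t in at \<tau> within {0..\<delta>}. norm ((t\<^sup>2 * V (i, t, y) - \<tau>\<^sup>2 * V (i, \<tau>, y)) / (t - \<tau>)) \<le> t * B0"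
      using V_bound[OF adm i] True
      by (auto simp: eventually_at_filter power2_eq_square abs_mult intro!: mult_left_mono)
    have "((\<lambda>t. t * B0) \<longlongrightarrow> 0 * B0) (at 0 within {0..\<delta>})" by (intro tendsto_intros)
    then show "((\<lambda>t. t * B0) \<longlongrightarrow> 0) (at \<tau> within {0..\<delta>})" using True by simp
  qed
  then show ?thesis using True by (simp add: has_field_derivative_iff)
next
  case False
  then have \<tau>0: "\<tau> > 0" using \<tau> by simp
  \<comment> \<open>The characteristic is always followed backwards from the later time, so both
    signs of t - \<tau> are treated at once.\<close>
  define mn where "mn t = min t \<tau>" for t
  define mx where "mx t = max t \<tau>" for t
  \<comment> \<open>The difference quotient with all intermediate points as independent arguments;
    its limit then needs only joint continuity of H.\<close>
  define H where "H = (\<lambda>p :: real \<times> real \<times> real \<times> real \<times> real. case p of (b, \<rho>, \<rho>', a, \<xi>) \<Rightarrow>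
      b * along g V X i (\<rho>, b, y) - b * along l V X i (\<rho>', b, y) * (a\<^sup>2 * Vy a \<xi>))"
  define D where "D = {0..\<delta>} \<times> {0..1::real} \<times> {0..1::real} \<times> {0..\<delta>} \<times> (UNIV :: real set)"
  define Q where "Q t \<rho> \<rho>' \<xi> \<longleftrightarrow> \<rho> \<in> {mn t / mx t..1} \<and> \<rho>' \<in> {mn t / mx t..1} \<and> \<bar>\<xi> - y\<bar> \<le> \<delta> * K * \<bar>t - \<tau>\<bar> \<and>
      (t\<^sup>2 * V (i, t, y) - \<tau>\<^sup>2 * V (i, \<tau>, y)) / (t - \<tau>) = H (mx t, \<rho>, \<rho>', mn t, \<xi>)" for t \<rho> \<rho>' \<xi>
  have quotient: "\<exists>\<rho> \<rho>' \<xi>. Q t \<rho> \<rho>' \<xi>"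
    if t: "t \<in> {0<..\<delta>}" "t \<noteq> \<tau>" for t
  proof -
    define a where "a = mn t"
    define b where "b = mx t"
    have ab: "0 < a" "a < b" "b \<le> \<delta>" "b - a = \<bar>t - \<tau>\<bar>"
      using t \<tau>0 \<tau> by (auto simp: a_def b_def mn_def mx_def min_def max_def)
    have a\<delta>: "a \<in> {0..\<delta>}" and b\<delta>: "b \<in> {0..\<delta>}" using ab by auto
    define k where "k = a / b"
    have k: "0 < k" "k < 1" "b\<^sup>2 * (1 - k) = b * (b - a)"
      using ab by (auto simp: k_def field_simps power2_eq_square)
    define x where "x = X (i, k, b, y)"
    obtain \<rho> where \<rho>: "\<rho> \<in> {k..1}" "integral {k..1} (\<lambda>\<rho>. along g V X i (\<rho>, b, y)) = (1 - k) * along g V X i (\<rho>, b, y)"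
      using integral_mean_value[OF k(2) along_cont_slice(1)[OF adm i b\<delta>]] k by (metis less_imp_le)
    obtain \<rho>' where \<rho>': "\<rho>' \<in> {k..1}" "integral {k..1} (\<lambda>\<rho>. along l V X i (\<rho>, b, y)) = (1 - k) * along l V X i (\<rho>', b, y)"
      using integral_mean_value[OF k(2) along_cont_slice(2)[OF adm i b\<delta>]] k by (metis less_imp_le)
    have xy: "x - y = - (b * (b - a) * along l V X i (\<rho>', b, y))"
      using solution_along_characteristic(2)[OF i ab(1-3), of y]
      unfolding k_def[symmetric] x_def[symmetric] \<rho>'(2) mult.assoc[symmetric] k(3) .
    obtain \<xi> where \<xi>: "\<bar>\<xi> - y\<bar> \<le> \<bar>x - y\<bar>" "V (i, a, x) - V (i, a, y) = Vy a \<xi> * (x - y)"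
    proof (cases x y rule: linorder_cases)
      case less
      then obtain z where "x < z" "z < y" "V (i, a, y) - V (i, a, x) = (y - x) * Vy a z"
        using MVT2[OF less, of "\<lambda>y. V (i, a, y)" "Vy a"] Vy[OF a\<delta>] by blast
      then show ?thesis by (intro that[of z]) (auto simp: algebra_simps)
    next
      case equal
      then show ?thesis by (intro that[of y]) auto
    next
      case greater
      then obtain z where "y < z" "z < x" "V (i, a, x) - V (i, a, y) = (x - y) * Vy a z"
        using MVT2[OF greater, of "\<lambda>y. V (i, a, y)" "Vy a"] Vy[OF a\<delta>] by blast
      then show ?thesis by (intro that[of z]) auto
    qed
    have "\<bar>x - y\<bar> = b * (b - a) * \<bar>along l V X i (\<rho>', b, y)\<bar>" using ab by (simp add: xy abs_mult)
    also have "\<dots> \<le> \<delta> * (b - a) * K"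
    proof (intro mult_mono)
      have "\<bar>along l V X i (\<rho>', b, y)\<bar> \<le> \<rho>' * K" using \<rho>' k by (intro along_bound(2)[OF adm i b\<delta>]) auto
      also have "\<dots> \<le> 1 * K" using \<rho>' K by (intro mult_right_mono) auto
      finally show "\<bar>along l V X i (\<rho>', b, y)\<bar> \<le> K" by simp
    qed (use ab in auto)
    finally have \<xi>y: "\<bar>\<xi> - y\<bar> \<le> \<delta> * K * \<bar>t - \<tau>\<bar>" using \<xi>(1) ab(4) by (simp add: mult.commute mult.left_commute)
    have "b\<^sup>2 * V (i, b, y) - a\<^sup>2 * V (i, a, x) = b * (b - a) * along g V X i (\<rho>, b, y)"
      using solution_along_characteristic(1)[OF i ab(1-3), of y]
      unfolding k_def[symmetric] x_def[symmetric] \<rho>(2) mult.assoc[symmetric] k(3) .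
    moreover have "a\<^sup>2 * V (i, a, x) - a\<^sup>2 * V (i, a, y) = a\<^sup>2 * (Vy a \<xi> * (x - y))"
      unfolding \<xi>(2)[symmetric] by (simp add: algebra_simps)
    moreover have "b\<^sup>2 * V (i, b, y) - a\<^sup>2 * V (i, a, y) =
        (b\<^sup>2 * V (i, b, y) - a\<^sup>2 * V (i, a, x)) + (a\<^sup>2 * V (i, a, x) - a\<^sup>2 * V (i, a, y))" by simp
    ultimately have "b\<^sup>2 * V (i, b, y) - a\<^sup>2 * V (i, a, y) = b * (b - a) * along g V X i (\<rho>, b, y) + a\<^sup>2 * (Vy a \<xi> * (x - y))"
      by (simp only:)
    also have "\<dots> = (b - a) * H (b, \<rho>, \<rho>', a, \<xi>)" unfolding xy by (simp add: H_def algebra_simps)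
    finally have "(b\<^sup>2 * V (i, b, y) - a\<^sup>2 * V (i, a, y)) / (b - a) = H (b, \<rho>, \<rho>', a, \<xi>)" using ab by simp
    moreover have "(b\<^sup>2 * V (i, b, y) - a\<^sup>2 * V (i, a, y)) / (b - a) = (t\<^sup>2 * V (i, t, y) - \<tau>\<^sup>2 * V (i, \<tau>, y)) / (t - \<tau>)"
    proof (cases "t < \<tau>")
      case True
      then have "a = t" "b = \<tau>" by (auto simp: a_def b_def mn_def mx_def)
      then show ?thesis using minus_divide_divide[of "t\<^sup>2 * V (i, t, y) - \<tau>\<^sup>2 * V (i, \<tau>, y)" "t - \<tau>"] by simp
    next
      case False
      then have "a = \<tau>" "b = t" by (auto simp: a_def b_def mn_def mx_def)
      then show ?thesis by simp
    qed
    ultimately have "(t\<^sup>2 * V (i, t, y) - \<tau>\<^sup>2 * V (i, \<tau>, y)) / (t - \<tau>) = H (b, \<rho>, \<rho>', a, \<xi>)" by simp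
    then have "Q t \<rho> \<rho>' \<xi>" using \<rho>(1) \<rho>'(1) \<xi>y unfolding Q_def k_def a_def b_def by blast
    then show ?thesis by blast
  qed
  then obtain r r' \<xi> where "\<And>t. t \<in> {0<..\<delta>} \<Longrightarrow> t \<noteq> \<tau> \<Longrightarrow> Q t (r t) (r' t) (\<xi> t)" by metis
  note q = this[unfolded Q_def]
  let ?F = "at \<tau> within {0..\<delta>}"
  have ev: "\<forall>\<^sub>F t in ?F. t \<in> {0<..\<delta>} \<and> t \<noteq> \<tau>"
  proof -
    have "\<forall>\<^sub>F t in ?F. t > 0" using \<tau>0 by (intro order_tendstoD(1)[OF tendsto_ident_at])
    moreover have "\<forall>\<^sub>F t in ?F. t \<in> {0..\<delta>} \<and> t \<noteq> \<tau>" by (auto simp: eventually_at_filter)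
    ultimately show ?thesis by eventually_elim auto
  qed
  have mnl: "(mn \<longlongrightarrow> \<tau>) ?F" and mxl: "(mx \<longlongrightarrow> \<tau>) ?F"
  proof -
    have "((\<lambda>t. min t \<tau>) \<longlongrightarrow> min \<tau> \<tau>) ?F" "((\<lambda>t. max t \<tau>) \<longlongrightarrow> max \<tau> \<tau>) ?F" by (intro tendsto_intros)+
    then show "(mn \<longlongrightarrow> \<tau>) ?F" "(mx \<longlongrightarrow> \<tau>) ?F" by (simp_all add: mn_def[abs_def] mx_def[abs_def])
  qed
  \<comment> \<open>The rescaled times lie between this ratio and 1 and are squeezed to the end of
    the characteristic, where it passes through y.\<close>
  have kl: "((\<lambda>t. mn t / mx t) \<longlongrightarrow> 1) ?F" using tendsto_divide[OF mnl mxl] \<tau>0 by simp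
  have rl: "(r \<longlongrightarrow> 1) ?F" "(r' \<longlongrightarrow> 1) ?F"
    by (rule tendsto_sandwich[OF _ _ kl tendsto_const]; rule eventually_mono[OF ev]; use q in auto)+
  have \<xi>l: "(\<xi> \<longlongrightarrow> y) ?F"
  proof -
    have "((\<lambda>t. \<xi> t - y) \<longlongrightarrow> 0) ?F"
    proof (rule Lim_null_comparison)
      show "\<forall>\<^sub>F t in ?F. norm (\<xi> t - y) \<le> \<delta> * K * \<bar>t - \<tau>\<bar>" by (rule eventually_mono[OF ev]) (use q in auto)
      have "((\<lambda>t. \<delta> * K * \<bar>t - \<tau>\<bar>) \<longlongrightarrow> \<delta> * K * \<bar>\<tau> - \<tau>\<bar>) ?F" by (intro tendsto_intros)
      then show "((\<lambda>t. \<delta> * K * \<bar>t - \<tau>\<bar>) \<longlongrightarrow> 0) ?F" by simp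
    qed
    then show ?thesis by (rule LIM_zero_cancel)
  qed
  have Hc: "continuous_on D H"
  proof -
    have g1: "continuous_on D (\<lambda>p. along g V X i (fst (snd p), fst p, y))"
      by (rule continuous_on_compose2[OF along_cont(1)[OF adm i]]) (auto simp: D_def intro!: continuous_intros)
    have l1: "continuous_on D (\<lambda>p. along l V X i (fst (snd (snd p)), fst p, y))"
      by (rule continuous_on_compose2[OF along_cont(2)[OF adm i]]) (auto simp: D_def intro!: continuous_intros)
    have v1: "continuous_on D (\<lambda>p. Vy (fst (snd (snd (snd p)))) (snd (snd (snd (snd p)))))"
      by (rule continuous_on_compose2[OF Vy_cont, of D "\<lambda>p. snd (snd (snd p))"]) (auto simp: D_def intro!: continuous_intros)
    show ?thesis unfolding H_def split_beta by (intro continuous_intros g1 l1 v1)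
  qed
  have "((\<lambda>t. H (mx t, r t, r' t, mn t, \<xi> t)) \<longlongrightarrow> H (\<tau>, 1, 1, \<tau>, y)) ?F"
  proof (rule continuous_on_tendsto_compose[OF Hc])
    show "((\<lambda>t. (mx t, r t, r' t, mn t, \<xi> t)) \<longlongrightarrow> (\<tau>, 1, 1, \<tau>, y)) ?F"
      by (intro tendsto_Pair mxl rl mnl \<xi>l)
    show "(\<tau>, 1, 1, \<tau>, y) \<in> D" using \<tau> by (simp add: D_def)
    show "\<forall>\<^sub>F t in ?F. (mx t, r t, r' t, mn t, \<xi> t) \<in> D"
    proof (rule eventually_mono[OF ev])
      fix t assume t: "t \<in> {0<..\<delta>} \<and> t \<noteq> \<tau>"
      then have "0 \<le> mn t / mx t" using \<tau>0 by (auto simp: mn_def mx_def)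
      then have "0 \<le> r t" "0 \<le> r' t" using q[of t] t by (auto intro: order_trans)
      moreover have "mn t \<in> {0..\<delta>}" "mx t \<in> {0..\<delta>}" using t \<tau> by (auto simp: mn_def mx_def)
      ultimately show "(mx t, r t, r' t, mn t, \<xi> t) \<in> D" using q[of t] t by (auto simp: D_def)
    qed
  qed
  moreover have "H (\<tau>, 1, 1, \<tau>, y) = \<tau> * g i \<tau> y (\<lambda>j. V (j, \<tau>, y)) - \<tau> * l i \<tau> y (\<lambda>j. V (j, \<tau>, y)) * (\<tau>\<^sup>2 * Vy \<tau> y)"
    using X_eq[OF i \<tau>, of 1 y] by (simp add: H_def along_def)
  moreover have "\<forall>\<^sub>F t in ?F. H (mx t, r t, r' t, mn t, \<xi> t) = (t\<^sup>2 * V (i, t, y) - \<tau>\<^sup>2 * V (i, \<tau>, y)) / (t - \<tau>)"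
    by (rule eventually_mono[OF ev]) (use q in auto)
  ultimately show ?thesis unfolding has_field_derivative_iff by (auto intro: Lim_transform_eventually)
qed

lemma C1_solution:
  obtains Vy where "\<And>i \<tau> y. i \<in> J \<Longrightarrow> \<tau> \<in> {0..\<delta>} \<Longrightarrow> \<bar>Vy i \<tau> y\<bar> \<le> B1"
    and "\<And>i \<tau> y y'. i \<in> J \<Longrightarrow> \<tau> \<in> {0..\<delta>} \<Longrightarrow> \<bar>Vy i \<tau> y - Vy i \<tau> y'\<bar> \<le> B2 * \<bar>y - y'\<bar>"
    and "\<And>i. i \<in> J \<Longrightarrow> C1_strip \<delta> (\<lambda>\<tau> y. \<tau>\<^sup>2 * V (i, \<tau>, y))
      (\<lambda>\<tau> y. \<tau> * g i \<tau> y (\<lambda>j. V (j, \<tau>, y)) - \<tau> * l i \<tau> y (\<lambda>j. V (j, \<tau>, y)) * (\<tau>\<^sup>2 * Vy i \<tau> y))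
      (\<lambda>\<tau> y. \<tau>\<^sup>2 * Vy i \<tau> y)"
proof -
  have "\<exists>f. \<forall>y h. \<bar>V (i, \<tau>, y + h) - V (i, \<tau>, y) - f y * h\<bar> \<le> B2 / 2 * h\<^sup>2" if "i \<in> J" "\<tau> \<in> {0..\<delta>}" for i \<tau>
  proof -
    have "continuous_on UNIV (\<lambda>y. V (i, \<tau>, y))"
      by (rule continuous_on_compose2[OF V_cont[OF adm \<open>i \<in> J\<close>], of _ "\<lambda>y. (\<tau>, y)"]) (use that in \<open>auto intro!: continuous_intros\<close>)
    from second_difference_taylor[OF this V_sd[OF adm that]] show ?thesis by blast
  qed
  then obtain Vy where taylor: "\<And>i \<tau> y h. i \<in> J \<Longrightarrow> \<tau> \<in> {0..\<delta>} \<Longrightarrow> \<bar>V (i, \<tau>, y + h) - V (i, \<tau>, y) - Vy i \<tau> y * h\<bar> \<le> B2 / 2 * h\<^sup>2"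
    by metis
  have Vy: "((\<lambda>y. V (i, \<tau>, y)) has_real_derivative Vy i \<tau> y) (at y)" if "i \<in> J" "\<tau> \<in> {0..\<delta>}" for i \<tau> y
    by (rule taylor_imp_has_field_derivative[OF taylor[OF that]])
  have bound: "\<bar>Vy i \<tau> y\<bar> \<le> B1" if i: "i \<in> J" and \<tau>: "\<tau> \<in> {0..\<delta>}" for i \<tau> y
  proof (rule tendsto_upperbound)
    have "(\<lambda>h. (V (i, \<tau>, y + h) - V (i, \<tau>, y)) / h) \<midarrow>0\<rightarrow> Vy i \<tau> y" using Vy[OF that, of y] unfolding DERIV_def .
    then show "(\<lambda>h. \<bar>(V (i, \<tau>, y + h) - V (i, \<tau>, y)) / h\<bar>) \<midarrow>0\<rightarrow> \<bar>Vy i \<tau> y\<bar>" by (rule tendsto_rabs)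
    show "\<forall>\<^sub>F h in at 0. \<bar>(V (i, \<tau>, y + h) - V (i, \<tau>, y)) / h\<bar> \<le> B1"
      using V_lip[OF adm that, of "y + _" y] by (auto simp: eventually_at_filter abs_divide divide_le_eq)
  qed simp
  have lip: "\<bar>Vy i \<tau> y - Vy i \<tau> y'\<bar> \<le> B2 * \<bar>y - y'\<bar>" if i: "i \<in> J" and \<tau>: "\<tau> \<in> {0..\<delta>}" for i \<tau> y y'
  proof (cases "y = y'")
    case False
    \<comment> \<open>Adding the expansions from y to y' and from y' to y cancels V. Each remainder
      is \<open>B2 / 2 * h\<^sup>2\<close>, hence the Lipschitz constant is \<open>B2\<close>
      without a further factor.\<close>
    define h where "h = y' - y"
    have y: "y' + - h = y" by (simp add: h_def)
    have "\<bar>V (i, \<tau>, y') - V (i, \<tau>, y) - Vy i \<tau> y * h\<bar> \<le> B2 / 2 * h\<^sup>2" using taylor[OF that, of y h] by (simp add: h_def)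
    moreover have "\<bar>V (i, \<tau>, y) - V (i, \<tau>, y') + Vy i \<tau> y' * h\<bar> \<le> B2 / 2 * h\<^sup>2" 
      using taylor[OF that, of y' "- h"] unfolding y by simp
    ultimately have "\<bar>(V (i, \<tau>, y') - V (i, \<tau>, y) - Vy i \<tau> y * h) + (V (i, \<tau>, y) - V (i, \<tau>, y') + Vy i \<tau> y' * h)\<bar> \<le> B2 / 2 * h\<^sup>2 + B2 / 2 * h\<^sup>2"
      by (rule order_trans[OF abs_triangle_ineq add_mono])
    moreover have "(V (i, \<tau>, y') - V (i, \<tau>, y) - Vy i \<tau> y * h) + (V (i, \<tau>, y) - V (i, \<tau>, y') + Vy i \<tau> y' * h) = (Vy i \<tau> y' - Vy i \<tau> y) * h"
      by (simp add: algebra_simps)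
    ultimately have "\<bar>Vy i \<tau> y' - Vy i \<tau> y\<bar> * \<bar>h\<bar> \<le> B2 * \<bar>h\<bar> * \<bar>h\<bar>" by (simp add: abs_mult power2_eq_square)
    then show ?thesis using False by (simp add: h_def abs_minus_commute)
  qed simp
  \<comment> \<open>Lipschitz continuity in y says nothing about \<tau>. But the Taylor remainder
    makes the difference quotients converge at a rate independent of the point, so the joint
    continuity of V is inherited.\<close>
  have Vyc: "continuous_on ({0..\<delta>} \<times> UNIV) (\<lambda>p. Vy i (fst p) (snd p))" if i: "i \<in> J" for i
  proof (rule uniform_limit_theorem)
    let ?D = "\<lambda>n p. (V (i, fst p, snd p + 1 / real (Suc n)) - V (i, fst p, snd p)) / (1 / real (Suc n))"
    have "continuous_on ({0..\<delta>} \<times> UNIV) (?D n)" for n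
    proof -
      have "continuous_on ({0..\<delta>} \<times> UNIV) (\<lambda>p. V (i, fst p, snd p + 1 / real (Suc n)))"
        by (rule continuous_on_compose2[OF V_cont[OF adm i], of _ "\<lambda>p. (fst p, snd p + 1 / real (Suc n))"]) (auto intro!: continuous_intros)
      then show ?thesis using V_cont[OF adm i] by (intro continuous_intros) auto
    qed
    then show "\<forall>\<^sub>F n in sequentially. continuous_on ({0..\<delta>} \<times> UNIV) (?D n)" by simp
    have b: "dist (?D n p) (Vy i (fst p) (snd p)) \<le> B2 / 2 * (1 / real (Suc n))" if "p \<in> {0..\<delta>} \<times> UNIV" for n p
    proof -
      define h where "h = 1 / real (Suc n)"
      have h: "h > 0" by (simp add: h_def)
      have "?D n p - Vy i (fst p) (snd p) = (V (i, fst p, snd p + h) - V (i, fst p, snd p) - Vy i (fst p) (snd p) * h) / h"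
        unfolding h_def[symmetric] using h by (simp add: field_simps)
      then have "dist (?D n p) (Vy i (fst p) (snd p)) = \<bar>V (i, fst p, snd p + h) - V (i, fst p, snd p) - Vy i (fst p) (snd p) * h\<bar> / h"
        using h by (simp add: dist_real_def abs_divide)
      also have "\<dots> \<le> B2 / 2 * h\<^sup>2 / h" using that h by (intro divide_right_mono taylor[OF i]) auto
      also have "\<dots> = B2 / 2 * h" using h by (simp add: power2_eq_square)
      finally show ?thesis by (simp only: h_def)
    qed
    show "uniform_limit ({0..\<delta>} \<times> UNIV) ?D (\<lambda>p. Vy i (fst p) (snd p)) sequentially"
    proof (rule uniform_limitI)
      fix e :: real assume e: "e > 0"
      have "(\<lambda>n. B2 / 2 * (1 / real (Suc n))) \<longlonglongrightarrow> B2 / 2 * 0" by (intro tendsto_intros LIMSEQ_Suc[OF lim_1_over_n])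
      then have "\<forall>\<^sub>F n in sequentially. B2 / 2 * (1 / real (Suc n)) < e" using e by (intro order_tendstoD(2)) auto
      then show "\<forall>\<^sub>F n in sequentially. \<forall>p\<in>{0..\<delta>} \<times> UNIV. dist (?D n p) (Vy i (fst p) (snd p)) < e"
        by (rule eventually_mono) (use b in \<open>blast intro: le_less_trans\<close>)
    qed
  qed simp
  have C1: "C1_strip \<delta> (\<lambda>\<tau> y. \<tau>\<^sup>2 * V (i, \<tau>, y))
      (\<lambda>\<tau> y. \<tau> * g i \<tau> y (\<lambda>j. V (j, \<tau>, y)) - \<tau> * l i \<tau> y (\<lambda>j. V (j, \<tau>, y)) * (\<tau>\<^sup>2 * Vy i \<tau> y))
      (\<lambda>\<tau> y. \<tau>\<^sup>2 * Vy i \<tau> y)" if i: "i \<in> J" for i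
    unfolding C1_strip_def
  proof (intro conjI ballI)
    let ?S = "{0..\<delta>} \<times> (UNIV :: real set)"
    \<comment> \<open>\<open>gl_cont\<close> speaks of sets of triples, because \<open>along\<close>
      depends on (\<rho>, \<tau>, y). A dummy first coordinate adapts it to pairs.\<close>
    let ?S3 = "{0::real} \<times> {0..\<delta>} \<times> (UNIV :: real set)"
    have "continuous_on ?S3 (\<lambda>p. g i (fst (snd p)) (snd (snd p)) (\<lambda>j. V (j, snd p))) \<and>
        continuous_on ?S3 (\<lambda>p. l i (fst (snd p)) (snd (snd p)) (\<lambda>j. V (j, snd p)))"
    proof (rule gl_cont[OF i])
      show "continuous_on ?S3 (\<lambda>p. V (j, snd p))" if "j \<in> J" for j
        by (rule continuous_on_compose2[OF V_cont[OF adm that]]) (auto intro!: continuous_intros)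
      show "\<bar>V (j, snd p)\<bar> \<le> B0" if "p \<in> ?S3" "j \<in> J" for p j
        using V_bound[OF adm that(2), of "fst (snd p)" "snd (snd p)"] that(1) by auto
    qed (auto intro!: continuous_intros)
    then have gc: "continuous_on ?S3 (\<lambda>p. g i (fst (snd p)) (snd (snd p)) (\<lambda>j. V (j, snd p)))"
      and lc: "continuous_on ?S3 (\<lambda>p. l i (fst (snd p)) (snd (snd p)) (\<lambda>j. V (j, snd p)))" by auto
    have c0: "continuous_on ?S (\<lambda>p. (0 :: real, p))" by (intro continuous_intros)
    have "continuous_on ?S (\<lambda>p. g i (fst p) (snd p) (\<lambda>j. V (j, p)))" "continuous_on ?S (\<lambda>p. l i (fst p) (snd p) (\<lambda>j. V (j, p)))"
      using continuous_on_compose2[OF gc c0] continuous_on_compose2[OF lc c0] by (simp_all add: image_subset_iff)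
    then show "continuous_on ?S (\<lambda>p. fst p * g i (fst p) (snd p) (\<lambda>j. V (j, fst p, snd p)) -
        fst p * l i (fst p) (snd p) (\<lambda>j. V (j, fst p, snd p)) * ((fst p)\<^sup>2 * Vy i (fst p) (snd p)))"
      by (intro continuous_intros Vyc[OF i]) auto
    show "continuous_on ?S (\<lambda>p. (fst p)\<^sup>2 * Vy i (fst p) (snd p))" by (intro continuous_intros Vyc[OF i])
    fix p assume p: "p \<in> ?S"
    obtain \<tau> y where py: "p = (\<tau>, y)" by (cases p)
    have \<tau>: "\<tau> \<in> {0..\<delta>}" using p py by simp
    let ?ut = "\<tau> * g i \<tau> y (\<lambda>j. V (j, \<tau>, y)) - \<tau> * l i \<tau> y (\<lambda>j. V (j, \<tau>, y)) * (\<tau>\<^sup>2 * Vy i \<tau> y)"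
    \<comment> \<open>For the total derivative it suffices that one partial derivative, here the one
      in y, is continuous near the point.\<close>
    have "((\<lambda>(\<tau>, y). \<tau>\<^sup>2 * V (i, \<tau>, y)) has_derivative (\<lambda>(tx, ty). ?ut * tx + blinfun_scaleR_left (\<tau>\<^sup>2 * Vy i \<tau> y) ty)) (at (\<tau>, y) within {0..\<delta>} \<times> UNIV)"
    proof (rule has_derivative_partialsI)
      show "((\<lambda>\<tau>. \<tau>\<^sup>2 * V (i, \<tau>, y)) has_derivative (*) ?ut) (at \<tau> within {0..\<delta>})"
        using time_derivative[OF i \<tau> Vy[OF i] Vyc[OF i], of y] by (simp add: has_field_derivative_def)
      show "((\<lambda>y. t\<^sup>2 * V (i, t, y)) has_derivative blinfun_apply (blinfun_scaleR_left (t\<^sup>2 * Vy i t y))) (at y within UNIV)"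
        if "t \<in> {0..\<delta>}" for t y
        using DERIV_cmult[OF Vy[OF i that, of y], of "t\<^sup>2"]
        by (simp add: has_field_derivative_def mult.commute[of _ "t\<^sup>2 * Vy i t y"])
      have "continuous_on ?S (\<lambda>p. blinfun_scaleR_left ((fst p)\<^sup>2 * Vy i (fst p) (snd p)) :: real \<Rightarrow>\<^sub>L real)"
        by (intro continuous_intros Vyc[OF i])
      note bspec[OF this[unfolded continuous_on_eq_continuous_within] p]
      then show "continuous (at (\<tau>, y) within ?S) (\<lambda>(\<tau>, y). blinfun_scaleR_left (\<tau>\<^sup>2 * Vy i \<tau> y) :: real \<Rightarrow>\<^sub>L real)"
        unfolding split_beta py .
    qed auto
    then show "((\<lambda>q. (fst q)\<^sup>2 * V (i, fst q, snd q)) has_derivative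
        (\<lambda>h. (fst p * g i (fst p) (snd p) (\<lambda>j. V (j, fst p, snd p)) -
          fst p * l i (fst p) (snd p) (\<lambda>j. V (j, fst p, snd p)) * ((fst p)\<^sup>2 * Vy i (fst p) (snd p))) * fst h +
          (fst p)\<^sup>2 * Vy i (fst p) (snd p) * snd h)) (at p within ?S)"
      by (simp add: py case_prod_unfold mult.commute[of _ "\<tau>\<^sup>2 * Vy i \<tau> y"])
  qed
  show thesis by (rule that[OF bound lip C1])
qed

end

lemma classical_solution:
  obtains V Vy where "\<And>i \<tau> y. i \<in> J \<Longrightarrow> \<tau> \<in> {0..\<delta>} \<Longrightarrow> \<bar>V (i, \<tau>, y)\<bar> \<le> B0"
    and "\<And>i \<tau> y. i \<in> J \<Longrightarrow> \<tau> \<in> {0..\<delta>} \<Longrightarrow> \<bar>Vy i \<tau> y\<bar> \<le> B1"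
    and "\<And>i \<tau> y y'. i \<in> J \<Longrightarrow> \<tau> \<in> {0..\<delta>} \<Longrightarrow> \<bar>Vy i \<tau> y - Vy i \<tau> y'\<bar> \<le> B2 * \<bar>y - y'\<bar>"
    and "\<And>i. i \<in> J \<Longrightarrow> C1_strip \<delta> (\<lambda>\<tau> y. \<tau>\<^sup>2 * V (i, \<tau>, y))
      (\<lambda>\<tau> y. \<tau> * g i \<tau> y (\<lambda>j. V (j, \<tau>, y)) - \<tau> * l i \<tau> y (\<lambda>j. V (j, \<tau>, y)) * (\<tau>\<^sup>2 * Vy i \<tau> y))
      (\<lambda>\<tau> y. \<tau>\<^sup>2 * Vy i \<tau> y)"
proof (rule solution_exists)
  fix V X
  assume adm: "admissible V X"
    and V: "\<And>i \<tau> y. i \<in> J \<Longrightarrow> \<tau> \<in> {0..\<delta>} \<Longrightarrow> V (i, \<tau>, y) = integral {0..1} (\<lambda>\<rho>. along g V X i (\<rho>, \<tau>, y))"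
    and X: "\<And>i \<sigma> \<tau> y. i \<in> J \<Longrightarrow> \<tau> \<in> {0..\<delta>} \<Longrightarrow> \<sigma> \<in> {0..1} \<Longrightarrow>
      X (i, \<sigma>, \<tau>, y) = y - \<tau>\<^sup>2 * integral {\<sigma>..1} (\<lambda>\<rho>. along l V X i (\<rho>, \<tau>, y))"
  show thesis
  proof (rule C1_solution[OF adm])
    show "V (i, \<tau>, y) = integral {0..1} (\<lambda>\<rho>. along g V X i (\<rho>, \<tau>, y))" if "i \<in> J" "\<tau> \<in> {0..\<delta>}" for i \<tau> y
      by (rule V[OF that])
    show "X (i, \<sigma>, \<tau>, y) = y - \<tau>\<^sup>2 * integral {\<sigma>..1} (\<lambda>\<rho>. along l V X i (\<rho>, \<tau>, y))"
      if "i \<in> J" "\<tau> \<in> {0..\<delta>}" "\<sigma> \<in> {0..1}" for i \<sigma> \<tau> y by (rule X[OF that])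
  next
    fix Vy
    assume Vy: "\<And>i \<tau> y. i \<in> J \<Longrightarrow> \<tau> \<in> {0..\<delta>} \<Longrightarrow> \<bar>Vy i \<tau> y\<bar> \<le> B1"
        "\<And>i \<tau> y y'. i \<in> J \<Longrightarrow> \<tau> \<in> {0..\<delta>} \<Longrightarrow> \<bar>Vy i \<tau> y - Vy i \<tau> y'\<bar> \<le> B2 * \<bar>y - y'\<bar>"
        "\<And>i. i \<in> J \<Longrightarrow> C1_strip \<delta> (\<lambda>\<tau> y. \<tau>\<^sup>2 * V (i, \<tau>, y))
          (\<lambda>\<tau> y. \<tau> * g i \<tau> y (\<lambda>j. V (j, \<tau>, y)) - \<tau> * l i \<tau> y (\<lambda>j. V (j, \<tau>, y)) * (\<tau>\<^sup>2 * Vy i \<tau> y))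
          (\<lambda>\<tau> y. \<tau>\<^sup>2 * Vy i \<tau> y)"
    show thesis
    proof (rule that[of V Vy])
      show "\<bar>V (i, \<tau>, y)\<bar> \<le> B0" if "i \<in> J" "\<tau> \<in> {0..\<delta>}" for i \<tau> y by (rule V_bound[OF adm that])
    qed (fact Vy)+
  qed
qed

end

subsection \<open>Functions with bounded second differences\<close>

text \<open>The range of w = \<tau> v. Constants taken over this box do not depend on the bound for
  v, which can therefore be chosen afterwards; a small \<delta> then keeps w in the box.\<close>

definition unit_box :: "(nat \<Rightarrow> real) set" where
  "unit_box = {w. \<forall>j\<in>{1..4}. \<bar>w j\<bar> \<le> 1}"

text \<open>The last clause bounds second differences on arbitrary triples, not only on a midpoint and its end points, so that
  the class is stable under composition.\<close>

definition C11 :: "real \<Rightarrow> (real \<Rightarrow> (nat \<Rightarrow> real) \<Rightarrow> real) \<Rightarrow> bool" where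
  "C11 K q \<longleftrightarrow>
     (\<forall>y. \<forall>w\<in>unit_box. \<bar>q y w\<bar> \<le> K) \<and>
     (\<forall>y y' d. \<forall>w\<in>unit_box. \<forall>w'\<in>unit_box. \<bar>y - y'\<bar> \<le> d \<longrightarrow> (\<forall>j\<in>{1..4}. \<bar>w j - w' j\<bar> \<le> d) \<longrightarrow>
        \<bar>q y w - q y' w'\<bar> \<le> K * d) \<and>
     (\<forall>y y' ym d e. \<forall>w\<in>unit_box. \<forall>w'\<in>unit_box. \<forall>wm\<in>unit_box.
        \<bar>y - ym\<bar> \<le> d \<longrightarrow> \<bar>y' - ym\<bar> \<le> d \<longrightarrow> \<bar>y + y' - 2 * ym\<bar> \<le> e \<longrightarrow>
        (\<forall>j\<in>{1..4}. \<bar>w j - wm j\<bar> \<le> d \<and> \<bar>w' j - wm j\<bar> \<le> d \<and> \<bar>w j + w' j - 2 * wm j\<bar> \<le> e) \<longrightarrow>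
        \<bar>q y w + q y' w' - 2 * q ym wm\<bar> \<le> K * (d\<^sup>2 + e))"

lemma C11I:
  assumes "\<And>y w. w \<in> unit_box \<Longrightarrow> \<bar>q y w\<bar> \<le> K"
    and "\<And>y y' w w' d. \<lbrakk>w \<in> unit_box; w' \<in> unit_box; 0 \<le> d; \<bar>y - y'\<bar> \<le> d; \<forall>j\<in>{1..4}. \<bar>w j - w' j\<bar> \<le> d\<rbrakk> \<Longrightarrow>
      \<bar>q y w - q y' w'\<bar> \<le> K * d"
    and "\<And>y y' ym w w' wm d e. \<lbrakk>w \<in> unit_box; w' \<in> unit_box; wm \<in> unit_box; 0 \<le> d; 0 \<le> e;
      \<bar>y - ym\<bar> \<le> d; \<bar>y' - ym\<bar> \<le> d; \<bar>y + y' - 2 * ym\<bar> \<le> e;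
      \<forall>j\<in>{1..4}. \<bar>w j - wm j\<bar> \<le> d; \<forall>j\<in>{1..4}. \<bar>w' j - wm j\<bar> \<le> d; \<forall>j\<in>{1..4}. \<bar>w j + w' j - 2 * wm j\<bar> \<le> e\<rbrakk> \<Longrightarrow>
      \<bar>q y w + q y' w' - 2 * q ym wm\<bar> \<le> K * (d\<^sup>2 + e)"
  shows "C11 K q"
  unfolding C11_def
proof (intro conjI allI ballI impI)
  show "\<bar>q y w\<bar> \<le> K" if "w \<in> unit_box" for y w by (rule assms(1)[OF that])
  show "\<bar>q y w - q y' w'\<bar> \<le> K * d"
    if "w \<in> unit_box" "w' \<in> unit_box" "\<bar>y - y'\<bar> \<le> d" "\<forall>j\<in>{1..4}. \<bar>w j - w' j\<bar> \<le> d" for y y' d w w'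
    by (rule assms(2)[OF that(1,2) order_trans[OF abs_ge_zero that(3)] that(3,4)])
  show "\<bar>q y w + q y' w' - 2 * q ym wm\<bar> \<le> K * (d\<^sup>2 + e)"
    if "w \<in> unit_box" "w' \<in> unit_box" "wm \<in> unit_box" "\<bar>y - ym\<bar> \<le> d" "\<bar>y' - ym\<bar> \<le> d" "\<bar>y + y' - 2 * ym\<bar> \<le> e"
      "\<forall>j\<in>{1..4}. \<bar>w j - wm j\<bar> \<le> d \<and> \<bar>w' j - wm j\<bar> \<le> d \<and> \<bar>w j + w' j - 2 * wm j\<bar> \<le> e" for y y' ym d e w w' wm
    by (rule assms(3)[OF that(1,2,3) order_trans[OF abs_ge_zero that(4)] order_trans[OF abs_ge_zero that(6)] that(4,5,6)])
      (use that(7) in blast)+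
qed

lemma
  assumes "C11 K q"
  shows C11_bound: "w \<in> unit_box \<Longrightarrow> \<bar>q y w\<bar> \<le> K"
    and C11_lip: "\<lbrakk>w \<in> unit_box; w' \<in> unit_box; \<bar>y - y'\<bar> \<le> d; \<forall>j\<in>{1..4}. \<bar>w j - w' j\<bar> \<le> d\<rbrakk> \<Longrightarrow>
      \<bar>q y w - q y' w'\<bar> \<le> K * d"
    and C11_sd: "\<lbrakk>w \<in> unit_box; w' \<in> unit_box; wm \<in> unit_box;
      \<bar>y - ym\<bar> \<le> d; \<bar>y' - ym\<bar> \<le> d; \<bar>y + y' - 2 * ym\<bar> \<le> e;
      \<forall>j\<in>{1..4}. \<bar>w j - wm j\<bar> \<le> d; \<forall>j\<in>{1..4}. \<bar>w' j - wm j\<bar> \<le> d; \<forall>j\<in>{1..4}. \<bar>w j + w' j - 2 * wm j\<bar> \<le> e\<rbrakk> \<Longrightarrow>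
      \<bar>q y w + q y' w' - 2 * q ym wm\<bar> \<le> K * (d\<^sup>2 + e)"
  using assms unfolding C11_def by simp_all

lemma zero_in_unit_box: "(\<lambda>_. 0) \<in> unit_box"
  by (simp add: unit_box_def)

lemma C11_nonneg: "C11 K q \<Longrightarrow> K \<ge> 0"
  using order_trans[OF abs_ge_zero C11_bound[OF _ zero_in_unit_box]] by blast

lemma C11_mono:
  assumes q: "C11 K q" and KL: "K \<le> L"
  shows "C11 L q"
proof (rule C11I)
  show "\<bar>q y w\<bar> \<le> L" if "w \<in> unit_box" for y w using C11_bound[OF q that] KL by (rule order_trans)
next
  fix y y' w w' and d :: real
  assume h: "w \<in> unit_box" "w' \<in> unit_box" "\<bar>y - y'\<bar> \<le> d" "\<forall>j\<in>{1..4}. \<bar>w j - w' j\<bar> \<le> d" and d: "0 \<le> d"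
  show "\<bar>q y w - q y' w'\<bar> \<le> L * d" by (rule order_trans[OF C11_lip[OF q h] mult_right_mono[OF KL d]])
next
  fix y y' ym w w' wm and d e :: real
  assume h: "w \<in> unit_box" "w' \<in> unit_box" "wm \<in> unit_box"
      "\<bar>y - ym\<bar> \<le> d" "\<bar>y' - ym\<bar> \<le> d" "\<bar>y + y' - 2 * ym\<bar> \<le> e"
      "\<forall>j\<in>{1..4}. \<bar>w j - wm j\<bar> \<le> d" "\<forall>j\<in>{1..4}. \<bar>w' j - wm j\<bar> \<le> d" "\<forall>j\<in>{1..4}. \<bar>w j + w' j - 2 * wm j\<bar> \<le> e"
    and e: "0 \<le> e"
  have "0 \<le> d\<^sup>2 + e" using e by simp
  then show "\<bar>q y w + q y' w' - 2 * q ym wm\<bar> \<le> L * (d\<^sup>2 + e)"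
    by (rule order_trans[OF C11_sd[OF q h] mult_right_mono[OF KL]])
qed

lemma C11_const: "C11 \<bar>k\<bar> (\<lambda>y w. k)"
  by (rule C11I) simp_all

lemma C11_coordinate: "j \<in> {1..4} \<Longrightarrow> C11 1 (\<lambda>y w. w j)"
proof (rule C11I)
  fix w w' wm :: "nat \<Rightarrow> real" and d e :: real
  assume j: "j \<in> {1..4}" and e: "\<forall>j\<in>{1..4}. \<bar>w j + w' j - 2 * wm j\<bar> \<le> e"
  have "\<bar>w j + w' j - 2 * wm j\<bar> \<le> e" using e j by blast
  also have "\<dots> \<le> 1 * (d\<^sup>2 + e)" by simp
  finally show "\<bar>w j + w' j - 2 * wm j\<bar> \<le> 1 * (d\<^sup>2 + e)" .
qed (auto simp: unit_box_def)

lemma C11_add: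
  assumes p: "C11 K p" and q: "C11 L q"
  shows "C11 (K + L) (\<lambda>y w. p y w + q y w)"
proof (rule C11I)
  show "\<bar>p y w + q y w\<bar> \<le> K + L" if "w \<in> unit_box" for y w
    by (rule order_trans[OF abs_triangle_ineq add_mono[OF C11_bound[OF p that] C11_bound[OF q that]]])
next
  fix y y' w w' and d :: real
  assume h: "w \<in> unit_box" "w' \<in> unit_box" "\<bar>y - y'\<bar> \<le> d" "\<forall>j\<in>{1..4}. \<bar>w j - w' j\<bar> \<le> d"
  have "p y w + q y w - (p y' w' + q y' w') = (p y w - p y' w') + (q y w - q y' w')" by simp
  then show "\<bar>p y w + q y w - (p y' w' + q y' w')\<bar> \<le> (K + L) * d"
    using order_trans[OF abs_triangle_ineq add_mono[OF C11_lip[OF p h] C11_lip[OF q h]]] by (simp only: distrib_right)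
next
  fix y y' ym w w' wm and d e :: real
  assume h: "w \<in> unit_box" "w' \<in> unit_box" "wm \<in> unit_box"
      "\<bar>y - ym\<bar> \<le> d" "\<bar>y' - ym\<bar> \<le> d" "\<bar>y + y' - 2 * ym\<bar> \<le> e"
      "\<forall>j\<in>{1..4}. \<bar>w j - wm j\<bar> \<le> d" "\<forall>j\<in>{1..4}. \<bar>w' j - wm j\<bar> \<le> d" "\<forall>j\<in>{1..4}. \<bar>w j + w' j - 2 * wm j\<bar> \<le> e"
  have "p y w + q y w + (p y' w' + q y' w') - 2 * (p ym wm + q ym wm) =
      (p y w + p y' w' - 2 * p ym wm) + (q y w + q y' w' - 2 * q ym wm)" by simp
  then show "\<bar>p y w + q y w + (p y' w' + q y' w') - 2 * (p ym wm + q ym wm)\<bar> \<le> (K + L) * (d\<^sup>2 + e)"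
    using order_trans[OF abs_triangle_ineq add_mono[OF C11_sd[OF p h] C11_sd[OF q h]]] by (simp only: distrib_right)
qed

lemma abs_mult_le: "\<bar>a\<bar> \<le> A \<Longrightarrow> \<bar>b\<bar> \<le> B \<Longrightarrow> \<bar>a * b\<bar> \<le> A * (B :: real)"
  unfolding abs_mult by (rule mult_mono) (auto intro: order_trans[OF abs_ge_zero])

text \<open>The discrete Leibniz rule: each factor contributes its second difference at the centre,
  and the mixed part is a product of first differences on either side.\<close>

lemma second_difference_mult_bound:
  fixes p1 p2 pm q1 q2 qm :: real
  assumes "\<bar>p1 + p2 - 2 * pm\<bar> \<le> A" "\<bar>qm\<bar> \<le> B" "\<bar>pm\<bar> \<le> C" "\<bar>q1 + q2 - 2 * qm\<bar> \<le> D"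
    "\<bar>p1 - pm\<bar> \<le> E" "\<bar>q1 - qm\<bar> \<le> F" "\<bar>p2 - pm\<bar> \<le> E" "\<bar>q2 - qm\<bar> \<le> F"
  shows "\<bar>p1 * q1 + p2 * q2 - 2 * (pm * qm)\<bar> \<le> A * B + C * D + E * F + E * F"
proof -
  have "p1 * q1 + p2 * q2 - 2 * (pm * qm) =
      (p1 + p2 - 2 * pm) * qm + pm * (q1 + q2 - 2 * qm) + (p1 - pm) * (q1 - qm) + (p2 - pm) * (q2 - qm)"
    by (simp add: algebra_simps)
  also have "\<bar>\<dots>\<bar> \<le> A * B + C * D + E * F + E * F"
    by (intro order_trans[OF abs_triangle_ineq add_mono] abs_mult_le assms)
  finally show ?thesis .
qed

lemma C11_mult:
  assumes p: "C11 K p" and q: "C11 L q"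
  shows "C11 (4 * (K * L)) (\<lambda>y w. p y w * q y w)"
proof (rule C11I)
  have KL: "0 \<le> K * L" using C11_nonneg[OF p] C11_nonneg[OF q] by simp
  show "\<bar>p y w * q y w\<bar> \<le> 4 * (K * L)" if "w \<in> unit_box" for y w
    using abs_mult_le[OF C11_bound[OF p that] C11_bound[OF q that], of y y] KL by linarith
  fix y y' w w' and d :: real
  assume h: "w \<in> unit_box" "w' \<in> unit_box" "\<bar>y - y'\<bar> \<le> d" "\<forall>j\<in>{1..4}. \<bar>w j - w' j\<bar> \<le> d" and d: "0 \<le> d"
  have "p y w * q y w - p y' w' * q y' w' = (p y w - p y' w') * q y w + p y' w' * (q y w - q y' w')"
    by (simp add: algebra_simps)
  also have "\<bar>\<dots>\<bar> \<le> K * d * L + K * (L * d)"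
    by (rule order_trans[OF abs_triangle_ineq add_mono[OF abs_mult_le abs_mult_le]])
      (rule C11_lip[OF p h] C11_bound[OF q h(1)] C11_bound[OF p h(2)] C11_lip[OF q h])+
  also have "\<dots> = 2 * (K * L * d)" by simp
  also have "\<dots> \<le> 4 * (K * L) * d" using mult_nonneg_nonneg[OF KL d] by simp
  finally show "\<bar>p y w * q y w - p y' w' * q y' w'\<bar> \<le> 4 * (K * L) * d" .
next
  have KL: "0 \<le> K * L" using C11_nonneg[OF p] C11_nonneg[OF q] by simp
  fix y y' ym w w' wm and d e :: real
  assume h: "w \<in> unit_box" "w' \<in> unit_box" "wm \<in> unit_box"
      "\<bar>y - ym\<bar> \<le> d" "\<bar>y' - ym\<bar> \<le> d" "\<bar>y + y' - 2 * ym\<bar> \<le> e"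
      "\<forall>j\<in>{1..4}. \<bar>w j - wm j\<bar> \<le> d" "\<forall>j\<in>{1..4}. \<bar>w' j - wm j\<bar> \<le> d" "\<forall>j\<in>{1..4}. \<bar>w j + w' j - 2 * wm j\<bar> \<le> e"
    and e: "0 \<le> e"
  have "\<bar>p y w * q y w + p y' w' * q y' w' - 2 * (p ym wm * q ym wm)\<bar>
      \<le> (K * (d\<^sup>2 + e)) * L + K * (L * (d\<^sup>2 + e)) + (K * d) * (L * d) + (K * d) * (L * d)"
    by (rule second_difference_mult_bound)
      (rule C11_sd[OF p h] C11_sd[OF q h] C11_bound[OF p h(3)] C11_bound[OF q h(3)]
        C11_lip[OF p h(1,3,4,7)] C11_lip[OF q h(1,3,4,7)] C11_lip[OF p h(2,3,5,8)] C11_lip[OF q h(2,3,5,8)])+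
  \<comment> \<open>The constant 4 counts the terms of the product rule: two second differences and
    two products of first differences.\<close>
  also have "\<dots> = 4 * (K * L) * (d\<^sup>2 + e) - 2 * (K * L * e)" by (simp add: algebra_simps power2_eq_square)
  also have "\<dots> \<le> 4 * (K * L) * (d\<^sup>2 + e)" using mult_nonneg_nonneg[OF KL e] by simp
  finally show "\<bar>p y w * q y w + p y' w' * q y' w' - 2 * (p ym wm * q ym wm)\<bar> \<le> 4 * (K * L) * (d\<^sup>2 + e)" .
qed

lemma C11_inverse:
  assumes q: "C11 K q" and m: "m > 0" "\<And>y w. w \<in> unit_box \<Longrightarrow> m \<le> q y w"
  shows "C11 (1 / m + K / m\<^sup>2 + 2 * (K / m * (K / m\<^sup>2))) (\<lambda>y w. 1 / q y w)"
proof -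
  have K: "K \<ge> 0" by (rule C11_nonneg[OF q])
  have pos: "0 \<le> 1 / m" "0 \<le> K / m\<^sup>2" "0 \<le> K / m * (K / m\<^sup>2)" using K m by auto
  have bound: "\<bar>1 / q y w\<bar> \<le> 1 / m" if "w \<in> unit_box" for y w
    using m(2)[OF that, of y] m(1) by (simp add: abs_divide divide_simps)
  have lip: "\<bar>1 / q y w - 1 / q y' w'\<bar> \<le> K / m\<^sup>2 * d"
    if h: "w \<in> unit_box" "w' \<in> unit_box" "\<bar>y - y'\<bar> \<le> d" "\<forall>j\<in>{1..4}. \<bar>w j - w' j\<bar> \<le> d" for y y' w w' d
  proof -
    have nz: "q y w > 0" "q y' w' > 0" using m(1) m(2)[OF h(1), of y] m(2)[OF h(2), of y'] by simp_all
    then have "1 / q y w - 1 / q y' w' = - ((q y w - q y' w') * ((1 / q y w) * (1 / q y' w')))" by (simp add: divide_simps)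
    then have "\<bar>1 / q y w - 1 / q y' w'\<bar> = \<bar>(q y w - q y' w') * ((1 / q y w) * (1 / q y' w'))\<bar>" by (simp only: abs_minus_cancel)
    also have "\<dots> \<le> K * d * (1 / m * (1 / m))"
      by (intro abs_mult_le C11_lip[OF q h] bound h)
    also have "\<dots> = K / m\<^sup>2 * d" by (simp add: power2_eq_square)
    finally show ?thesis .
  qed
  show ?thesis
  proof (rule C11I)
    show "\<bar>1 / q y w\<bar> \<le> 1 / m + K / m\<^sup>2 + 2 * (K / m * (K / m\<^sup>2))" if "w \<in> unit_box" for y w
      using bound[OF that, of y] pos by linarith
  next
    fix y y' w w' and d :: real
    assume h: "w \<in> unit_box" "w' \<in> unit_box" "\<bar>y - y'\<bar> \<le> d" "\<forall>j\<in>{1..4}. \<bar>w j - w' j\<bar> \<le> d" and d: "0 \<le> d"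
    have "K / m\<^sup>2 * d \<le> (1 / m + K / m\<^sup>2 + 2 * (K / m * (K / m\<^sup>2))) * d" using pos d by (intro mult_right_mono) auto
    with lip[OF h] show "\<bar>1 / q y w - 1 / q y' w'\<bar> \<le> (1 / m + K / m\<^sup>2 + 2 * (K / m * (K / m\<^sup>2))) * d" by (rule order_trans)
  next
    fix y y' ym w w' wm and d e :: real
    assume h: "w \<in> unit_box" "w' \<in> unit_box" "wm \<in> unit_box"
        "\<bar>y - ym\<bar> \<le> d" "\<bar>y' - ym\<bar> \<le> d" "\<bar>y + y' - 2 * ym\<bar> \<le> e"
        "\<forall>j\<in>{1..4}. \<bar>w j - wm j\<bar> \<le> d" "\<forall>j\<in>{1..4}. \<bar>w' j - wm j\<bar> \<le> d" "\<forall>j\<in>{1..4}. \<bar>w j + w' j - 2 * wm j\<bar> \<le> e"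
      and e: "0 \<le> e"
    define a b c where "a = q y w" and "b = q y' w'" and "c = q ym wm"
    have nz: "a > 0" "b > 0" "c > 0"
      using m(1) m(2)[OF h(1), of y] m(2)[OF h(2), of y'] m(2)[OF h(3), of ym] by (simp_all add: a_def b_def c_def)
    have sd: "\<bar>a + b - 2 * c\<bar> \<le> K * (d\<^sup>2 + e)" unfolding a_def b_def c_def by (rule C11_sd[OF q h])
    have l1: "\<bar>a - c\<bar> \<le> K * d" "\<bar>b - c\<bar> \<le> K * d"
      unfolding a_def b_def c_def by (rule C11_lip[OF q h(1,3,4,7)], rule C11_lip[OF q h(2,3,5,8)])
    have l2: "\<bar>1 / a - 1 / c\<bar> \<le> K / m\<^sup>2 * d" "\<bar>1 / b - 1 / c\<bar> \<le> K / m\<^sup>2 * d"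
      unfolding a_def b_def c_def by (rule lip[OF h(1,3,4,7)], rule lip[OF h(2,3,5,8)])
    have bc: "\<bar>1 / c\<bar> \<le> 1 / m" unfolding c_def by (rule bound[OF h(3)])
    \<comment> \<open>The product rule for q * (1 / q) = 1, whose second difference is zero, solved
      for the second difference of 1 / q.\<close>
    have "1 / a + 1 / b - 2 * (1 / c) = - ((1 / c) * ((a + b - 2 * c) * (1 / c) + (a - c) * (1 / a - 1 / c) + (b - c) * (1 / b - 1 / c)))"
    proof -
      have "a * (1 / a) = 1" "b * (1 / b) = 1" "c * (1 / c) = 1" using nz by simp_all
      then show ?thesis by algebra
    qed
    then have "\<bar>1 / a + 1 / b - 2 * (1 / c)\<bar> = \<bar>(1 / c) * ((a + b - 2 * c) * (1 / c) + (a - c) * (1 / a - 1 / c) + (b - c) * (1 / b - 1 / c))\<bar>"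
      by (simp only: abs_minus_cancel)
    also have "\<dots> \<le> (1 / m) * (K * (d\<^sup>2 + e) * (1 / m) + K * d * (K / m\<^sup>2 * d) + K * d * (K / m\<^sup>2 * d))"
      by (intro abs_mult_le[OF bc] order_trans[OF abs_triangle_ineq add_mono] abs_mult_le sd bc l1 l2)
    also have "\<dots> = K / m\<^sup>2 * (d\<^sup>2 + e) + 2 * (K / m * (K / m\<^sup>2)) * d\<^sup>2"
      by (simp add: power2_eq_square add_divide_distrib distrib_left)
    also have "\<dots> \<le> (1 / m + K / m\<^sup>2) * (d\<^sup>2 + e) + 2 * (K / m * (K / m\<^sup>2)) * (d\<^sup>2 + e)"
      using pos e by (intro add_mono mult_right_mono mult_left_mono) auto
    also have "\<dots> = (1 / m + K / m\<^sup>2 + 2 * (K / m * (K / m\<^sup>2))) * (d\<^sup>2 + e)" by (simp only: distrib_right)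
    finally show "\<bar>1 / q y w + 1 / q y' w' - 2 * (1 / q ym wm)\<bar> \<le> (1 / m + K / m\<^sup>2 + 2 * (K / m * (K / m\<^sup>2))) * (d\<^sup>2 + e)"
      unfolding a_def b_def c_def .
  qed
qed

lemma C11_of_derivatives:
  fixes f f' f'' :: "real \<Rightarrow> real"
  assumes f': "\<And>y. (f has_real_derivative f' y) (at y)" and f'': "\<And>y. (f' has_real_derivative f'' y) (at y)"
    and b: "\<And>y. \<bar>f y\<bar> \<le> K" "\<And>y. \<bar>f' y\<bar> \<le> K" "\<And>y. \<bar>f'' y\<bar> \<le> K"
  shows "C11 (2 * K) (\<lambda>y w. f y)"
proof -
  have K: "K \<ge> 0" using b(1)[of 0] by (rule order_trans[OF abs_ge_zero])
  have lip: "\<bar>f y - f y'\<bar> \<le> K * \<bar>y - y'\<bar>" for y y'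
    using field_differentiable_bound[of UNIV f f' K y y'] f' b(2) by simp
  have lip': "\<bar>f' y - f' y'\<bar> \<le> K * \<bar>y - y'\<bar>" for y y'
    using field_differentiable_bound[of UNIV f' f'' K y y'] f'' b(3) by simp
  \<comment> \<open>Subtracting the linear function with slope \<open>f' m\<close> leaves a
    derivative of size at most \<open>K * \<bar>y - m\<bar>\<close> on the segment; the mean value
    inequality then suffices.\<close>
  have taylor: "\<bar>f y - f m - f' m * (y - m)\<bar> \<le> K * \<bar>y - m\<bar> * \<bar>y - m\<bar>" for y m
  proof -
    have "norm ((f y - f' m * y) - (f m - f' m * m)) \<le> K * \<bar>y - m\<bar> * norm (y - m)"
    proof (rule field_differentiable_bound[of "closed_segment m y" _ "\<lambda>x. f' x - f' m"])
      show "((\<lambda>x. f x - f' m * x) has_real_derivative f' z - f' m) (at z within closed_segment m y)" for z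
        by (rule DERIV_subset[of _ _ _ UNIV]) (auto intro!: derivative_eq_intros f')
      show "norm (f' z - f' m) \<le> K * \<bar>y - m\<bar>" if "z \<in> closed_segment m y" for z
      proof -
        have "\<bar>z - m\<bar> \<le> \<bar>y - m\<bar>" using that by (auto simp: closed_segment_eq_real_ivl split: if_splits)
        then have "K * \<bar>z - m\<bar> \<le> K * \<bar>y - m\<bar>" using K by (rule mult_left_mono)
        with lip'[of z m] show ?thesis by simp
      qed
    qed auto
    then show ?thesis by (simp add: algebra_simps)
  qed
  show ?thesis
  proof (rule C11I)
    show "\<bar>f y\<bar> \<le> 2 * K" for y using b(1)[of y] K by linarith
    show "\<bar>f y - f y'\<bar> \<le> 2 * K * d" if "\<bar>y - y'\<bar> \<le> d" "0 \<le> d" for y y' d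
      using order_trans[OF lip mult_left_mono[OF that(1) K]] mult_nonneg_nonneg[OF K that(2)] by simp
  next
    fix y y' m d e :: real assume h: "\<bar>y - m\<bar> \<le> d" "\<bar>y' - m\<bar> \<le> d" "\<bar>y + y' - 2 * m\<bar> \<le> e" "0 \<le> d" "0 \<le> e"
    have "K * \<bar>x - m\<bar> * \<bar>x - m\<bar> \<le> K * d\<^sup>2" if "\<bar>x - m\<bar> \<le> d" for x
      unfolding mult.assoc power2_eq_square using K that h(4) by (intro mult_left_mono mult_mono) auto
    note t = order_trans[OF taylor this[OF h(1)]] order_trans[OF taylor this[OF h(2)]] abs_mult_le[OF b(2) h(3), of m]
    have "f y + f y' - 2 * f m = (f y - f m - f' m * (y - m)) + (f y' - f m - f' m * (y' - m)) + f' m * (y + y' - 2 * m)"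
      by (simp add: algebra_simps)
    also have "\<bar>\<dots>\<bar> \<le> K * d\<^sup>2 + K * d\<^sup>2 + K * e"
      by (intro order_trans[OF abs_triangle_ineq add_mono] t)
    also have "\<dots> \<le> 2 * K * (d\<^sup>2 + e)" using mult_nonneg_nonneg[OF K h(5)] by (simp add: algebra_simps)
    finally show "\<bar>f y + f y' - 2 * f m\<bar> \<le> 2 * K * (d\<^sup>2 + e)" .
  qed
qed

section \<open>Families with uniform constants\<close>

text \<open>The constant is uniform in time and in |lam| <= 1, since \<delta> and M must not depend
  on lam. Continuity is stated for composites with continuous coordinates, in the shape of
  \<open>gl_cont\<close>, and so involves no topology on the function-valued argument w.\<close>

definition C11_family :: "real \<Rightarrow> (real \<Rightarrow> real \<Rightarrow> real \<Rightarrow> (nat \<Rightarrow> real) \<Rightarrow> real) \<Rightarrow> bool" where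
  "C11_family \<delta> h \<longleftrightarrow>
     (\<exists>K. \<forall>lam \<tau>. \<bar>lam\<bar> \<le> 1 \<longrightarrow> \<tau> \<in> {0..\<delta>} \<longrightarrow> C11 K (h lam \<tau>)) \<and>
     (\<forall>lam S t \<eta> w. \<bar>lam\<bar> \<le> 1 \<longrightarrow> continuous_on S t \<longrightarrow> continuous_on S \<eta> \<longrightarrow> (\<forall>j\<in>{1..4}. continuous_on S (w j)) \<longrightarrow>
        (\<forall>p\<in>S. t p \<in> {0..\<delta>} \<and> (\<lambda>j. w j p) \<in> unit_box) \<longrightarrow>
        continuous_on (S :: (real \<times> real \<times> real) set) (\<lambda>p. h lam (t p) (\<eta> p) (\<lambda>j. w j p)))"

lemma C11_familyI:
  assumes "\<And>lam \<tau>. \<bar>lam\<bar> \<le> 1 \<Longrightarrow> \<tau> \<in> {0..\<delta>} \<Longrightarrow> C11 K (h lam \<tau>)"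
    and "\<And>lam S t \<eta> w. \<lbrakk>\<bar>lam\<bar> \<le> 1; continuous_on S t; continuous_on S \<eta>; \<forall>j\<in>{1..4}. continuous_on S (w j);
      \<forall>p\<in>S. t p \<in> {0..\<delta>} \<and> (\<lambda>j. w j p) \<in> unit_box\<rbrakk> \<Longrightarrow>
      continuous_on (S :: (real \<times> real \<times> real) set) (\<lambda>p. h lam (t p) (\<eta> p) (\<lambda>j. w j p))"
  shows "C11_family \<delta> h"
  unfolding C11_family_def using assms by blast

lemma C11_family_bound:
  assumes "C11_family \<delta> h"
  obtains K where "\<And>lam \<tau>. \<bar>lam\<bar> \<le> 1 \<Longrightarrow> \<tau> \<in> {0..\<delta>} \<Longrightarrow> C11 K (h lam \<tau>)"
  using assms unfolding C11_family_def by blast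

lemma C11_family_cont:
  assumes "C11_family \<delta> h" "\<bar>lam\<bar> \<le> 1" "continuous_on S t" "continuous_on S \<eta>" "\<forall>j\<in>{1..4}. continuous_on S (w j)"
    "\<forall>p\<in>S. t p \<in> {0..\<delta>} \<and> (\<lambda>j. w j p) \<in> unit_box"
  shows "continuous_on (S :: (real \<times> real \<times> real) set) (\<lambda>p. h lam (t p) (\<eta> p) (\<lambda>j. w j p))"
  using assms unfolding C11_family_def by blast

lemma C11_family_add:
  assumes "C11_family \<delta> p" "C11_family \<delta> q"
  shows "C11_family \<delta> (\<lambda>lam \<tau> y w. p lam \<tau> y w + q lam \<tau> y w)"
proof -
  obtain K where K: "\<And>lam \<tau>. \<bar>lam\<bar> \<le> 1 \<Longrightarrow> \<tau> \<in> {0..\<delta>} \<Longrightarrow> C11 K (p lam \<tau>)" using assms(1) C11_family_bound by blast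
  obtain L where L: "\<And>lam \<tau>. \<bar>lam\<bar> \<le> 1 \<Longrightarrow> \<tau> \<in> {0..\<delta>} \<Longrightarrow> C11 L (q lam \<tau>)" using assms(2) C11_family_bound by blast
  show ?thesis
    by (rule C11_familyI[OF C11_add[OF K L]]) (auto intro!: continuous_on_add C11_family_cont[OF assms(1)] C11_family_cont[OF assms(2)])
qed

lemma C11_family_mult:
  assumes "C11_family \<delta> p" "C11_family \<delta> q"
  shows "C11_family \<delta> (\<lambda>lam \<tau> y w. p lam \<tau> y w * q lam \<tau> y w)"
proof -
  obtain K where K: "\<And>lam \<tau>. \<bar>lam\<bar> \<le> 1 \<Longrightarrow> \<tau> \<in> {0..\<delta>} \<Longrightarrow> C11 K (p lam \<tau>)" using assms(1) C11_family_bound by blast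
  obtain L where L: "\<And>lam \<tau>. \<bar>lam\<bar> \<le> 1 \<Longrightarrow> \<tau> \<in> {0..\<delta>} \<Longrightarrow> C11 L (q lam \<tau>)" using assms(2) C11_family_bound by blast
  show ?thesis
    by (rule C11_familyI[OF C11_mult[OF K L]]) (auto intro!: continuous_on_mult C11_family_cont[OF assms(1)] C11_family_cont[OF assms(2)])
qed

lemma C11_family_const: "C11_family \<delta> (\<lambda>lam \<tau> y w. k)"
  by (rule C11_familyI[OF C11_const]) auto

lemma C11_family_minus: "C11_family \<delta> p \<Longrightarrow> C11_family \<delta> (\<lambda>lam \<tau> y w. - p lam \<tau> y w)"
  using C11_family_mult[OF C11_family_const[of \<delta> "-1"], of p] by simp

lemma C11_family_diff: "C11_family \<delta> p \<Longrightarrow> C11_family \<delta> q \<Longrightarrow> C11_family \<delta> (\<lambda>lam \<tau> y w. p lam \<tau> y w - q lam \<tau> y w)"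
  using C11_family_add[OF _ C11_family_minus, of \<delta> p q] by simp

lemma C11_family_power2: "C11_family \<delta> p \<Longrightarrow> C11_family \<delta> (\<lambda>lam \<tau> y w. (p lam \<tau> y w)\<^sup>2)"
  unfolding power2_eq_square by (rule C11_family_mult)

lemma C11_family_parameter: "C11_family \<delta> (\<lambda>lam \<tau> y w. lam)"
  by (rule C11_familyI[OF C11_mono[OF C11_const]]) auto

lemma C11_family_coordinate:
  assumes "j \<in> {1..4}"
  shows "C11_family \<delta> (\<lambda>lam \<tau> y w. w j)"
  by (rule C11_familyI[OF C11_coordinate[OF assms]]) (use assms in blast)

text \<open>\<open>C11\<close> measures variation in y and w only, so compactness of
  \<open>{0..\<delta>}\<close> is all that is needed. Mere continuity of \<open>\<kappa>1\<close>
  and \<open>\<mu>1\<close> suffices later for this reason.\<close>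

lemma C11_family_time:
  assumes "continuous_on {0..\<delta>} f"
  shows "C11_family \<delta> (\<lambda>lam \<tau> y w. f \<tau>)"
proof -
  have "bounded (f ` {0..\<delta>})" by (intro compact_imp_bounded compact_continuous_image assms compact_Icc)
  then have "\<exists>B. \<forall>\<tau>\<in>{0..\<delta>}. \<bar>f \<tau>\<bar> \<le> B" by (simp add: bounded_iff)
  then obtain B where B: "\<And>\<tau>. \<tau> \<in> {0..\<delta>} \<Longrightarrow> \<bar>f \<tau>\<bar> \<le> B" by blast
  show ?thesis
  proof (rule C11_familyI[of _ B])
    show "C11 B (\<lambda>y w. f \<tau>)" if "\<tau> \<in> {0..\<delta>}" for \<tau> by (rule C11_mono[OF C11_const B[OF that]])
    show "continuous_on S (\<lambda>p. f (t p))" if "continuous_on S t" "\<forall>p\<in>S. t p \<in> {0..\<delta>} \<and> (\<lambda>j. w j p) \<in> unit_box"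
      for S :: "(real \<times> real \<times> real) set" and t w
      by (rule continuous_on_compose2[OF assms that(1)]) (use that(2) in auto)
  qed
qed

lemma C11_family_inverse:
  assumes h: "C11_family \<delta> h" and m: "m > 0"
    and mh: "\<And>lam \<tau> y w. \<bar>lam\<bar> \<le> 1 \<Longrightarrow> \<tau> \<in> {0..\<delta>} \<Longrightarrow> w \<in> unit_box \<Longrightarrow> m \<le> h lam \<tau> y w"
  shows "C11_family \<delta> (\<lambda>lam \<tau> y w. 1 / h lam \<tau> y w)"
proof -
  obtain K where K: "\<And>lam \<tau>. \<bar>lam\<bar> \<le> 1 \<Longrightarrow> \<tau> \<in> {0..\<delta>} \<Longrightarrow> C11 K (h lam \<tau>)" using h C11_family_bound by blast
  show ?thesis
  proof (rule C11_familyI)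
    show "C11 (1 / m + K / m\<^sup>2 + 2 * (K / m * (K / m\<^sup>2))) (\<lambda>y w. 1 / h lam \<tau> y w)" if "\<bar>lam\<bar> \<le> 1" "\<tau> \<in> {0..\<delta>}" for lam \<tau>
      by (rule C11_inverse[OF K[OF that] m mh[OF that]])
    fix lam :: real and S :: "(real \<times> real \<times> real) set" and t \<eta> :: "real \<times> real \<times> real \<Rightarrow> real" and w
    assume a: "\<bar>lam\<bar> \<le> 1" "continuous_on S t" "continuous_on S \<eta>" "\<forall>j\<in>{1..4}. continuous_on S (w j)"
      "\<forall>p\<in>S. t p \<in> {0..\<delta>} \<and> (\<lambda>j. w j p) \<in> unit_box"
    have "h lam (t p) (\<eta> p) (\<lambda>j. w j p) \<noteq> 0" if "p \<in> S" for p
      using mh[OF a(1), of "t p" "\<lambda>j. w j p" "\<eta> p"] a(5) that m by fastforce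
    then show "continuous_on S (\<lambda>p. 1 / h lam (t p) (\<eta> p) (\<lambda>j. w j p))"
      by (intro continuous_on_divide continuous_on_const C11_family_cont[OF h a]) auto
  qed
qed

lemma smooth_fun_DERIV: "smooth_fun f \<Longrightarrow> ((deriv ^^ k) f has_real_derivative (deriv ^^ Suc k) f x) (at x)"
  by (simp add: smooth_fun_def DERIV_deriv_iff_real_differentiable)

lemma C11_family_smooth:
  assumes f: "smooth_fun f" and b: "bounded (range ((deriv ^^ k) f))" "bounded (range ((deriv ^^ Suc k) f))" "bounded (range ((deriv ^^ Suc (Suc k)) f))"
  shows "C11_family \<delta> (\<lambda>lam \<tau> y w. (deriv ^^ k) f y)"
proof -
  obtain A where A: "\<And>y. \<bar>(deriv ^^ k) f y\<bar> \<le> A" using b(1) by (auto simp: bounded_iff)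
  obtain B where B: "\<And>y. \<bar>(deriv ^^ Suc k) f y\<bar> \<le> B" using b(2) by (auto simp: bounded_iff)
  obtain C where C: "\<And>y. \<bar>(deriv ^^ Suc (Suc k)) f y\<bar> \<le> C" using b(3) by (auto simp: bounded_iff)
  have max: "A \<le> max A (max B C)" "B \<le> max A (max B C)" "C \<le> max A (max B C)" by auto
  show ?thesis
  proof (rule C11_familyI)
    show "C11 (2 * max A (max B C)) (\<lambda>y w. (deriv ^^ k) f y)"
      by (rule C11_of_derivatives[OF smooth_fun_DERIV[OF f] smooth_fun_DERIV[OF f]
        order_trans[OF A max(1)] order_trans[OF B max(2)] order_trans[OF C max(3)]])
    show "continuous_on S (\<lambda>p. (deriv ^^ k) f (\<eta> p))" if "continuous_on S \<eta>" for S :: "(real \<times> real \<times> real) set" and \<eta>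
    proof (rule continuous_on_compose2[OF _ that, of UNIV])
      show "continuous_on UNIV ((deriv ^^ k) f)"
        by (rule DERIV_continuous_on) (rule smooth_fun_DERIV[OF f])
    qed simp
  qed
qed

text \<open>The removable singularity at \<tau> = 0: the first-order Taylor coefficient divided out
  of a function of time stays continuous, and differentiability at the single point 0 is
  enough.\<close>

lemma difference_quotient_continuous:
  fixes f :: "real \<Rightarrow> real"
  assumes f: "continuous_on {0..\<delta>} f" and D: "(f has_real_derivative D) (at 0)"
  shows "continuous_on {0..\<delta>} (\<lambda>\<tau>. if \<tau> = 0 then D else (f \<tau> - f 0) / \<tau>)"
  unfolding continuous_on_eq_continuous_within
proof
  fix \<tau> assume \<tau>: "\<tau> \<in> {0..\<delta>}"
  show "continuous (at \<tau> within {0..\<delta>}) (\<lambda>\<tau>. if \<tau> = 0 then D else (f \<tau> - f 0) / \<tau>)"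
  proof (cases "\<tau> = 0")
    case True
    have "((\<lambda>\<tau>. (f \<tau> - f 0) / \<tau>) \<longlongrightarrow> D) (at 0 within {0..\<delta>})"
      using D[unfolded has_field_derivative_iff] by (auto intro: tendsto_within_subset)
    moreover have "\<forall>\<^sub>F t in at 0 within {0..\<delta>}. (f t - f 0) / t = (if t = 0 then D else (f t - f 0) / t)"
      by (auto simp: eventually_at_filter)
    ultimately show ?thesis unfolding True continuous_within by (auto intro: Lim_transform_eventually)
  next
    case False
    have "((\<lambda>\<tau>. (f \<tau> - f 0) / \<tau>) \<longlongrightarrow> (f \<tau> - f 0) / \<tau>) (at \<tau> within {0..\<delta>})"
      using f \<tau> False by (intro tendsto_intros) (auto simp: continuous_on_def)
    moreover have "\<forall>\<^sub>F t in at \<tau> within {0..\<delta>}. (f t - f 0) / t = (if t = 0 then D else (f t - f 0) / t)"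
    proof -
      have "\<forall>\<^sub>F t in at \<tau> within {0..\<delta>}. t > 0" using \<tau> False by (intro order_tendstoD(1)[OF tendsto_ident_at]) auto
      then show ?thesis by (rule eventually_mono) simp
    qed
    ultimately show ?thesis unfolding continuous_within using False by (auto intro: Lim_transform_eventually)
  qed
qed

subsection \<open>The hodograph system\<close>

text \<open>Both identities cancel the singular factor \<open>1 / \<tau>\<close>: the terms that do not vanish at \<open>\<tau> = 0\<close> are exactly
  those that \<open>G\<close> was chosen to remove. The equations for the other characteristic family follow by exchanging \<open>R\<close> and \<open>S\<close>.\<close>

lemma source_regularized_1:
  fixes \<tau> :: real
  assumes nz: "\<tau> \<noteq> 0" "S \<noteq> 0"
    and RS: "R = S + \<tau> * (\<tau> * D)" and Q: "R2 - S2 = \<tau> * Q" "Q = \<tau> * D2 - 2 * p"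
    and R2: "R2 = \<psi> + \<tau> * r" "S2 = \<psi> + \<tau> * s" and S: "S = \<psi>1 + \<tau> * (G + x)" and G: "G * \<psi>1 = - (k0 * (\<psi>\<^sup>2 + 2 * lam * p))"
    and k: "k = A * Ap / cp" "\<tau> * k1 = k - k0"
  shows "(R + S) * (R - S) / (4 * S * \<tau>) + lam * A * Ap * (R2 - S2) / (cp * S * \<tau>)
      - A\<^sup>2 * (R2 - S2)\<^sup>2 / (4 * S * \<tau>) - A * Ap * R2 * S2 / (cp * S) - G + \<tau> * F / (cp * S) =
    \<tau> * (1 / 2 * D + lam * (k * (1 / S)) * D2 + (1 / S) * (1 / 4 * (\<tau> * D)\<^sup>2 - 1 / 4 * A\<^sup>2 * Q\<^sup>2 + (1 / cp) * F
      - (k1 * (2 * lam * p + \<psi>\<^sup>2) + k * (\<psi> * (r + s) + \<tau> * (r * s)) + G * (G + x))))"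
proof -
  have t1: "(R + S) * (R - S) / (4 * S * \<tau>) = \<tau> * (1 / 2 * D) + (1 / S) * (\<tau> * (1 / 4 * (\<tau> * D)\<^sup>2))"
    using nz unfolding RS by (simp add: divide_simps) (simp add: algebra_simps power2_eq_square)
  have t2: "lam * A * Ap * (R2 - S2) / (cp * S * \<tau>) = (1 / S) * (lam * k * Q)"
    using nz unfolding Q(1) k(1) by (simp add: mult_ac)
  have t3: "A\<^sup>2 * (R2 - S2)\<^sup>2 / (4 * S * \<tau>) = (1 / S) * (\<tau> * (1 / 4 * A\<^sup>2 * Q\<^sup>2))"
    using nz unfolding Q(1) by (simp add: power2_eq_square mult_ac)
  have t4: "A * Ap * R2 * S2 / (cp * S) = (1 / S) * (k * R2 * S2)" unfolding k(1) by simp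
  \<comment> \<open>The correction is put over the denominator S, so that it can cancel against the
    other terms.\<close>
  have t5: "G = (1 / S) * (G * S)" using nz by simp
  have t6: "\<tau> * F / (cp * S) = (1 / S) * (\<tau> * ((1 / cp) * F))" by simp
  \<comment> \<open>These are the terms without a factor \<tau>. Their value at \<tau> = 0 is -
    \<open>k0 * (\<psi>\<^sup>2 + 2 * lam * p)\<close> - \<open>G * \<psi>1\<close>, and the
    definition of G makes it zero.\<close>
  have main: "lam * k * Q - k * R2 * S2 - G * S = \<tau> * (lam * k * D2)
      - \<tau> * (k1 * (2 * lam * p + \<psi>\<^sup>2) + k * (\<psi> * (r + s) + \<tau> * (r * s)) + G * (G + x))"
    using G k(2) Q(2) R2 S by algebra
  have "(R + S) * (R - S) / (4 * S * \<tau>) + lam * A * Ap * (R2 - S2) / (cp * S * \<tau>)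
      - A\<^sup>2 * (R2 - S2)\<^sup>2 / (4 * S * \<tau>) - A * Ap * R2 * S2 / (cp * S) - G + \<tau> * F / (cp * S)
    = \<tau> * (1 / 2 * D) + (1 / S) * (\<tau> * (1 / 4 * (\<tau> * D)\<^sup>2) - \<tau> * (1 / 4 * A\<^sup>2 * Q\<^sup>2) + \<tau> * ((1 / cp) * F)
      + (lam * k * Q - k * R2 * S2 - G * S))"
    unfolding t1 t2 t3 t4 t6 by (subst t5) (simp only: distrib_left right_diff_distrib)
  also have "\<dots> = \<tau> * (1 / 2 * D + lam * (k * (1 / S)) * D2 + (1 / S) * (1 / 4 * (\<tau> * D)\<^sup>2 - 1 / 4 * A\<^sup>2 * Q\<^sup>2 + (1 / cp) * F
      - (k1 * (2 * lam * p + \<psi>\<^sup>2) + k * (\<psi> * (r + s) + \<tau> * (r * s)) + G * (G + x))))"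
    unfolding main by algebra
  finally show ?thesis .
qed

lemma source_regularized_2:
  fixes \<tau> :: real
  assumes nz: "\<tau> \<noteq> 0" "S \<noteq> 0"
    and RS: "R = S + \<tau> * (\<tau> * D)" and Q: "R2 - S2 = \<tau> * Q" "Q = \<tau> * D2 - 2 * p"
    and R2: "R2 = \<psi> + \<tau> * r" "S2 = \<psi> + \<tau> * s" and G: "G = - p + 2 * m0 * \<psi>"
    and m: "m = Ap / (A * cp)" "\<tau> * m1 = m - m0"
  shows "R * (R2 - S2) / (2 * S * \<tau>) - lam * Ap * (R - S) / (A * cp * S * \<tau>)
      + Ap * (R * S2 + R2 * S) / (A * cp * S) - G + \<tau> * F / (cp * S) =
    \<tau> * (1 / 2 * D2 + lam * (- m * (1 / S)) * D + ((1 / S) * (1 / 2 * (\<tau> * D) * (\<tau> * D2) - p * (\<tau> * D)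
      + m * ((\<psi> + \<tau> * s) * (\<tau> * D)) + (1 / cp) * F) + 2 * m1 * \<psi> + m * (r + s)))"
proof -
  \<comment> \<open>R / S differs from 1 by a term of order \<open>\<tau>\<^sup>2\<close>, which
    isolates Q / 2 as the only term of order zero.\<close>
  have t1: "R * (R2 - S2) / (2 * S * \<tau>) = Q / 2 + (1 / S) * (\<tau> * ((\<tau> * D) * (Q / 2)))"
    using nz unfolding RS Q(1) by (simp add: divide_simps) (simp add: algebra_simps)
  have t2: "lam * Ap * (R - S) / (A * cp * S * \<tau>) = (1 / S) * (lam * m * (\<tau> * D))"
    using nz unfolding RS m(1) by (simp add: mult_ac)
  have t3: "Ap * (R * S2 + R2 * S) / (A * cp * S) = m * (R2 + S2) + (1 / S) * (m * (S2 * (\<tau> * (\<tau> * D))))"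
  proof -
    have "Ap * (R * S2 + R2 * S) / (A * cp * S) = m * ((R * S2 + R2 * S) / S)" unfolding m(1) by simp
    also have "(R * S2 + R2 * S) / S = R2 + S2 + (1 / S) * (S2 * (\<tau> * (\<tau> * D)))"
      using nz unfolding RS by (simp add: divide_simps) (simp add: algebra_simps)
    finally show ?thesis by (simp only: distrib_left mult.left_commute)
  qed
  have t6: "\<tau> * F / (cp * S) = (1 / S) * (\<tau> * ((1 / cp) * F))" by simp
  \<comment> \<open>At \<tau> = 0 the sum is \<open>- p + 2 * m0 * \<psi> - G\<close>, which
    vanishes by the choice of G.\<close>
  have main: "Q / 2 + m * (R2 + S2) - G = \<tau> * (1 / 2 * D2 + 2 * m1 * \<psi> + m * (r + s))"
  proof -
    have "Q / 2 = \<tau> * (1 / 2 * D2) - p" unfolding Q(2) by simp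
    then show ?thesis using G m(2) R2 by algebra
  qed
  have "R * (R2 - S2) / (2 * S * \<tau>) - lam * Ap * (R - S) / (A * cp * S * \<tau>)
      + Ap * (R * S2 + R2 * S) / (A * cp * S) - G + \<tau> * F / (cp * S)
    = (Q / 2 + m * (R2 + S2) - G) + (1 / S) * (\<tau> * ((\<tau> * D) * (Q / 2)) - lam * m * (\<tau> * D) + m * (S2 * (\<tau> * (\<tau> * D))) + \<tau> * ((1 / cp) * F))"
    unfolding t1 t2 t3 t6 by (simp add: distrib_left right_diff_distrib)
  also have "Q / 2 + m * (R2 + S2) - G = \<tau> * (1 / 2 * D2 + 2 * m1 * \<psi> + m * (r + s))" by (rule main)
  also have "Q / 2 = 1 / 2 * \<tau> * D2 - p" unfolding Q(2) by simp
  finally show ?thesis unfolding R2(2) by algebra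
qed

section \<open>The coefficients as functions of the hodograph time\<close>

locale hodograph_data =
  fixes c a \<phi>2 \<psi>1 \<psi>2 :: "real \<Rightarrow> real" and \<phi>1 m0 \<psi>0 :: real
  assumes c_smooth: "smooth_fun c" and a_smooth: "smooth_fun a"
    and m0: "m0 > 0" and a_lower: "\<forall>z. \<bar>a z\<bar> \<ge> m0" and c_decreasing: "\<forall>z. deriv c z \<le> - m0"
    and c_zero: "c \<phi>1 = 0"
    and \<phi>2_smooth: "smooth_fun \<phi>2" and \<psi>1_smooth: "smooth_fun \<psi>1" and \<psi>2_smooth: "smooth_fun \<psi>2"
    and \<phi>2_bounded: "\<forall>j \<in> {1..4::nat}. bounded (range ((deriv ^^ j) \<phi>2))"
    and \<psi>1_bounded: "\<forall>k \<in> {0..3::nat}. bounded (range ((deriv ^^ k) \<psi>1))"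
    and \<psi>2_bounded: "\<forall>k \<in> {0..3::nat}. bounded (range ((deriv ^^ k) \<psi>2))"
    and \<psi>0: "\<psi>0 > 0" and \<psi>1_lower: "\<forall>y. \<psi>1 y \<ge> \<psi>0"
begin

lemma DERIVs:
  "(c has_real_derivative deriv c x) (at x)" "(deriv c has_real_derivative deriv (deriv c) x) (at x)"
  "(a has_real_derivative deriv a x) (at x)" "(deriv a has_real_derivative deriv (deriv a) x) (at x)"
  "(deriv \<phi>2 has_real_derivative deriv (deriv \<phi>2) x) (at x)"
  "(\<psi>1 has_real_derivative deriv \<psi>1 x) (at x)" "(\<psi>2 has_real_derivative deriv \<psi>2 x) (at x)"
  using smooth_fun_DERIV[OF c_smooth, of 0] smooth_fun_DERIV[OF c_smooth, of 1] smooth_fun_DERIV[OF a_smooth, of 0]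
    smooth_fun_DERIV[OF a_smooth, of 1] smooth_fun_DERIV[OF \<phi>2_smooth, of 1] smooth_fun_DERIV[OF \<psi>1_smooth, of 0]
    smooth_fun_DERIV[OF \<psi>2_smooth, of 0]
  by simp_all

text \<open>The mean value theorem with c' <= - m0. This one estimate gives injectivity, the growth
  that makes c surjective, and the Lipschitz continuity of the inverse.\<close>

lemma c_expanding: "m0 * \<bar>u - v\<bar> \<le> \<bar>c u - c v\<bar>"
proof -
  have *: "m0 * (v - u) \<le> c u - c v" if uv: "u < v" for u v
  proof -
    obtain z where "c v - c u = (v - u) * deriv c z" using MVT2[OF uv, of c "deriv c"] DERIVs(1) by blast
    moreover have "(v - u) * deriv c z \<le> (v - u) * (- m0)" using uv c_decreasing by (intro mult_left_mono) auto
    ultimately show ?thesis by (simp add: mult.commute)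
  qed
  show ?thesis
  proof (cases u v rule: linorder_cases)
    case less
    then show ?thesis using *[OF less] m0 by (simp add: abs_if)
  next
    case greater
    then show ?thesis using *[OF greater] m0 by (simp add: abs_if)
  qed simp
qed

lemma c_bij: "bij c"
proof (rule bijI)
  show "inj c"
  proof (rule injI)
    fix u v assume "c u = c v"
    then have "m0 * \<bar>u - v\<bar> \<le> 0" using c_expanding[of u v] by simp
    then show "u = v" using m0 by (simp add: mult_le_0_iff)
  qed
  show "surj c"
    unfolding surj_def
  proof
    fix z
    \<comment> \<open>Over \<open>{0..r}\<close> and over \<open>{- r..0}\<close> the decreasing
      function c changes by at least |z| + |c 0|, so z lies between c r and c (- r).\<close>
    define r where "r = (\<bar>z\<bar> + \<bar>c 0\<bar>) / m0"
    have r: "0 \<le> r" "m0 * r = \<bar>z\<bar> + \<bar>c 0\<bar>" using m0 by (simp_all add: r_def)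
    have mono: "c v \<le> c u" if "u \<le> v" for u v
    proof (rule DERIV_nonpos_imp_nonincreasing[OF that])
      fix x
      have "deriv c x \<le> 0" using c_decreasing[rule_format, of x] m0 by linarith
      then show "\<exists>D. (c has_real_derivative D) (at x) \<and> D \<le> 0" using DERIVs(1) by blast
    qed
    have "m0 * r \<le> \<bar>c 0 - c r\<bar>" "m0 * r \<le> \<bar>c (- r) - c 0\<bar>" using c_expanding[of 0 r] c_expanding[of "- r" 0] r(1) by simp_all
    then have "c r \<le> z" "z \<le> c (- r)" using mono[of 0 r] mono[of "- r" 0] r by linarith+
    moreover have "isCont c x" for x using DERIVs(1) by (rule DERIV_isCont)
    ultimately have "\<exists>x\<ge>- r. x \<le> r \<and> c x = z" using r(1) by (intro IVT2) auto
    then show "\<exists>x. z = c x" by blast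
  qed
qed

lemma ustar_0: "ustar c 0 = \<phi>1"
  using c_bij c_zero by (metis bij_is_inj inv_f_f minus_zero ustar_def)

lemma ustar_DERIV: "(ustar c has_real_derivative - inverse (deriv c (ustar c \<tau>))) (at \<tau>)"
proof -
  have cont: "isCont (inv c) x" for x
    unfolding isCont_def
  proof (rule LIM_zero_cancel, rule Lim_null_comparison)
    have "m0 * \<bar>inv c t - inv c x\<bar> \<le> \<bar>t - x\<bar>" for t
      using c_expanding[of "inv c t" "inv c x"] c_bij by (simp add: bij_is_surj surj_f_inv_f)
    then show "\<forall>\<^sub>F t in at x. norm (inv c t - inv c x) \<le> \<bar>t - x\<bar> / m0"
      using m0 by (simp add: pos_le_divide_eq mult.commute)
    have "((\<lambda>t. \<bar>t - x\<bar> / m0) \<longlongrightarrow> \<bar>x - x\<bar> / m0) (at x)" using m0 by (intro tendsto_intros) auto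
    then show "((\<lambda>t. \<bar>t - x\<bar> / m0) \<longlongrightarrow> 0) (at x)" by simp
  qed
  have "(inv c has_real_derivative inverse (deriv c (inv c (- \<tau>)))) (at (- \<tau>))"
  proof (rule DERIV_inverse_function[where a = "- \<tau> - 1" and b = "- \<tau> + 1"])
    show "deriv c (inv c (- \<tau>)) \<noteq> 0" using c_decreasing[rule_format, of "inv c (- \<tau>)"] m0 by auto
    show "c (inv c y) = y" for y using c_bij by (simp add: bij_is_surj surj_f_inv_f)
  qed (use DERIVs(1) cont in auto)
  then have "((\<lambda>t. inv c (- t)) has_real_derivative inverse (deriv c (inv c (- \<tau>))) * (- 1)) (at \<tau>)"
    by (rule DERIV_chain2) (auto intro!: derivative_eq_intros)
  then show ?thesis by (simp add: ustar_def[abs_def])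
qed

definition A where "A \<tau> = a (ustar c \<tau>)"
definition Ap where "Ap \<tau> = deriv a (ustar c \<tau>)"
definition cp where "cp \<tau> = deriv c (ustar c \<tau>)"
text \<open>\<open>\<kappa>\<close> and \<open>\<mu>\<close> are the only combinations of the
  coefficients in terms that survive at \<tau> = 0, so only they need a first-order expansion
  there.\<close>

definition \<kappa> where "\<kappa> \<tau> = A \<tau> * Ap \<tau> / cp \<tau>"
definition \<mu> where "\<mu> \<tau> = Ap \<tau> / (A \<tau> * cp \<tau>)"

lemma cp_nz: "cp \<tau> \<noteq> 0"
  using c_decreasing[rule_format, of "ustar c \<tau>"] m0 by (auto simp: cp_def)

lemma A_nz: "A \<tau> \<noteq> 0"
  using a_lower[rule_format, of "ustar c \<tau>"] m0 by (auto simp: A_def)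

lemma coefficient_differentiable:
  "A differentiable (at \<tau>)" "Ap differentiable (at \<tau>)" "cp differentiable (at \<tau>)" "\<kappa> differentiable (at \<tau>)" "\<mu> differentiable (at \<tau>)"
proof -
  show A: "A differentiable (at \<tau>)" and Ap: "Ap differentiable (at \<tau>)" and cp: "cp differentiable (at \<tau>)"
    unfolding A_def[abs_def] Ap_def[abs_def] cp_def[abs_def]
    using DERIV_chain2[OF DERIVs(3) ustar_DERIV] DERIV_chain2[OF DERIVs(4) ustar_DERIV] DERIV_chain2[OF DERIVs(2) ustar_DERIV]
    unfolding real_differentiable_def by blast+
  show "\<kappa> differentiable (at \<tau>)" unfolding \<kappa>_def[abs_def]
    by (intro differentiable_divide differentiable_mult A Ap cp cp_nz)
  show "\<mu> differentiable (at \<tau>)" unfolding \<mu>_def[abs_def]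
    by (intro differentiable_divide differentiable_mult A Ap cp) (simp add: cp_nz A_nz)
qed

lemma coefficient_continuous:
  "continuous_on S A" "continuous_on S Ap" "continuous_on S cp" "continuous_on S \<kappa>" "continuous_on S \<mu>"
  by (rule differentiable_imp_continuous_on, rule differentiable_at_imp_differentiable_on, rule coefficient_differentiable)+

definition \<kappa>1 where "\<kappa>1 \<tau> = (if \<tau> = 0 then deriv \<kappa> 0 else (\<kappa> \<tau> - \<kappa> 0) / \<tau>)"
definition \<mu>1 where "\<mu>1 \<tau> = (if \<tau> = 0 then deriv \<mu> 0 else (\<mu> \<tau> - \<mu> 0) / \<tau>)"

lemma quotient_continuous: "continuous_on {0..\<delta>} \<kappa>1" "continuous_on {0..\<delta>} \<mu>1"
  unfolding \<kappa>1_def[abs_def] \<mu>1_def[abs_def]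
  by (intro difference_quotient_continuous coefficient_continuous; simp add: DERIV_deriv_iff_real_differentiable coefficient_differentiable)+

lemma \<psi>1_pos: "\<psi>1 y > 0"
  using \<psi>1_lower \<psi>0 by (meson less_le_trans)

text \<open>The Taylor coefficients and their derivatives in closed form, built from sums, products
  and 1 / \<open>\<psi>1\<close>, so that the closure rules for families apply to them.\<close>

definition G11 where "G11 lam y = - (\<kappa> 0 * ((\<psi>2 y)\<^sup>2 + 2 * lam * deriv \<phi>2 y)) * (1 / \<psi>1 y)"
definition G11' where "G11' lam y = - (\<kappa> 0 * (2 * \<psi>2 y * deriv \<psi>2 y + 2 * lam * deriv (deriv \<phi>2) y)) * (1 / \<psi>1 y)
  + \<kappa> 0 * ((\<psi>2 y)\<^sup>2 + 2 * lam * deriv \<phi>2 y) * (deriv \<psi>1 y * (1 / \<psi>1 y)\<^sup>2)"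
definition G21 where "G21 y = - deriv \<phi>2 y + 2 * \<mu> 0 * \<psi>2 y"
definition G21' where "G21' y = - deriv (deriv \<phi>2) y + 2 * \<mu> 0 * deriv \<psi>2 y"
definition G22 where "G22 y = deriv \<phi>2 y + 2 * \<mu> 0 * \<psi>2 y"
definition G22' where "G22' y = deriv (deriv \<phi>2) y + 2 * \<mu> 0 * deriv \<psi>2 y"

lemma g11_eq: "g11 c a \<phi>1 \<phi>2 \<psi>1 \<psi>2 lam = G11 lam"
proof
  fix y
  have "f11 a \<phi>1 \<phi>2 \<psi>2 lam y = a \<phi>1 * deriv a \<phi>1 * ((\<psi>2 y)\<^sup>2 + 2 * lam * deriv \<phi>2 y)"
    by (simp add: f11_def algebra_simps)
  then show "g11 c a \<phi>1 \<phi>2 \<psi>1 \<psi>2 lam y = G11 lam y"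
    by (simp add: g11_def G11_def \<kappa>_def A_def Ap_def cp_def ustar_0)
qed

lemma g2_eq: "g21 c a \<phi>1 \<phi>2 \<psi>1 \<psi>2 = G21" "g22 c a \<phi>1 \<phi>2 \<psi>1 \<psi>2 = G22"
proof -
  have nz: "deriv c \<phi>1 \<noteq> 0" "a \<phi>1 \<noteq> 0" using cp_nz[of 0] A_nz[of 0] by (simp_all add: cp_def A_def ustar_0)
  have \<mu>0: "deriv c \<phi>1 * \<mu> 0 = deriv a \<phi>1 / a \<phi>1" using nz by (simp add: \<mu>_def A_def Ap_def cp_def ustar_0)
  have D: "deriv c \<phi>1 * \<psi>1 y \<noteq> 0" for y using nz \<psi>1_pos[of y] by simp
  have m: "2 * deriv a \<phi>1 / a \<phi>1 = 2 * (deriv c \<phi>1 * \<mu> 0)" by (simp add: \<mu>0)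
  have "f21 c a \<phi>1 \<phi>2 \<psi>1 \<psi>2 y = (deriv c \<phi>1 * \<psi>1 y) * - G21 y" "f22 c a \<phi>1 \<phi>2 \<psi>1 \<psi>2 y = (deriv c \<phi>1 * \<psi>1 y) * - G22 y" for y
    unfolding f21_def f22_def m G21_def G22_def by (simp_all add: algebra_simps)
  then show "g21 c a \<phi>1 \<phi>2 \<psi>1 \<psi>2 = G21" "g22 c a \<phi>1 \<phi>2 \<psi>1 \<psi>2 = G22"
    using D by (auto simp: g21_def g22_def fun_eq_iff)
qed

lemma deriv_G: "deriv (G11 lam) y = G11' lam y" "deriv G21 y = G21' y" "deriv G22 y = G22' y"
proof -
  have nz: "\<psi>1 y \<noteq> 0" using \<psi>1_pos[of y] by simp
  have "((\<lambda>y. 1 / \<psi>1 y) has_real_derivative - (deriv \<psi>1 y * (1 / \<psi>1 y)\<^sup>2)) (at y)"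
    by (rule derivative_eq_intros DERIVs nz refl)+ (simp add: power2_eq_square)
  note d = DERIV_mult[OF _ this]
  have "((\<lambda>y. - (\<kappa> 0 * ((\<psi>2 y)\<^sup>2 + 2 * lam * deriv \<phi>2 y))) has_real_derivative
      - (\<kappa> 0 * (2 * \<psi>2 y * deriv \<psi>2 y + 2 * lam * deriv (deriv \<phi>2) y))) (at y)"
    by (rule derivative_eq_intros DERIVs refl)+ simp
  from d[OF this] have "(G11 lam has_real_derivative G11' lam y) (at y)"
    unfolding G11_def[abs_def] G11'_def by (rule DERIV_cong) (simp add: algebra_simps)
  then show "deriv (G11 lam) y = G11' lam y" by (rule DERIV_imp_deriv)
  have "(G21 has_real_derivative G21' y) (at y)" unfolding G21_def[abs_def] G21'_def
    by (rule derivative_eq_intros DERIVs refl)+ simp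
  then show "deriv G21 y = G21' y" by (rule DERIV_imp_deriv)
  have "(G22 has_real_derivative G22' y) (at y)" unfolding G22_def[abs_def] G22'_def
    by (rule derivative_eq_intros DERIVs refl)+ simp
  then show "deriv G22 y = G22' y" by (rule DERIV_imp_deriv)
qed

text \<open>Membership consumes three consecutive bounded derivatives. The y-derivatives of the
  Taylor coefficients occur in the source, which leads to order 4 for \<open>\<phi>2\<close> and
  order 3 for \<open>\<psi>1\<close> and \<open>\<psi>2\<close>.\<close>

lemma data_families:
  "C11_family \<delta> (\<lambda>lam \<tau> y w. \<psi>1 y)" "C11_family \<delta> (\<lambda>lam \<tau> y w. deriv \<psi>1 y)"
  "C11_family \<delta> (\<lambda>lam \<tau> y w. \<psi>2 y)" "C11_family \<delta> (\<lambda>lam \<tau> y w. deriv \<psi>2 y)"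
  "C11_family \<delta> (\<lambda>lam \<tau> y w. deriv \<phi>2 y)" "C11_family \<delta> (\<lambda>lam \<tau> y w. deriv (deriv \<phi>2) y)"
proof -
  show "C11_family \<delta> (\<lambda>lam \<tau> y w. \<psi>1 y)"
    using C11_family_smooth[OF \<psi>1_smooth \<psi>1_bounded[rule_format, of 0] \<psi>1_bounded[rule_format, of "Suc 0"] \<psi>1_bounded[rule_format, of "Suc (Suc 0)"]] by simp
  show "C11_family \<delta> (\<lambda>lam \<tau> y w. deriv \<psi>1 y)"
    using C11_family_smooth[OF \<psi>1_smooth \<psi>1_bounded[rule_format, of "Suc 0"] \<psi>1_bounded[rule_format, of "Suc (Suc 0)"] \<psi>1_bounded[rule_format, of "Suc (Suc (Suc 0))"]] by simp
  show "C11_family \<delta> (\<lambda>lam \<tau> y w. \<psi>2 y)"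
    using C11_family_smooth[OF \<psi>2_smooth \<psi>2_bounded[rule_format, of 0] \<psi>2_bounded[rule_format, of "Suc 0"] \<psi>2_bounded[rule_format, of "Suc (Suc 0)"]] by simp
  show "C11_family \<delta> (\<lambda>lam \<tau> y w. deriv \<psi>2 y)"
    using C11_family_smooth[OF \<psi>2_smooth \<psi>2_bounded[rule_format, of "Suc 0"] \<psi>2_bounded[rule_format, of "Suc (Suc 0)"] \<psi>2_bounded[rule_format, of "Suc (Suc (Suc 0))"]] by simp
  show "C11_family \<delta> (\<lambda>lam \<tau> y w. deriv \<phi>2 y)"
    using C11_family_smooth[OF \<phi>2_smooth \<phi>2_bounded[rule_format, of "Suc 0"] \<phi>2_bounded[rule_format, of "Suc (Suc 0)"] \<phi>2_bounded[rule_format, of "Suc (Suc (Suc 0))"]] by simp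
  show "C11_family \<delta> (\<lambda>lam \<tau> y w. deriv (deriv \<phi>2) y)"
    using C11_family_smooth[OF \<phi>2_smooth \<phi>2_bounded[rule_format, of "Suc (Suc 0)"] \<phi>2_bounded[rule_format, of "Suc (Suc (Suc 0))"] \<phi>2_bounded[rule_format, of "Suc (Suc (Suc (Suc 0)))"]] by simp
qed

lemmas family_intros = C11_family_add C11_family_mult C11_family_diff C11_family_minus C11_family_power2
  C11_family_const C11_family_parameter data_families

lemma G_families:
  "C11_family \<delta> (\<lambda>lam \<tau> y w. G11 lam y)" "C11_family \<delta> (\<lambda>lam \<tau> y w. G11' lam y)"
  "C11_family \<delta> (\<lambda>lam \<tau> y w. G21 y)" "C11_family \<delta> (\<lambda>lam \<tau> y w. G21' y)"
  "C11_family \<delta> (\<lambda>lam \<tau> y w. G22 y)" "C11_family \<delta> (\<lambda>lam \<tau> y w. G22' y)"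
proof -
  have i: "C11_family \<delta> (\<lambda>lam \<tau> y w. 1 / \<psi>1 y)"
    using \<psi>1_lower by (intro C11_family_inverse[OF data_families(1) \<psi>0]) auto
  show "C11_family \<delta> (\<lambda>lam \<tau> y w. G11 lam y)" "C11_family \<delta> (\<lambda>lam \<tau> y w. G11' lam y)"
    "C11_family \<delta> (\<lambda>lam \<tau> y w. G21 y)" "C11_family \<delta> (\<lambda>lam \<tau> y w. G21' y)"
    "C11_family \<delta> (\<lambda>lam \<tau> y w. G22 y)" "C11_family \<delta> (\<lambda>lam \<tau> y w. G22' y)"
    unfolding G11_def G11'_def G21_def G21'_def G22_def G22'_def by (intro family_intros i)+
qed

text \<open>From here on \<open>w = \<tau> v\<close> with \<open>u\<^sub>j = \<tau>\<^sup>2 v\<^sub>j\<close>, so that \<open>R\<^sub>1 = \<psi>\<^sub>1 + \<tau> (g\<^sub>1\<^sub>1 + w\<^sub>1)\<close> etc.\<close>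

definition R1 where "R1 lam \<tau> y w = \<psi>1 y + \<tau> * (G11 lam y + w 1)" for w :: "nat \<Rightarrow> real"
definition S1 where "S1 lam \<tau> y w = \<psi>1 y + \<tau> * (G11 lam y + w 2)" for w :: "nat \<Rightarrow> real"
definition r2 where "r2 y w = G21 y + w 3" for w :: "nat \<Rightarrow> real"
definition s2 where "s2 y w = G22 y + w 4" for w :: "nat \<Rightarrow> real"

text \<open>For \<tau> > 0, \<tau> E is \<open>(\<kappa> \<tau> - \<kappa> 0) * (2 * lam * deriv
  \<phi>2 y + (\<psi>2 y)\<^sup>2)\<close> plus \<open>\<kappa> \<tau>\<close> times the difference
  between the product of R2 and S2 and \<open>(\<psi>2 y)\<^sup>2\<close>: the remainder left by the
  cancellation at \<tau> = 0, common to the first two equations.\<close>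

definition E where "E lam \<tau> y w = \<kappa>1 \<tau> * (2 * lam * deriv \<phi>2 y + (\<psi>2 y)\<^sup>2)
  + \<kappa> \<tau> * (\<psi>2 y * (r2 y w + s2 y w) + \<tau> * (r2 y w * s2 y w))" for w :: "nat \<Rightarrow> real"

text \<open>The coupling between the pairs (1, 2) and (3, 4) through lam. It acts on differences of
  v, not of w, so shrinking \<delta> does not weaken it.\<close>

definition alpha :: "nat \<Rightarrow> real \<Rightarrow> real \<Rightarrow> real \<Rightarrow> (nat \<Rightarrow> real) \<Rightarrow> real" where
  "alpha i lam \<tau> y w = (if i = 1 then \<kappa> \<tau> * (1 / S1 lam \<tau> y w) else if i = 2 then \<kappa> \<tau> * (1 / R1 lam \<tau> y w)
     else if i = 3 then - \<mu> \<tau> * (1 / S1 lam \<tau> y w) else - \<mu> \<tau> * (1 / R1 lam \<tau> y w))"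

text \<open>The remaining terms of the regularized identities, with \<tau> D and \<tau> D2 written
  as differences of w: here v occurs only as \<tau> v.\<close>

definition beta :: "nat \<Rightarrow> real \<Rightarrow> real \<Rightarrow> real \<Rightarrow> (nat \<Rightarrow> real) \<Rightarrow> real" where
  "beta i lam \<tau> y w =
    (if i = 1 then (1 / S1 lam \<tau> y w) * (1 / 4 * (w 1 - w 2)\<^sup>2 - 1 / 4 * (A \<tau>)\<^sup>2 * (w 3 - w 4 - 2 * deriv \<phi>2 y)\<^sup>2
       + (1 / cp \<tau>) * (deriv \<psi>1 y + G11' lam y * \<tau>) - (E lam \<tau> y w + G11 lam y * (G11 lam y + w 2)))
     else if i = 2 then (1 / R1 lam \<tau> y w) * (1 / 4 * (w 1 - w 2)\<^sup>2 - 1 / 4 * (A \<tau>)\<^sup>2 * (w 3 - w 4 - 2 * deriv \<phi>2 y)\<^sup>2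
       - (1 / cp \<tau>) * (deriv \<psi>1 y + G11' lam y * \<tau>) - (E lam \<tau> y w + G11 lam y * (G11 lam y + w 1)))
     else if i = 3 then (1 / S1 lam \<tau> y w) * (1 / 2 * (w 1 - w 2) * (w 3 - w 4) - deriv \<phi>2 y * (w 1 - w 2)
       + \<mu> \<tau> * ((\<psi>2 y + \<tau> * s2 y w) * (w 1 - w 2)) + (1 / cp \<tau>) * (deriv \<psi>2 y + G21' y * \<tau>))
       + 2 * \<mu>1 \<tau> * \<psi>2 y + \<mu> \<tau> * (r2 y w + s2 y w)
     else (1 / R1 lam \<tau> y w) * (1 / 2 * (w 1 - w 2) * (w 3 - w 4) - deriv \<phi>2 y * (w 1 - w 2)
       - \<mu> \<tau> * ((\<psi>2 y + \<tau> * r2 y w) * (w 1 - w 2)) - (1 / cp \<tau>) * (deriv \<psi>2 y + G22' y * \<tau>))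
       + 2 * \<mu>1 \<tau> * \<psi>2 y + \<mu> \<tau> * (r2 y w + s2 y w))"

definition ell :: "nat \<Rightarrow> real \<Rightarrow> real \<Rightarrow> real \<Rightarrow> (nat \<Rightarrow> real) \<Rightarrow> real" where
  "ell i lam \<tau> y w = (if odd i then - (1 / cp \<tau>) * (1 / S1 lam \<tau> y w) else (1 / cp \<tau>) * (1 / R1 lam \<tau> y w))"

text \<open>Uses only |w| <= 1 and the bound on \<open>G11\<close> for |lam| <= 1, so this first
  \<delta> is available before anything is known about the solution.\<close>

lemma denominators_positive:
  obtains \<delta> where "\<delta> > 0" "\<delta> \<le> 1"
    "\<And>lam \<tau> y x. \<bar>lam\<bar> \<le> 1 \<Longrightarrow> \<tau> \<in> {0..\<delta>} \<Longrightarrow> \<bar>x\<bar> \<le> 1 \<Longrightarrow> \<psi>0 / 2 \<le> \<psi>1 y + \<tau> * (G11 lam y + x)"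
proof -
  have "\<exists>K. \<forall>lam (\<tau> :: real). \<bar>lam\<bar> \<le> 1 \<longrightarrow> \<tau> \<in> {0..1} \<longrightarrow> C11 K (\<lambda>y w. G11 lam y)"
    using G_families(1)[of 1] unfolding C11_family_def by (rule conjunct1)
  then obtain K where KC: "\<And>lam (\<tau> :: real). \<bar>lam\<bar> \<le> 1 \<Longrightarrow> \<tau> \<in> {0..1} \<Longrightarrow> C11 K (\<lambda>y w. G11 lam y)" by blast
  have K: "\<bar>G11 lam y\<bar> \<le> K" if "\<bar>lam\<bar> \<le> 1" for lam y
  proof -
    have "C11 K (\<lambda>y w. G11 lam y)" using KC[OF that, of 0] by simp
    then show ?thesis using C11_bound[OF _ zero_in_unit_box] by blast
  qed
  have K0: "K \<ge> 0" using order_trans[OF abs_ge_zero K[of 0 0]] by simp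
  define k where "k = K + 1"
  have k: "k > 0" using K0 by (simp add: k_def)
  \<comment> \<open>With k bounding |G11 + x|, the perturbation of \<open>\<psi>1\<close> is at most
    \<delta> k, hence at most half of its lower bound.\<close>
  define \<delta> where "\<delta> = min 1 (\<psi>0 / (2 * k))"
  have "\<delta> \<le> \<psi>0 / (2 * k)" by (simp add: \<delta>_def)
  then have "\<delta> * k \<le> \<psi>0 / (2 * k) * k" using k by (intro mult_right_mono) auto
  also have "\<dots> = \<psi>0 / 2" using k by simp
  finally have \<delta>: "\<delta> > 0" "\<delta> \<le> 1" "\<delta> * k \<le> \<psi>0 / 2" using \<psi>0 k by (simp_all add: \<delta>_def)
  show thesis
  proof (rule that[OF \<delta>(1,2)])
    fix lam \<tau> y x :: real assume h: "\<bar>lam\<bar> \<le> 1" "\<tau> \<in> {0..\<delta>}" "\<bar>x\<bar> \<le> 1"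
    have "\<bar>G11 lam y + x\<bar> \<le> k" unfolding k_def by (rule order_trans[OF abs_triangle_ineq add_mono[OF K[OF h(1)] h(3)]])
    then have "\<bar>\<tau> * (G11 lam y + x)\<bar> \<le> \<delta> * k" unfolding abs_mult using h(2) k by (intro mult_mono) auto
    then have "\<bar>\<tau> * (G11 lam y + x)\<bar> \<le> \<psi>0 / 2" using \<delta>(3) by (rule order_trans)
    moreover have "\<psi>0 / 2 \<le> p + q" if "\<bar>q\<bar> \<le> \<psi>0 / 2" "\<psi>0 \<le> p" for p q using that by linarith
    ultimately show "\<psi>0 / 2 \<le> \<psi>1 y + \<tau> * (G11 lam y + x)" using \<psi>1_lower by blast
  qed
qed

lemma coefficient_families:
  assumes \<delta>: "\<And>lam \<tau> y x. \<bar>lam\<bar> \<le> 1 \<Longrightarrow> \<tau> \<in> {0..\<delta>} \<Longrightarrow> \<bar>x\<bar> \<le> 1 \<Longrightarrow> \<psi>0 / 2 \<le> \<psi>1 y + \<tau> * (G11 lam y + x)"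
  shows "C11_family \<delta> (alpha i)" "C11_family \<delta> (beta i)" "C11_family \<delta> (ell i)"
proof -
  have w: "C11_family \<delta> (\<lambda>lam \<tau> y w. w 1)" "C11_family \<delta> (\<lambda>lam \<tau> y w. w 2)" "C11_family \<delta> (\<lambda>lam \<tau> y w. w 3)" "C11_family \<delta> (\<lambda>lam \<tau> y w. w 4)"
    by (auto intro: C11_family_coordinate)
  have t: "C11_family \<delta> (\<lambda>lam \<tau> y w. \<tau>)" by (rule C11_family_time) (rule continuous_on_id)
  have co: "C11_family \<delta> (\<lambda>lam \<tau> y w. A \<tau>)" "C11_family \<delta> (\<lambda>lam \<tau> y w. \<kappa> \<tau>)" "C11_family \<delta> (\<lambda>lam \<tau> y w. \<mu> \<tau>)"
    "C11_family \<delta> (\<lambda>lam \<tau> y w. \<kappa>1 \<tau>)" "C11_family \<delta> (\<lambda>lam \<tau> y w. \<mu>1 \<tau>)" "C11_family \<delta> (\<lambda>lam \<tau> y w. 1 / cp \<tau>)"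
    by (intro C11_family_time coefficient_continuous quotient_continuous continuous_on_divide continuous_on_const ballI cp_nz)+
  have i1: "C11_family \<delta> (\<lambda>lam \<tau> y w. 1 / R1 lam \<tau> y w)"
  proof (rule C11_family_inverse)
    show "C11_family \<delta> R1" unfolding R1_def[abs_def] by (intro family_intros G_families t w)
    show "\<psi>0 / 2 > 0" using \<psi>0 by simp
    fix lam \<tau> y :: real and w assume h: "\<bar>lam\<bar> \<le> 1" "\<tau> \<in> {0..\<delta>}" "w \<in> unit_box"
    have "\<bar>w 1\<bar> \<le> 1" using h(3) by (simp add: unit_box_def)
    then show "\<psi>0 / 2 \<le> R1 lam \<tau> y w" unfolding R1_def by (rule \<delta>[OF h(1,2)])
  qed
  have i2: "C11_family \<delta> (\<lambda>lam \<tau> y w. 1 / S1 lam \<tau> y w)"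
  proof (rule C11_family_inverse)
    show "C11_family \<delta> S1" unfolding S1_def[abs_def] by (intro family_intros G_families t w)
    show "\<psi>0 / 2 > 0" using \<psi>0 by simp
    fix lam \<tau> y :: real and w assume h: "\<bar>lam\<bar> \<le> 1" "\<tau> \<in> {0..\<delta>}" "w \<in> unit_box"
    have "\<bar>w 2\<bar> \<le> 1" using h(3) by (simp add: unit_box_def)
    then show "\<psi>0 / 2 \<le> S1 lam \<tau> y w" unfolding S1_def by (rule \<delta>[OF h(1,2)])
  qed
  have rs: "C11_family \<delta> (\<lambda>lam \<tau> y w. r2 y w)" "C11_family \<delta> (\<lambda>lam \<tau> y w. s2 y w)"
    unfolding r2_def s2_def by (intro family_intros G_families w)+
  have E: "C11_family \<delta> (\<lambda>lam \<tau> y w. E lam \<tau> y w)"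
    unfolding E_def by (intro family_intros rs co t)
  have b: "C11_family \<delta> (\<lambda>lam \<tau> y w. if b then p lam \<tau> y w else q lam \<tau> y w)"
    if "C11_family \<delta> p" "C11_family \<delta> q" for b p q using that by (cases b) simp_all
  show "C11_family \<delta> (alpha i)" unfolding alpha_def[abs_def] by (intro b family_intros co i1 i2)
  show "C11_family \<delta> (beta i)" unfolding beta_def[abs_def] by (intro b family_intros G_families w t co i1 i2 rs E)
  show "C11_family \<delta> (ell i)" unfolding ell_def[abs_def] by (intro b family_intros co i1 i2)
qed

text \<open>Sorted by how v enters: with the fixed coefficient +-1 / 2, with a factor lam, and
  through \<tau> v only. The alternating sign reflects the exchange of R and S between the two
  characteristic families.\<close>

definition rhs :: "real \<Rightarrow> nat \<Rightarrow> real \<Rightarrow> real \<Rightarrow> (nat \<Rightarrow> real) \<Rightarrow> real" where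
  "rhs lam i \<tau> y v = (if odd i then 1 / 2 else - (1 / 2)) * (if i \<le> 2 then v 1 - v 2 else v 3 - v 4)
     + lam * alpha i lam \<tau> y (\<lambda>j. \<tau> * v j) * (if i \<le> 2 then v 3 - v 4 else v 1 - v 2) + beta i lam \<tau> y (\<lambda>j. \<tau> * v j)"

lemma hodograph_eqsI:
  assumes \<tau>: "\<tau> > 0" and R: "R1 lam \<tau> y (\<lambda>j. \<tau> * v j) \<noteq> 0" and S: "S1 lam \<tau> y (\<lambda>j. \<tau> * v j) \<noteq> 0"
    and ut: "\<And>i. i \<in> {1..4} \<Longrightarrow> ut i = \<tau> * rhs lam i \<tau> y v - \<tau> * ell i lam \<tau> y (\<lambda>j. \<tau> * v j) * uy i"
  shows "hodograph_eqs c a \<phi>1 \<phi>2 \<psi>1 \<psi>2 lam \<tau> y (\<lambda>j. \<tau>\<^sup>2 * v j) ut uy"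
proof -
  define w where "w = (\<lambda>j. \<tau> * v j)"
  let ?R = "R1 lam \<tau> y w" and ?S = "S1 lam \<tau> y w" and ?R2 = "\<psi>2 y + \<tau> * r2 y w" and ?S2 = "\<psi>2 y + \<tau> * s2 y w"
  have u1: "\<tau>\<^sup>2 * v 1 + \<psi>1 y + G11 lam y * \<tau> = ?R" "\<tau>\<^sup>2 * v 2 + \<psi>1 y + G11 lam y * \<tau> = ?S"
    by (simp_all add: R1_def S1_def w_def algebra_simps power2_eq_square)
  have u2: "\<tau>\<^sup>2 * v 3 + \<psi>2 y + G21 y * \<tau> = ?R2" "\<tau>\<^sup>2 * v 4 + \<psi>2 y + G22 y * \<tau> = ?S2"
    by (simp_all add: r2_def s2_def w_def algebra_simps power2_eq_square)
  have nz: "\<tau> \<noteq> 0" "?R \<noteq> 0" "?S \<noteq> 0" using \<tau> R S by (auto simp: w_def)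
  have RS: "?R = ?S + \<tau> * (\<tau> * (v 1 - v 2))" "?S = ?R + \<tau> * (\<tau> * (- (v 1 - v 2)))"
    by (simp_all add: R1_def S1_def w_def algebra_simps)
  have Q: "?R2 - ?S2 = \<tau> * (w 3 - w 4 - 2 * deriv \<phi>2 y)"
    "?S2 - ?R2 = \<tau> * - (w 3 - w 4 - 2 * deriv \<phi>2 y)"
    by (simp_all add: r2_def s2_def G21_def G22_def algebra_simps)
  have Q': "w 3 - w 4 - 2 * deriv \<phi>2 y = \<tau> * (v 3 - v 4) - 2 * deriv \<phi>2 y"
    "- (w 3 - w 4 - 2 * deriv \<phi>2 y) = \<tau> * - (v 3 - v 4) - 2 * - deriv \<phi>2 y"
    by (simp_all add: w_def algebra_simps)
  have G: "G11 lam y * \<psi>1 y = - (\<kappa> 0 * ((\<psi>2 y)\<^sup>2 + 2 * lam * deriv \<phi>2 y))"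
    using \<psi>1_pos[of y] by (simp add: G11_def)
  have \<kappa>: "\<tau> * \<kappa>1 \<tau> = \<kappa> \<tau> - \<kappa> 0" and \<mu>: "\<tau> * \<mu>1 \<tau> = \<mu> \<tau> - \<mu> 0" using \<tau> by (simp_all add: \<kappa>1_def \<mu>1_def)
  have w12: "w 1 - w 2 = \<tau> * (v 1 - v 2)" "w 3 - w 4 = \<tau> * (v 3 - v 4)" by (simp_all add: w_def algebra_simps)
  note 1 = source_regularized_1[OF nz(1,3) RS(1) Q(1) Q'(1) refl refl S1_def G \<kappa>_def \<kappa>, of "deriv \<psi>1 y + G11' lam y * \<tau>"]
  \<comment> \<open>Exchanging \<open>R1\<close> and \<open>S1\<close> reverses D, and the opposite
    characteristic speed reverses the last term; R2 - S2 keeps its sign in this equation.\<close>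
  note 2 = source_regularized_1[OF nz(1,2) RS(2) Q(1) Q'(1) refl refl R1_def G \<kappa>_def \<kappa>, of "- (deriv \<psi>1 y + G11' lam y * \<tau>)"]
  note 3 = source_regularized_2[OF nz(1,3) RS(1) Q(1) Q'(1) refl refl G21_def \<mu>_def \<mu>, of lam "deriv \<psi>2 y + G21' y * \<tau>"]
  have G22: "G22 y = - (- deriv \<phi>2 y) + 2 * \<mu> 0 * \<psi>2 y" by (simp add: G22_def)
  \<comment> \<open>Here the second pair is exchanged as well, so Q and \<open>deriv \<phi>2\<close>
    change sign. The lam term of the fourth equation keeps R1 - S1, which is why the identity is
    used with - lam.\<close>
  note 4 = source_regularized_2[OF nz(1,2) RS(2) Q(2) Q'(2) refl refl G22 \<mu>_def \<mu>, of "- lam" "- (deriv \<psi>2 y + G22' y * \<tau>)"]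
  have n: "odd (1::nat)" "\<not> odd (2::nat)" "odd (3::nat)" "\<not> odd (4::nat)" "(1::nat) \<le> 2" "(2::nat) \<le> 2" "\<not> (3::nat) \<le> 2" "\<not> (4::nat) \<le> 2"
    "(2::nat) \<noteq> 1" "(3::nat) \<noteq> 1" "(4::nat) \<noteq> 1" "(3::nat) \<noteq> 2" "(4::nat) \<noteq> 2" "(4::nat) \<noteq> 3" by simp_all
  note unfold = rhs_def alpha_def beta_def E_def w_def[symmetric] w12 n if_True if_False refl not_False_eq_True not_True_eq_False
  have speed: "\<tau> * (- (1 / cp \<tau>) * (1 / z)) = - \<tau> / (cp \<tau> * z)" "\<tau> * ((1 / cp \<tau>) * (1 / z)) = \<tau> / (cp \<tau> * z)" for z by simp_all
  have e: "ut 1 + - \<tau> / (cp \<tau> * ?S) * uy 1 = \<tau> * rhs lam 1 \<tau> y v"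
    "ut 2 + \<tau> / (cp \<tau> * ?R) * uy 2 = \<tau> * rhs lam 2 \<tau> y v"
    "ut 3 + - \<tau> / (cp \<tau> * ?S) * uy 3 = \<tau> * rhs lam 3 \<tau> y v"
    "ut 4 + \<tau> / (cp \<tau> * ?R) * uy 4 = \<tau> * rhs lam 4 \<tau> y v"
    using ut[of 1] ut[of 2] ut[of 3] ut[of 4] unfolding w_def[symmetric] ell_def speed[symmetric]
    by (simp_all only: n if_True if_False not_False_eq_True atLeastAtMost_iff) simp_all
  show ?thesis
    unfolding hodograph_eqs_def Let_def g11_eq g2_eq deriv_G u1 u2 A_def[symmetric] Ap_def[symmetric] cp_def[symmetric] e
  proof (intro conjI)
    show "\<tau> * rhs lam 1 \<tau> y v =
      (?R + ?S) * (?R - ?S) / (4 * ?S * \<tau>) +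
      lam * A \<tau> * Ap \<tau> * (?R2 - ?S2) / (cp \<tau> * ?S * \<tau>) -
      (A \<tau>)\<^sup>2 * (?R2 - ?S2)\<^sup>2 / (4 * ?S * \<tau>) -
      A \<tau> * Ap \<tau> * ?R2 * ?S2 / (cp \<tau> * ?S) - G11 lam y +
      \<tau> * (deriv \<psi>1 y + G11' lam y * \<tau>) / (cp \<tau> * ?S)"
      unfolding 1 by (simp only: unfold)
    have "\<tau> * rhs lam 2 \<tau> y v =
      (?S + ?R) * (?S - ?R) / (4 * ?R * \<tau>) +
      lam * A \<tau> * Ap \<tau> * (?R2 - ?S2) / (cp \<tau> * ?R * \<tau>) -
      (A \<tau>)\<^sup>2 * (?R2 - ?S2)\<^sup>2 / (4 * ?R * \<tau>) -
      A \<tau> * Ap \<tau> * ?R2 * ?S2 / (cp \<tau> * ?R) - G11 lam y +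
      \<tau> * - (deriv \<psi>1 y + G11' lam y * \<tau>) / (cp \<tau> * ?R)"
      unfolding 2 by (simp only: unfold) algebra
    then show "\<tau> * rhs lam 2 \<tau> y v =
      (?R + ?S) * (?S - ?R) / (4 * ?R * \<tau>) +
      lam * A \<tau> * Ap \<tau> * (?R2 - ?S2) / (cp \<tau> * ?R * \<tau>) -
      (A \<tau>)\<^sup>2 * (?R2 - ?S2)\<^sup>2 / (4 * ?R * \<tau>) -
      A \<tau> * Ap \<tau> * ?R2 * ?S2 / (cp \<tau> * ?R) - G11 lam y -
      \<tau> * (deriv \<psi>1 y + G11' lam y * \<tau>) / (cp \<tau> * ?R)"
      by (simp only: mult_minus_right minus_divide_left[symmetric] add_uminus_conv_diff add.commute[of "?S"])
    show "\<tau> * rhs lam 3 \<tau> y v =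
      ?R * (?R2 - ?S2) / (2 * ?S * \<tau>) -
      lam * Ap \<tau> * (?R - ?S) / (A \<tau> * cp \<tau> * ?S * \<tau>) +
      Ap \<tau> * (?R * ?S2 + ?R2 * ?S) / (A \<tau> * cp \<tau> * ?S) - G21 y +
      \<tau> * (deriv \<psi>2 y + G21' y * \<tau>) / (cp \<tau> * ?S)"
      unfolding 3 by (simp only: unfold)
    have "\<tau> * rhs lam 4 \<tau> y v =
      ?S * (?S2 - ?R2) / (2 * ?R * \<tau>) -
      - lam * Ap \<tau> * (?S - ?R) / (A \<tau> * cp \<tau> * ?R * \<tau>) +
      Ap \<tau> * (?S * ?R2 + ?S2 * ?R) / (A \<tau> * cp \<tau> * ?R) - G22 y +
      \<tau> * - (deriv \<psi>2 y + G22' y * \<tau>) / (cp \<tau> * ?R)"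
      unfolding 4 by (simp only: unfold) algebra
    also have "- lam * Ap \<tau> * (?S - ?R) = lam * Ap \<tau> * (?R - ?S)" by (simp add: algebra_simps)
    also have "?S * ?R2 + ?S2 * ?R =
      ?R * ?S2 + ?R2 * ?S" by (simp add: algebra_simps)
    finally show "\<tau> * rhs lam 4 \<tau> y v =
      ?S * (?S2 - ?R2) / (2 * ?R * \<tau>) -
      lam * Ap \<tau> * (?R - ?S) / (A \<tau> * cp \<tau> * ?R * \<tau>) +
      Ap \<tau> * (?R * ?S2 + ?R2 * ?S) / (A \<tau> * cp \<tau> * ?R) - G22 y -
      \<tau> * (deriv \<psi>2 y + G22' y * \<tau>) / (cp \<tau> * ?R)"
      by (simp only: mult_minus_right minus_divide_left[symmetric] add_uminus_conv_diff)
  qed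
qed

end

section \<open>Estimates for the regularized source and speed\<close>

text \<open>The common shape of the four right-hand sides, so that the estimates are made once, with
  the indices, the sign s and the coefficients p, q as parameters.\<close>

definition source :: "real \<Rightarrow> real \<Rightarrow> real \<Rightarrow> (real \<Rightarrow> (nat \<Rightarrow> real) \<Rightarrow> real) \<Rightarrow> (real \<Rightarrow> (nat \<Rightarrow> real) \<Rightarrow> real)
    \<Rightarrow> nat \<Rightarrow> nat \<Rightarrow> nat \<Rightarrow> nat \<Rightarrow> real \<Rightarrow> (nat \<Rightarrow> real) \<Rightarrow> real" where
  "source lam \<tau> s p q j k j' k' y v = s * (v j - v k) + lam * p y (\<lambda>j. \<tau> * v j) * (v j' - v k') + q y (\<lambda>j. \<tau> * v j)"

context
  fixes K \<tau> :: real
  assumes K: "K \<ge> 1" and \<tau>: "0 \<le> \<tau>" "\<tau> * K \<le> 1 / 8"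
begin

lemma \<tau>_le: "\<tau> \<le> 1 / 8"
  using mult_left_mono[OF K \<tau>(1)] \<tau>(2) by simp

lemma scaled_in_box:
  assumes "\<forall>j\<in>{1..4}. \<bar>v j\<bar> \<le> 2 * K"
  shows "(\<lambda>j. \<tau> * v j) \<in> unit_box"
proof -
  have "\<bar>\<tau> * v j\<bar> \<le> 1" if "j \<in> {1..4}" for j
  proof -
    have "\<bar>\<tau> * v j\<bar> \<le> \<tau> * (2 * K)" unfolding abs_mult abs_of_nonneg[OF \<tau>(1)] by (rule mult_left_mono[OF bspec[OF assms that] \<tau>(1)])
    also have "\<dots> = 2 * (\<tau> * K)" by simp
    also have "\<dots> \<le> 1" using \<tau>(2) by linarith
    finally show ?thesis .
  qed
  then show ?thesis by (simp add: unit_box_def)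
qed

lemma abs_scaled_le: "\<bar>x\<bar> \<le> d \<Longrightarrow> \<bar>\<tau> * x\<bar> \<le> \<tau> * d"
  unfolding abs_mult abs_of_nonneg[OF \<tau>(1)] by (rule mult_left_mono[OF _ \<tau>(1)])

text \<open>\<open>C11\<close> allows one step size for y and w together, whereas y and v move at
  different scales here. Since w = \<tau> v, the common steps are dy + \<tau> dv and ey + \<tau>
  ev.\<close>

lemma scaled_sd_bound:
  assumes h: "C11 K h"
    and v: "\<forall>j\<in>{1..4}. \<bar>v j\<bar> \<le> 2 * K" "\<forall>j\<in>{1..4}. \<bar>v' j\<bar> \<le> 2 * K" "\<forall>j\<in>{1..4}. \<bar>vm j\<bar> \<le> 2 * K"
    and y: "\<bar>y - ym\<bar> \<le> dy" "\<bar>y' - ym\<bar> \<le> dy" "\<bar>y + y' - 2 * ym\<bar> \<le> ey"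
    and dv: "\<forall>j\<in>{1..4}. \<bar>v j - vm j\<bar> \<le> dv" "\<forall>j\<in>{1..4}. \<bar>v' j - vm j\<bar> \<le> dv"
      "\<forall>j\<in>{1..4}. \<bar>v j + v' j - 2 * vm j\<bar> \<le> ev"
  shows "\<bar>h y (\<lambda>j. \<tau> * v j) - h ym (\<lambda>j. \<tau> * vm j)\<bar> \<le> K * (dy + \<tau> * dv)"
    "\<bar>h y' (\<lambda>j. \<tau> * v' j) - h ym (\<lambda>j. \<tau> * vm j)\<bar> \<le> K * (dy + \<tau> * dv)"
    "\<bar>h y (\<lambda>j. \<tau> * v j) + h y' (\<lambda>j. \<tau> * v' j) - 2 * h ym (\<lambda>j. \<tau> * vm j)\<bar> \<le> K * ((dy + \<tau> * dv)\<^sup>2 + (ey + \<tau> * ev))"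
proof -
  have n: "0 \<le> dv" "0 \<le> ev" "0 \<le> dy" "0 \<le> ey"
    using order_trans[OF abs_ge_zero bspec[OF dv(1), of 1]] order_trans[OF abs_ge_zero bspec[OF dv(3), of 1]] order_trans[OF abs_ge_zero y(1)] order_trans[OF abs_ge_zero y(3)] by simp_all
  have n2: "0 \<le> \<tau> * dv" "0 \<le> \<tau> * ev" using n \<tau> by simp_all
  have e: "\<bar>y - ym\<bar> \<le> dy + \<tau> * dv" "\<bar>y' - ym\<bar> \<le> dy + \<tau> * dv" "\<bar>y + y' - 2 * ym\<bar> \<le> ey + \<tau> * ev"
    using y n2 by linarith+
  have 1: "\<bar>\<tau> * v j - \<tau> * vm j\<bar> \<le> dy + \<tau> * dv" "\<bar>\<tau> * v' j - \<tau> * vm j\<bar> \<le> dy + \<tau> * dv"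
    "\<bar>\<tau> * v j + \<tau> * v' j - 2 * (\<tau> * vm j)\<bar> \<le> ey + \<tau> * ev" if "j \<in> {1..4}" for j
  proof -
    have "\<tau> * v j - \<tau> * vm j = \<tau> * (v j - vm j)" "\<tau> * v' j - \<tau> * vm j = \<tau> * (v' j - vm j)"
      "\<tau> * v j + \<tau> * v' j - 2 * (\<tau> * vm j) = \<tau> * (v j + v' j - 2 * vm j)" by (simp_all add: algebra_simps)
    moreover note abs_scaled_le[OF bspec[OF dv(1) that]] abs_scaled_le[OF bspec[OF dv(2) that]] abs_scaled_le[OF bspec[OF dv(3) that]]
    ultimately show "\<bar>\<tau> * v j - \<tau> * vm j\<bar> \<le> dy + \<tau> * dv" "\<bar>\<tau> * v' j - \<tau> * vm j\<bar> \<le> dy + \<tau> * dv"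
      "\<bar>\<tau> * v j + \<tau> * v' j - 2 * (\<tau> * vm j)\<bar> \<le> ey + \<tau> * ev" using n by (simp_all add: add_increasing)
  qed
  note w = scaled_in_box[OF v(1)] scaled_in_box[OF v(2)] scaled_in_box[OF v(3)]
  show "\<bar>h y (\<lambda>j. \<tau> * v j) - h ym (\<lambda>j. \<tau> * vm j)\<bar> \<le> K * (dy + \<tau> * dv)"
    by (rule C11_lip[OF h w(1,3) e(1)]) (intro ballI 1)
  show "\<bar>h y' (\<lambda>j. \<tau> * v' j) - h ym (\<lambda>j. \<tau> * vm j)\<bar> \<le> K * (dy + \<tau> * dv)"
    by (rule C11_lip[OF h w(2,3) e(2)]) (intro ballI 1)
  show "\<bar>h y (\<lambda>j. \<tau> * v j) + h y' (\<lambda>j. \<tau> * v' j) - 2 * h ym (\<lambda>j. \<tau> * vm j)\<bar> \<le> K * ((dy + \<tau> * dv)\<^sup>2 + (ey + \<tau> * ev))"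
    by (rule C11_sd[OF h w e]) (intro ballI 1; assumption)+
qed

text \<open>The constant 3 K + 1 is generous for the speed; it is the one that
  \<open>source_sd\<close> produces, shared because the abstract system has a single K.\<close>

lemma speed_sd:
  assumes h: "C11 K h"
    and v: "\<forall>j\<in>{1..4}. \<bar>v j\<bar> \<le> 2 * K" "\<forall>j\<in>{1..4}. \<bar>v' j\<bar> \<le> 2 * K" "\<forall>j\<in>{1..4}. \<bar>vm j\<bar> \<le> 2 * K"
    and y: "\<bar>y - ym\<bar> \<le> dy" "\<bar>y' - ym\<bar> \<le> dy" "\<bar>y + y' - 2 * ym\<bar> \<le> ey"
    and dv: "\<forall>j\<in>{1..4}. \<bar>v j - vm j\<bar> \<le> dv" "\<forall>j\<in>{1..4}. \<bar>v' j - vm j\<bar> \<le> dv"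
      "\<forall>j\<in>{1..4}. \<bar>v j + v' j - 2 * vm j\<bar> \<le> ev"
  shows "\<bar>h y (\<lambda>j. \<tau> * v j) + h y' (\<lambda>j. \<tau> * v' j) - 2 * h ym (\<lambda>j. \<tau> * vm j)\<bar> \<le> (3 * K + 1) * (dy\<^sup>2 + dv\<^sup>2 + ey + ev)"
proof -
  have n: "0 \<le> dv" "0 \<le> ev" "0 \<le> dy" "0 \<le> ey"
    using order_trans[OF abs_ge_zero bspec[OF dv(1), of 1]] order_trans[OF abs_ge_zero bspec[OF dv(3), of 1]] order_trans[OF abs_ge_zero y(1)] order_trans[OF abs_ge_zero y(3)] by simp_all
  have "\<tau> * dv \<le> 1 * dv" "\<tau> * ev \<le> 1 * ev" using \<tau>_le n by (intro mult_right_mono; simp)+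
  then have le: "dy + \<tau> * dv \<le> dy + dv" "ey + \<tau> * ev \<le> ey + ev" by simp_all
  have sq: "0 \<le> (dy - dv)\<^sup>2" by simp
  have "(dy + \<tau> * dv)\<^sup>2 \<le> (dy + dv)\<^sup>2" using le n \<tau> by (intro power_mono) auto
  also have "\<dots> \<le> 2 * (dy\<^sup>2 + dv\<^sup>2)" using sq by (simp add: power2_eq_square algebra_simps)
  finally have "K * ((dy + \<tau> * dv)\<^sup>2 + (ey + \<tau> * ev)) \<le> K * (2 * (dy\<^sup>2 + dv\<^sup>2) + (ey + ev))"
    using le K by (intro mult_left_mono add_mono) auto
  also have "\<dots> \<le> (3 * K + 1) * (dy\<^sup>2 + dv\<^sup>2 + ey + ev)"
  proof -
    have "(3 * K + 1) * (dy\<^sup>2 + dv\<^sup>2 + ey + ev) - K * (2 * (dy\<^sup>2 + dv\<^sup>2) + (ey + ev))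
        = (K + 1) * (dy\<^sup>2 + dv\<^sup>2) + (2 * K + 1) * (ey + ev)" by (simp add: algebra_simps)
    moreover have "0 \<le> (K + 1) * (dy\<^sup>2 + dv\<^sup>2) + (2 * K + 1) * (ey + ev)" using K n by simp
    ultimately show ?thesis by linarith
  qed
  finally show ?thesis by (rule order_trans[OF scaled_sd_bound(3)[OF h v y dv]])
qed

lemma speed_lip:
  assumes h: "C11 K h" and v: "\<forall>j\<in>{1..4}. \<bar>v j\<bar> \<le> 2 * K" and v': "\<forall>j\<in>{1..4}. \<bar>v' j\<bar> \<le> 2 * K"
    and d: "\<forall>j\<in>{1..4}. \<bar>v j - v' j\<bar> \<le> d"
  shows "\<bar>h y (\<lambda>j. \<tau> * v j) - h y' (\<lambda>j. \<tau> * v' j)\<bar> \<le> (3 * K + 1) * (\<bar>y - y'\<bar> + d)"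
proof -
  have d0: "0 \<le> d" using order_trans[OF abs_ge_zero bspec[OF d, of 1]] by simp
  \<comment> \<open>A two-point estimate as a degenerate triple, in which the centre coincides with
    the second point.\<close>
  have a: "\<forall>j\<in>{1..4}. \<bar>v' j - v' j\<bar> \<le> d" and b: "\<forall>j\<in>{1..4}. \<bar>v j + v' j - 2 * v' j\<bar> \<le> d" using d d0 by simp_all
  have y: "\<bar>y - y'\<bar> \<le> \<bar>y - y'\<bar>" "\<bar>y' - y'\<bar> \<le> \<bar>y - y'\<bar>" "\<bar>y + y' - 2 * y'\<bar> \<le> \<bar>y - y'\<bar>" by simp_all
  have "\<bar>h y (\<lambda>j. \<tau> * v j) - h y' (\<lambda>j. \<tau> * v' j)\<bar> \<le> K * (\<bar>y - y'\<bar> + \<tau> * d)"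
    by (rule scaled_sd_bound(1)[OF h v v' v' y d a b])
  also have "\<dots> \<le> (3 * K + 1) * (\<bar>y - y'\<bar> + d)"
    using K d0 \<tau>_le \<tau>(1) mult_right_mono[of \<tau> 1 d] by (intro mult_mono add_mono) auto
  finally show ?thesis .
qed

context
  fixes lam s :: real and p q :: "real \<Rightarrow> (nat \<Rightarrow> real) \<Rightarrow> real" and j k j' k' :: nat
  assumes lam: "\<bar>lam\<bar> * K \<le> 1 / 8" and s: "\<bar>s\<bar> \<le> 1 / 2"
    and jk: "j \<in> {1..4}" "k \<in> {1..4}" "j' \<in> {1..4}" "k' \<in> {1..4}"
    and p: "C11 K p" and q: "C11 K q"
begin

text \<open>Closes the supremum bound with B0 = 2 K: the three terms give 2 K, K / 2 and K, together
  less than 2 B0 = 4 K.\<close>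

lemma source_bound:
  assumes v: "\<forall>j\<in>{1..4}. \<bar>v j\<bar> \<le> 2 * K"
  shows "\<bar>source lam \<tau> s p q j k j' k' y v\<bar> \<le> 2 * (2 * K)"
proof -
  note w = scaled_in_box[OF v]
  have d: "\<bar>v j - v k\<bar> \<le> 4 * K" if "j \<in> {1..4}" "k \<in> {1..4}" for j k
    using bspec[OF v that(1)] bspec[OF v that(2)] by linarith
  have "\<bar>source lam \<tau> s p q j k j' k' y v\<bar> \<le> 1 / 2 * (4 * K) + (\<bar>lam\<bar> * K) * (4 * K) + K"
    unfolding source_def
    by (intro order_trans[OF abs_triangle_ineq add_mono] abs_mult_le s d jk C11_bound[OF p w] C11_bound[OF q w] order_refl)
  also have "\<dots> \<le> 1 / 2 * (4 * K) + 1 / 8 * (4 * K) + K" using lam K by (intro add_mono mult_right_mono) auto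
  also have "\<dots> \<le> 2 * (2 * K)" using K by simp
  finally show ?thesis .
qed

lemma source_lip:
  assumes v: "\<forall>j\<in>{1..4}. \<bar>v j\<bar> \<le> 2 * K" and v': "\<forall>j\<in>{1..4}. \<bar>v' j\<bar> \<le> 2 * K"
    and d: "\<forall>j\<in>{1..4}. \<bar>v j - v' j\<bar> \<le> d"
  shows "\<bar>source lam \<tau> s p q j k j' k' y v - source lam \<tau> s p q j k j' k' y' v'\<bar> \<le> (3 * K + 1) * \<bar>y - y'\<bar> + 3 / 2 * d"
proof -
  define e where "e = \<bar>y - y'\<bar> + \<tau> * d"
  have d0: "0 \<le> d" using order_trans[OF abs_ge_zero bspec[OF d, of 1]] by simp
  have e0: "\<bar>y - y'\<bar> \<le> e" "0 \<le> e" using \<tau> d0 by (simp_all add: e_def)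
  have we: "\<forall>j\<in>{1..4}. \<bar>\<tau> * v j - \<tau> * v' j\<bar> \<le> e"
  proof
    fix j :: nat assume "j \<in> {1..4}"
    then have "\<bar>\<tau> * (v j - v' j)\<bar> \<le> \<tau> * d" by (intro abs_scaled_le bspec[OF d])
    then show "\<bar>\<tau> * v j - \<tau> * v' j\<bar> \<le> e" unfolding e_def right_diff_distrib by simp
  qed
  note w = scaled_in_box[OF v] and w' = scaled_in_box[OF v']
  have dp: "\<bar>p y (\<lambda>j. \<tau> * v j) - p y' (\<lambda>j. \<tau> * v' j)\<bar> \<le> K * e" by (rule C11_lip[OF p w w' e0(1) we])
  have dq: "\<bar>q y (\<lambda>j. \<tau> * v j) - q y' (\<lambda>j. \<tau> * v' j)\<bar> \<le> K * e" by (rule C11_lip[OF q w w' e0(1) we])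
  have dv: "\<bar>(v j - v k) - (v' j - v' k)\<bar> \<le> 2 * d" if "j \<in> {1..4}" "k \<in> {1..4}" for j k
    using bspec[OF d that(1)] bspec[OF d that(2)] by linarith
  have bv: "\<bar>v j - v k\<bar> \<le> 4 * K" if "j \<in> {1..4}" "k \<in> {1..4}" for j k
    using bspec[OF v that(1)] bspec[OF v that(2)] by linarith
  have "source lam \<tau> s p q j k j' k' y v - source lam \<tau> s p q j k j' k' y' v' = s * ((v j - v k) - (v' j - v' k))
      + lam * ((p y (\<lambda>j. \<tau> * v j) - p y' (\<lambda>j. \<tau> * v' j)) * (v j' - v k') + p y' (\<lambda>j. \<tau> * v' j) * ((v j' - v k') - (v' j' - v' k')))
      + (q y (\<lambda>j. \<tau> * v j) - q y' (\<lambda>j. \<tau> * v' j))"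
    unfolding source_def by algebra
  also have "\<bar>\<dots>\<bar> \<le> 1 / 2 * (2 * d) + \<bar>lam\<bar> * (K * e * (4 * K) + K * (2 * d)) + K * e"
    by (intro order_trans[OF abs_triangle_ineq add_mono] abs_mult_le s dp dq dv bv jk C11_bound[OF p w'] order_refl)
  \<comment> \<open>The budget 3 / 2 for d is spent as follows: 1 on the main coupling, 1 / 4 on the
    lam term, and 3 / 16 on the part \<tau> d of e.\<close>
  also have "\<dots> = d + (\<bar>lam\<bar> * K) * (4 * (K * e) + 2 * d) + K * e" by (simp add: algebra_simps)
  also have "\<dots> \<le> d + 1 / 8 * (4 * (K * e) + 2 * d) + K * e"
    using mult_nonneg_nonneg[of K e] K e0 d0 by (intro add_mono mult_right_mono lam order_refl) auto
  also have "\<dots> = 5 / 4 * d + 3 / 2 * (K * \<bar>y - y'\<bar>) + 3 / 2 * ((\<tau> * K) * d)" by (simp add: e_def algebra_simps)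
  also have "\<dots> \<le> 5 / 4 * d + 3 / 2 * (K * \<bar>y - y'\<bar>) + 3 / 2 * (1 / 8 * d)"
    using \<tau>(2) d0 by (intro add_mono mult_left_mono mult_right_mono order_refl) auto
  also have "\<dots> \<le> (3 * K + 1) * \<bar>y - y'\<bar> + 3 / 2 * d"
  proof -
    have "0 \<le> K * \<bar>y - y'\<bar>" using K by simp
    moreover have "(3 * K + 1) * \<bar>y - y'\<bar> = 3 * (K * \<bar>y - y'\<bar>) + \<bar>y - y'\<bar>" by (simp add: algebra_simps)
    ultimately show ?thesis using d0 abs_ge_zero[of "y - y'"] by linarith
  qed
  finally show ?thesis .
qed

text \<open>The linear budget for ev is that of \<open>source_lip\<close>. Quadratic terms arise
  from the coefficients and from products of first differences of p and v; they determine the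
  constant 3 K + 1, with the summand 1 paying for the products.\<close>

lemma source_sd:
  assumes v: "\<forall>j\<in>{1..4}. \<bar>v j\<bar> \<le> 2 * K" "\<forall>j\<in>{1..4}. \<bar>v' j\<bar> \<le> 2 * K" "\<forall>j\<in>{1..4}. \<bar>vm j\<bar> \<le> 2 * K"
    and y: "\<bar>y - ym\<bar> \<le> dy" "\<bar>y' - ym\<bar> \<le> dy" "\<bar>y + y' - 2 * ym\<bar> \<le> ey"
    and dv: "\<forall>j\<in>{1..4}. \<bar>v j - vm j\<bar> \<le> dv" "\<forall>j\<in>{1..4}. \<bar>v' j - vm j\<bar> \<le> dv"
      "\<forall>j\<in>{1..4}. \<bar>v j + v' j - 2 * vm j\<bar> \<le> ev"
  shows "\<bar>source lam \<tau> s p q j k j' k' y v + source lam \<tau> s p q j k j' k' y' v' - 2 * source lam \<tau> s p q j k j' k' ym vm\<bar> \<le> (3 * K + 1) * (dy\<^sup>2 + dv\<^sup>2 + ey) + 3 / 2 * ev"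
proof -
  define d where "d = dy + \<tau> * dv"
  define e where "e = ey + \<tau> * ev"
  note P = scaled_sd_bound[OF p v y dv, folded d_def e_def] and Q = scaled_sd_bound[OF q v y dv, folded d_def e_def]
  have n: "0 \<le> dv" "0 \<le> ev" "0 \<le> dy" "0 \<le> ey"
    using order_trans[OF abs_ge_zero bspec[OF dv(1), of 1]] order_trans[OF abs_ge_zero bspec[OF dv(3), of 1]] order_trans[OF abs_ge_zero y(1)] order_trans[OF abs_ge_zero y(3)] by simp_all
  have n2: "0 \<le> d" "0 \<le> e" using n \<tau> by (simp_all add: d_def e_def)
  have x: "\<bar>vm j - vm k\<bar> \<le> 4 * K" "\<bar>(v j - v k) + (v' j - v' k) - 2 * (vm j - vm k)\<bar> \<le> 2 * ev"
    "\<bar>(v j - v k) - (vm j - vm k)\<bar> \<le> 2 * dv" "\<bar>(v' j - v' k) - (vm j - vm k)\<bar> \<le> 2 * dv" if "j \<in> {1..4}" "k \<in> {1..4}" for j k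
  proof -
    show "\<bar>vm j - vm k\<bar> \<le> 4 * K" using bspec[OF v(3) that(1)] bspec[OF v(3) that(2)] by linarith
    have "(v j - v k) + (v' j - v' k) - 2 * (vm j - vm k) = (v j + v' j - 2 * vm j) - (v k + v' k - 2 * vm k)" by simp
    then show "\<bar>(v j - v k) + (v' j - v' k) - 2 * (vm j - vm k)\<bar> \<le> 2 * ev" using bspec[OF dv(3) that(1)] bspec[OF dv(3) that(2)] by linarith
    show "\<bar>(v j - v k) - (vm j - vm k)\<bar> \<le> 2 * dv" using bspec[OF dv(1) that(1)] bspec[OF dv(1) that(2)] by linarith
    show "\<bar>(v' j - v' k) - (vm j - vm k)\<bar> \<le> 2 * dv" using bspec[OF dv(2) that(1)] bspec[OF dv(2) that(2)] by linarith
  qed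
  have prod: "\<bar>p y (\<lambda>j. \<tau> * v j) * (v j' - v k') + p y' (\<lambda>j. \<tau> * v' j) * (v' j' - v' k') - 2 * (p ym (\<lambda>j. \<tau> * vm j) * (vm j' - vm k'))\<bar>
      \<le> K * (d\<^sup>2 + e) * (4 * K) + K * (2 * ev) + K * d * (2 * dv) + K * d * (2 * dv)"
    by (rule second_difference_mult_bound[OF P(3) x(1)[OF jk(3,4)] C11_bound[OF p scaled_in_box[OF v(3)]] x(2)[OF jk(3,4)] P(1) x(3)[OF jk(3,4)] P(2) x(4)[OF jk(3,4)]])
  have "source lam \<tau> s p q j k j' k' y v + source lam \<tau> s p q j k j' k' y' v' - 2 * source lam \<tau> s p q j k j' k' ym vm = s * ((v j - v k) + (v' j - v' k) - 2 * (vm j - vm k))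
      + lam * (p y (\<lambda>j. \<tau> * v j) * (v j' - v k') + p y' (\<lambda>j. \<tau> * v' j) * (v' j' - v' k') - 2 * (p ym (\<lambda>j. \<tau> * vm j) * (vm j' - vm k')))
      + (q y (\<lambda>j. \<tau> * v j) + q y' (\<lambda>j. \<tau> * v' j) - 2 * q ym (\<lambda>j. \<tau> * vm j))"
    unfolding source_def by algebra
  also have "\<bar>\<dots>\<bar> \<le> 1 / 2 * (2 * ev) + \<bar>lam\<bar> * (K * (d\<^sup>2 + e) * (4 * K) + K * (2 * ev) + K * d * (2 * dv) + K * d * (2 * dv)) + K * (d\<^sup>2 + e)"
    by (intro order_trans[OF abs_triangle_ineq add_mono] abs_mult_le s prod Q(3) x(2) jk order_refl)
  also have "\<dots> = ev + (\<bar>lam\<bar> * K) * (4 * (K * (d\<^sup>2 + e)) + 2 * ev + 4 * (d * dv)) + K * (d\<^sup>2 + e)" by (simp add: algebra_simps)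
  also have "\<dots> \<le> ev + 1 / 8 * (4 * (K * (d\<^sup>2 + e)) + 2 * ev + 4 * (d * dv)) + K * (d\<^sup>2 + e)"
    using n n2 K by (intro add_mono mult_right_mono lam order_refl) (auto intro!: add_nonneg_nonneg mult_nonneg_nonneg)
  also have "\<dots> = 5 / 4 * ev + 3 / 2 * (K * d\<^sup>2) + 3 / 2 * (K * ey) + 3 / 2 * ((\<tau> * K) * ev) + 1 / 2 * (d * dv)" by (simp add: e_def algebra_simps)
  also have "\<dots> \<le> 5 / 4 * ev + 3 / 2 * (K * (2 * (dy\<^sup>2 + dv\<^sup>2))) + 3 / 2 * (K * ey) + 3 / 2 * (1 / 8 * ev) + 1 / 2 * (2 * (dy\<^sup>2 + dv\<^sup>2))"
  proof -
    have "\<tau> * dv \<le> 1 * dv" using \<tau>_le n(1) by (intro mult_right_mono) auto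
    then have dle: "d \<le> dy + dv" by (simp add: d_def)
    have sq: "0 \<le> (dy - dv)\<^sup>2" by simp
    have "d\<^sup>2 \<le> (dy + dv)\<^sup>2" using dle n2 by (intro power_mono) auto
    also have "\<dots> \<le> 2 * (dy\<^sup>2 + dv\<^sup>2)" using sq by (simp add: power2_eq_square algebra_simps)
    finally have d2: "d\<^sup>2 \<le> 2 * (dy\<^sup>2 + dv\<^sup>2)" .
    have "d * dv \<le> (dy + dv) * dv" using dle n by (intro mult_right_mono)
    also have "\<dots> \<le> 2 * (dy\<^sup>2 + dv\<^sup>2)"
    proof -
      have "2 * (dy\<^sup>2 + dv\<^sup>2) - (dy + dv) * dv = 1 / 2 * (dy - dv)\<^sup>2 + 3 / 2 * dy\<^sup>2 + 1 / 2 * dv\<^sup>2" by (simp add: power2_eq_square algebra_simps)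
      moreover have "0 \<le> 1 / 2 * (dy - dv)\<^sup>2 + 3 / 2 * dy\<^sup>2 + 1 / 2 * dv\<^sup>2" by simp
      ultimately show ?thesis by linarith
    qed
    finally have dd: "d * dv \<le> 2 * (dy\<^sup>2 + dv\<^sup>2)" .
    show ?thesis using K n by (intro add_mono mult_left_mono mult_right_mono d2 dd \<tau>(2) order_refl) auto
  qed
  also have "\<dots> \<le> (3 * K + 1) * (dy\<^sup>2 + dv\<^sup>2 + ey) + 3 / 2 * ev"
  proof -
    have "(3 * K + 1) * (dy\<^sup>2 + dv\<^sup>2 + ey) + 3 / 2 * ev
        - (5 / 4 * ev + 3 / 2 * (K * (2 * (dy\<^sup>2 + dv\<^sup>2))) + 3 / 2 * (K * ey) + 3 / 2 * (1 / 8 * ev) + 1 / 2 * (2 * (dy\<^sup>2 + dv\<^sup>2)))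
        = 3 / 2 * (K * ey) + ey + 1 / 16 * ev" by (simp add: algebra_simps)
    moreover have "0 \<le> 3 / 2 * (K * ey) + ey + 1 / 16 * ev" using K n by simp
    ultimately show ?thesis by linarith
  qed
  finally show ?thesis .
qed

end

end

section \<open>Choice of the constants and the solution\<close>

context hodograph_data
begin

lemma rhs_eq_source:
  "rhs lam i \<tau> y v = source lam \<tau> (if odd i then 1 / 2 else - (1 / 2)) (alpha i lam \<tau>) (beta i lam \<tau>)
     (if i \<le> 2 then 1 else 3) (if i \<le> 2 then 2 else 4) (if i \<le> 2 then 3 else 1) (if i \<le> 2 then 4 else 2) y v"
  by (simp add: rhs_def source_def)

lemma transport:
  assumes K: "K \<ge> 1" and lam: "\<bar>lam\<bar> * K \<le> 1 / 8" and \<delta>1: "\<delta> \<le> \<delta>1" and \<delta>: "\<delta> > 0" "\<delta> * K \<le> 1 / 8"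
    and fam: "\<And>i. C11_family \<delta>1 (alpha i)" "\<And>i. C11_family \<delta>1 (beta i)" "\<And>i. C11_family \<delta>1 (ell i)"
    and C11: "\<forall>i\<in>{1..4}. \<forall>lam \<tau>. \<bar>lam\<bar> \<le> 1 \<longrightarrow> \<tau> \<in> {0..\<delta>1} \<longrightarrow> C11 K (alpha i lam \<tau>) \<and> C11 K (beta i lam \<tau>) \<and> C11 K (ell i lam \<tau>)"
    and B: "B1 = 4 * (3 * K + 1)" "B2 = 6 * ((3 * K + 1) * (3 + 2 * B1\<^sup>2) + 2 * B1)" "N = 4 * ((3 * K + 1) + 2 * B1) + 1"
    and small: "\<delta>\<^sup>2 * ((3 * K + 1) * (3 + B1\<^sup>2 + B1 + 2 * B2 + N)) \<le> 1 / 10"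
  shows "degenerate_transport {1..4} (rhs lam) (\<lambda>i \<tau> y v. ell i lam \<tau> y (\<lambda>j. \<tau> * v j)) \<delta> (3 * K + 1) (2 * K) B1 B2 N"
proof -
  have lam1: "\<bar>lam\<bar> \<le> 1" using lam K mult_left_mono[OF K abs_ge_zero[of lam]] by simp
  have t: "0 \<le> \<tau>" "\<tau> * K \<le> 1 / 8" "\<tau> \<in> {0..\<delta>1}" if "\<tau> \<in> {0..\<delta>}" for \<tau>
  proof -
    show "0 \<le> \<tau>" "\<tau> \<in> {0..\<delta>1}" using that \<delta>1 by auto
    have "\<tau> * K \<le> \<delta> * K" using that K by (intro mult_right_mono) auto
    then show "\<tau> * K \<le> 1 / 8" using \<delta>(2) by (rule order_trans)
  qed
  have s: "\<bar>if odd i then 1 / 2 else - (1 / 2)\<bar> \<le> (1 / 2 :: real)" for i :: nat by simp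
  have jk: "(if i \<le> 2 then 1 else 3) \<in> {1..4::nat}" "(if i \<le> 2 then 2 else 4) \<in> {1..4::nat}"
    "(if i \<le> 2 then 3 else 1) \<in> {1..4::nat}" "(if i \<le> 2 then 4 else 2) \<in> {1..4::nat}" for i :: nat by auto
  have c: "C11 K (alpha i lam \<tau>)" "C11 K (beta i lam \<tau>)" "C11 K (ell i lam \<tau>)" if "i \<in> {1..4}" "\<tau> \<in> {0..\<delta>}" for i \<tau>
    using C11[rule_format, OF that(1) lam1 t(3)[OF that(2)]] by auto
  have box: "(\<lambda>j. \<tau> * v j) \<in> unit_box" if "\<tau> \<in> {0..\<delta>}" "\<forall>j\<in>{1..4}. \<bar>v j\<bar> \<le> 2 * K" for \<tau> v
    by (rule scaled_in_box[OF K t(1,2)[OF that(1)] that(2)])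
  show ?thesis
  proof (rule degenerate_transport.intro)
    show "0 < 3 * K + 1" "0 < 2 * K" using K by auto
    show "B1 = 4 * (3 * K + 1)" "B2 = 6 * ((3 * K + 1) * (3 + 2 * B1\<^sup>2) + 2 * B1)" "N = 4 * ((3 * K + 1) + 2 * B1) + 1"
      "\<delta> > 0" "\<delta>\<^sup>2 * ((3 * K + 1) * (3 + B1\<^sup>2 + B1 + 2 * B2 + N)) \<le> 1 / 10" by (fact B \<delta> small)+
  next
    fix i :: nat and \<tau> y :: real and v :: "nat \<Rightarrow> real" assume i: "i \<in> {1..4}" and \<tau>: "\<tau> \<in> {0..\<delta>}" and "\<And>j. j \<in> {1..4} \<Longrightarrow> \<bar>v j\<bar> \<le> 2 * K"
    then have v: "\<forall>j\<in>{1..4}. \<bar>v j\<bar> \<le> 2 * K" by blast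
    show "\<bar>rhs lam i \<tau> y v\<bar> \<le> 2 * (2 * K)"
      unfolding rhs_eq_source by (rule source_bound[OF K t(1,2)[OF \<tau>] lam s jk c(1,2)[OF i \<tau>] v])
    have "\<bar>ell i lam \<tau> y (\<lambda>j. \<tau> * v j)\<bar> \<le> K" by (rule C11_bound[OF c(3)[OF i \<tau>] box[OF \<tau> v]])
    then show "\<bar>ell i lam \<tau> y (\<lambda>j. \<tau> * v j)\<bar> \<le> 3 * K + 1" using K by linarith
  next
    fix i :: nat and \<tau> y y' d :: real and v v' :: "nat \<Rightarrow> real" assume i: "i \<in> {1..4}" and \<tau>: "\<tau> \<in> {0..\<delta>}" and "\<And>j. j \<in> {1..4} \<Longrightarrow> \<bar>v j\<bar> \<le> 2 * K"
      "\<And>j. j \<in> {1..4} \<Longrightarrow> \<bar>v' j\<bar> \<le> 2 * K" "\<And>j. j \<in> {1..4} \<Longrightarrow> \<bar>v j - v' j\<bar> \<le> d"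
    then have v: "\<forall>j\<in>{1..4}. \<bar>v j\<bar> \<le> 2 * K" "\<forall>j\<in>{1..4}. \<bar>v' j\<bar> \<le> 2 * K" "\<forall>j\<in>{1..4}. \<bar>v j - v' j\<bar> \<le> d" by blast+
    show "\<bar>rhs lam i \<tau> y v - rhs lam i \<tau> y' v'\<bar> \<le> (3 * K + 1) * \<bar>y - y'\<bar> + 3 / 2 * d"
      unfolding rhs_eq_source by (rule source_lip[OF K t(1,2)[OF \<tau>] lam s jk c(1,2)[OF i \<tau>] v])
    show "\<bar>ell i lam \<tau> y (\<lambda>j. \<tau> * v j) - ell i lam \<tau> y' (\<lambda>j. \<tau> * v' j)\<bar> \<le> (3 * K + 1) * (\<bar>y - y'\<bar> + d)"
      by (rule speed_lip[OF K t(1,2)[OF \<tau>] c(3)[OF i \<tau>] v])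
  next
    fix i :: nat and \<tau> y y' ym dy dv ey ev :: real and v v' vm :: "nat \<Rightarrow> real"
    assume i: "i \<in> {1..4}" and \<tau>: "\<tau> \<in> {0..\<delta>}"
      and y: "\<bar>y - ym\<bar> \<le> dy" "\<bar>y' - ym\<bar> \<le> dy" "\<bar>y + y' - 2 * ym\<bar> \<le> ey"
      and "\<And>j. j \<in> {1..4} \<Longrightarrow> \<bar>v j\<bar> \<le> 2 * K" "\<And>j. j \<in> {1..4} \<Longrightarrow> \<bar>v' j\<bar> \<le> 2 * K" "\<And>j. j \<in> {1..4} \<Longrightarrow> \<bar>vm j\<bar> \<le> 2 * K"
        "\<And>j. j \<in> {1..4} \<Longrightarrow> \<bar>v j - vm j\<bar> \<le> dv" "\<And>j. j \<in> {1..4} \<Longrightarrow> \<bar>v' j - vm j\<bar> \<le> dv"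
        "\<And>j. j \<in> {1..4} \<Longrightarrow> \<bar>v j + v' j - 2 * vm j\<bar> \<le> ev"
    then have v: "\<forall>j\<in>{1..4}. \<bar>v j\<bar> \<le> 2 * K" "\<forall>j\<in>{1..4}. \<bar>v' j\<bar> \<le> 2 * K" "\<forall>j\<in>{1..4}. \<bar>vm j\<bar> \<le> 2 * K"
      and dv: "\<forall>j\<in>{1..4}. \<bar>v j - vm j\<bar> \<le> dv" "\<forall>j\<in>{1..4}. \<bar>v' j - vm j\<bar> \<le> dv" "\<forall>j\<in>{1..4}. \<bar>v j + v' j - 2 * vm j\<bar> \<le> ev" by blast+
    show "\<bar>rhs lam i \<tau> y v + rhs lam i \<tau> y' v' - 2 * rhs lam i \<tau> ym vm\<bar> \<le> (3 * K + 1) * (dy\<^sup>2 + dv\<^sup>2 + ey) + 3 / 2 * ev"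
      unfolding rhs_eq_source by (rule source_sd[OF K t(1,2)[OF \<tau>] lam s jk c(1,2)[OF i \<tau>] v y dv])
    show "\<bar>ell i lam \<tau> y (\<lambda>j. \<tau> * v j) + ell i lam \<tau> y' (\<lambda>j. \<tau> * v' j) - 2 * ell i lam \<tau> ym (\<lambda>j. \<tau> * vm j)\<bar> \<le> (3 * K + 1) * (dy\<^sup>2 + dv\<^sup>2 + ey + ev)"
      by (rule speed_sd[OF K t(1,2)[OF \<tau>] c(3)[OF i \<tau>] v y dv])
  next
    fix i :: nat and S :: "(real \<times> real \<times> real) set" and x \<eta> :: "real \<times> real \<times> real \<Rightarrow> real"
      and v :: "nat \<Rightarrow> real \<times> real \<times> real \<Rightarrow> real"
    assume a: "continuous_on S x" "continuous_on S \<eta>" "\<And>j. j \<in> {1..4} \<Longrightarrow> continuous_on S (v j)"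
      and xp: "\<And>p. p \<in> S \<Longrightarrow> x p \<in> {0..\<delta>}" and vp: "\<And>p j. p \<in> S \<Longrightarrow> j \<in> {1..4} \<Longrightarrow> \<bar>v j p\<bar> \<le> 2 * K"
    have w: "\<forall>j\<in>{1..4}. continuous_on S (\<lambda>p. x p * v j p)" using a by (intro ballI continuous_on_mult) auto
    have d: "\<forall>p\<in>S. x p \<in> {0..\<delta>1} \<and> (\<lambda>j. x p * v j p) \<in> unit_box"
    proof (intro ballI conjI)
      fix p assume p: "p \<in> S"
      show "x p \<in> {0..\<delta>1}" by (rule t(3)[OF xp[OF p]])
      have "\<forall>j\<in>{1..4}. \<bar>v j p\<bar> \<le> 2 * K" using vp[OF p] by blast
      then show "(\<lambda>j. x p * v j p) \<in> unit_box" by (rule box[OF xp[OF p]])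
    qed
    have f: "continuous_on S (\<lambda>p. alpha i lam (x p) (\<eta> p) (\<lambda>j. x p * v j p))" "continuous_on S (\<lambda>p. beta i lam (x p) (\<eta> p) (\<lambda>j. x p * v j p))"
      "continuous_on S (\<lambda>p. ell i lam (x p) (\<eta> p) (\<lambda>j. x p * v j p))"
      using C11_family_cont[OF fam(1) lam1 a(1,2) w d] C11_family_cont[OF fam(2) lam1 a(1,2) w d] C11_family_cont[OF fam(3) lam1 a(1,2) w d] by auto
    show "continuous_on S (\<lambda>p. rhs lam i (x p) (\<eta> p) (\<lambda>j. v j p)) \<and> continuous_on S (\<lambda>p. ell i lam (x p) (\<eta> p) (\<lambda>j. x p * v j p))"
      unfolding rhs_eq_source source_def by (intro conjI continuous_intros f a(3) jk)
  qed
qed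

lemma uniform_constant:
  assumes fam: "\<And>i. C11_family \<delta> (alpha i)" "\<And>i. C11_family \<delta> (beta i)" "\<And>i. C11_family \<delta> (ell i)"
  shows "\<exists>K\<ge>1. \<forall>i\<in>{1..4}. \<forall>lam \<tau>. \<bar>lam\<bar> \<le> 1 \<longrightarrow> \<tau> \<in> {0..\<delta>} \<longrightarrow> C11 K (alpha i lam \<tau>) \<and> C11 K (beta i lam \<tau>) \<and> C11 K (ell i lam \<tau>)"
proof -
  have "\<forall>i. \<exists>K. \<forall>lam \<tau>. \<bar>lam\<bar> \<le> 1 \<longrightarrow> \<tau> \<in> {0..\<delta>} \<longrightarrow> C11 K (h i lam \<tau>)"
    if "\<And>i. C11_family \<delta> (h i)" for h :: "nat \<Rightarrow> real \<Rightarrow> real \<Rightarrow> real \<Rightarrow> (nat \<Rightarrow> real) \<Rightarrow> real"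
    using that unfolding C11_family_def by blast
  note ex = this[THEN choice]
  obtain Ka where Ka: "\<forall>i lam \<tau>. \<bar>lam\<bar> \<le> 1 \<longrightarrow> \<tau> \<in> {0..\<delta>} \<longrightarrow> C11 (Ka i) (alpha i lam \<tau>)" using ex[of alpha] fam(1) by blast
  obtain Kb where Kb: "\<forall>i lam \<tau>. \<bar>lam\<bar> \<le> 1 \<longrightarrow> \<tau> \<in> {0..\<delta>} \<longrightarrow> C11 (Kb i) (beta i lam \<tau>)" using ex[of beta] fam(2) by blast
  obtain Kl where Kl: "\<forall>i lam \<tau>. \<bar>lam\<bar> \<le> 1 \<longrightarrow> \<tau> \<in> {0..\<delta>} \<longrightarrow> C11 (Kl i) (ell i lam \<tau>)" using ex[of ell] fam(3) by blast
  define m where "m i = \<bar>Ka i\<bar> + \<bar>Kb i\<bar> + \<bar>Kl i\<bar>" for i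
  define K where "K = 1 + (\<Sum>i=1..4. m i)"
  have m: "m i \<le> K" if "i \<in> {1..4}" for i
    using member_le_sum[of i "{1..4}" m] that by (simp add: K_def m_def)
  have K: "Ka i \<le> K" "Kb i \<le> K" "Kl i \<le> K" if "i \<in> {1..4}" for i
    using m[OF that] unfolding m_def by linarith+
  have "K \<ge> 1" unfolding K_def m_def by (simp add: sum_nonneg)
  moreover have "C11 K (alpha i lam \<tau>) \<and> C11 K (beta i lam \<tau>) \<and> C11 K (ell i lam \<tau>)" if "i \<in> {1..4}" "\<bar>lam\<bar> \<le> 1" "\<tau> \<in> {0..\<delta>}" for i lam \<tau>
    using C11_mono[OF Ka[rule_format, OF that(2,3)] K(1)[OF that(1)]] C11_mono[OF Kb[rule_format, OF that(2,3)] K(2)[OF that(1)]]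
      C11_mono[OF Kl[rule_format, OF that(2,3)] K(3)[OF that(1)]] by blast
  ultimately show ?thesis by blast
qed

lemma hodograph_solution:
  "\<exists>lam0 > 0. \<exists>\<delta> > 0. \<exists>M > 0. \<forall>lam. \<bar>lam\<bar> \<le> lam0 \<longrightarrow>
     (\<exists>U Ut Uy. class_F M \<delta> U Ut Uy \<and>
        (\<forall>\<tau> \<in> {0<..\<delta>}. \<forall>y. hodograph_eqs c a \<phi>1 \<phi>2 \<psi>1 \<psi>2 lam \<tau> y
            (\<lambda>j. U j \<tau> y) (\<lambda>j. Ut j \<tau> y) (\<lambda>j. Uy j \<tau> y)))"
proof -
  obtain \<delta>1 where \<delta>1: "\<delta>1 > 0" "\<delta>1 \<le> 1"
    and den: "\<And>lam \<tau> y x. \<bar>lam\<bar> \<le> 1 \<Longrightarrow> \<tau> \<in> {0..\<delta>1} \<Longrightarrow> \<bar>x\<bar> \<le> 1 \<Longrightarrow> \<psi>0 / 2 \<le> \<psi>1 y + \<tau> * (G11 lam y + x)"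
    using denominators_positive by blast
  have fam: "C11_family \<delta>1 (alpha i)" "C11_family \<delta>1 (beta i)" "C11_family \<delta>1 (ell i)" for i
    by (rule coefficient_families; rule den; assumption)+
  obtain K where K: "K \<ge> 1"
    and C11: "\<forall>i\<in>{1..4}. \<forall>lam \<tau>. \<bar>lam\<bar> \<le> 1 \<longrightarrow> \<tau> \<in> {0..\<delta>1} \<longrightarrow> C11 K (alpha i lam \<tau>) \<and> C11 K (beta i lam \<tau>) \<and> C11 K (ell i lam \<tau>)"
    using uniform_constant[OF fam] by blast
  define B1 where "B1 = 4 * (3 * K + 1)"
  define B2 where "B2 = 6 * ((3 * K + 1) * (3 + 2 * B1\<^sup>2) + 2 * B1)"
  define N where "N = 4 * ((3 * K + 1) + 2 * B1) + 1"
  define C where "C = (3 * K + 1) * (3 + B1\<^sup>2 + B1 + 2 * B2 + N)"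
  have B1: "B1 > 0" using K by (simp add: B1_def)
  have B2: "B2 > 0" using K B1 unfolding B2_def by (intro mult_pos_pos add_nonneg_pos mult_nonneg_nonneg) auto
  have N: "N > 0" using K B1 by (simp add: N_def)
  have C: "C \<ge> 0" unfolding C_def using K B1 B2 N by (intro mult_nonneg_nonneg add_nonneg_nonneg) auto
  \<comment> \<open>The three bounds keep the denominators positive, keep \<tau> v in the unit box,
    and make the iteration contract. Since \<delta> <= 1, the last one may bound \<delta> C in place
    of \<open>\<delta>\<^sup>2 * C\<close>; C + 1 avoids a zero denominator.\<close>
  define \<delta> where "\<delta> = min \<delta>1 (min (1 / (8 * K)) (1 / (10 * (C + 1))))"
  have \<delta>: "\<delta> > 0" "\<delta> \<le> \<delta>1" "\<delta> \<le> 1 / (8 * K)" "\<delta> \<le> 1 / (10 * (C + 1))" using \<delta>1 K C by (auto simp: \<delta>_def)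
  have \<delta>K: "\<delta> * K \<le> 1 / 8" using \<delta>(3) K by (simp add: field_simps)
  have small: "\<delta>\<^sup>2 * C \<le> 1 / 10"
  proof -
    have "\<delta> * (\<delta> * C) \<le> 1 * (1 / (10 * (C + 1)) * (C + 1))"
      using \<delta> \<delta>1 C by (intro mult_mono) auto
    also have "\<dots> = 1 / 10" using C by (simp add: field_simps)
    finally show ?thesis by (simp add: power2_eq_square)
  qed
  \<comment> \<open>All four components share the same constants, so each of the three sums in the
    function class is 4 times one of the summands.\<close>
  define M where "M = 4 * (2 * K) + 4 * B1 + 4 * B2"
  have M: "M > 0" "4 * (2 * K) \<le> M" "4 * B1 \<le> M" "4 * B2 \<le> M" using K B1 B2 by (simp_all add: M_def)
  have "\<exists>U Ut Uy. class_F M \<delta> U Ut Uy \<and> (\<forall>\<tau> \<in> {0<..\<delta>}. \<forall>y. hodograph_eqs c a \<phi>1 \<phi>2 \<psi>1 \<psi>2 lam \<tau> y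
            (\<lambda>j. U j \<tau> y) (\<lambda>j. Ut j \<tau> y) (\<lambda>j. Uy j \<tau> y))" if lam0: "\<bar>lam\<bar> \<le> 1 / (8 * K)" for lam
  proof -
    have lam: "\<bar>lam\<bar> * K \<le> 1 / 8" using lam0 K by (simp add: field_simps)
    have lam1: "\<bar>lam\<bar> \<le> 1" using lam mult_left_mono[OF K abs_ge_zero[of lam]] by simp
    interpret T: degenerate_transport "{1..4}" "rhs lam" "\<lambda>i \<tau> y v. ell i lam \<tau> y (\<lambda>j. \<tau> * v j)" \<delta> "3 * K + 1" "2 * K" B1 B2 N
      by (rule transport[OF K lam \<delta>(2,1) \<delta>K fam C11 B1_def B2_def N_def small[unfolded C_def]])
    obtain V Vy where Vb: "\<And>i \<tau> y. i \<in> {1..4} \<Longrightarrow> \<tau> \<in> {0..\<delta>} \<Longrightarrow> \<bar>V (i, \<tau>, y)\<bar> \<le> 2 * K"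
      and Vy: "\<And>i \<tau> y. i \<in> {1..4} \<Longrightarrow> \<tau> \<in> {0..\<delta>} \<Longrightarrow> \<bar>Vy i \<tau> y\<bar> \<le> B1"
        "\<And>i \<tau> y y'. i \<in> {1..4} \<Longrightarrow> \<tau> \<in> {0..\<delta>} \<Longrightarrow> \<bar>Vy i \<tau> y - Vy i \<tau> y'\<bar> \<le> B2 * \<bar>y - y'\<bar>"
      and C1: "\<And>i. i \<in> {1..4} \<Longrightarrow> C1_strip \<delta> (\<lambda>\<tau> y. \<tau>\<^sup>2 * V (i, \<tau>, y))
        (\<lambda>\<tau> y. \<tau> * rhs lam i \<tau> y (\<lambda>j. V (j, \<tau>, y)) - \<tau> * ell i lam \<tau> y (\<lambda>j. \<tau> * V (j, \<tau>, y)) * (\<tau>\<^sup>2 * Vy i \<tau> y))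
        (\<lambda>\<tau> y. \<tau>\<^sup>2 * Vy i \<tau> y)"
      using T.classical_solution by blast
    define U where "U i \<tau> y = \<tau>\<^sup>2 * V (i, \<tau>, y)" for i \<tau> y
    define Uy where "Uy i \<tau> y = \<tau>\<^sup>2 * Vy i \<tau> y" for i \<tau> y
    define Ut where "Ut i \<tau> y = \<tau> * rhs lam i \<tau> y (\<lambda>j. V (j, \<tau>, y)) - \<tau> * ell i lam \<tau> y (\<lambda>j. \<tau> * V (j, \<tau>, y)) * Uy i \<tau> y" for i \<tau> y
    have sum4: "(\<Sum>j=1..4::nat. k) = 4 * (k :: real)" for k by simp
    have "class_F M \<delta> U Ut Uy"
      unfolding class_F_def
    proof (intro conjI ballI allI)
      show "C1_strip \<delta> (U j) (Ut j) (Uy j)" if "j \<in> {1..4}" for j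
        using C1[OF that] unfolding U_def[abs_def] Ut_def[abs_def] Uy_def[abs_def] .
      show "U j 0 y = 0" "Ut j 0 y = 0" for j y by (simp_all add: U_def Ut_def)
      show "\<exists>K. (\<forall>j\<in>{1..4}. \<forall>\<tau>\<in>{0..\<delta>}. \<forall>y. \<bar>U j \<tau> y\<bar> \<le> K j * \<tau>\<^sup>2) \<and> (\<Sum>j=1..4. K j) \<le> M"
      proof (intro exI[of _ "\<lambda>_. 2 * K"] conjI ballI allI)
        show "\<bar>U j \<tau> y\<bar> \<le> 2 * K * \<tau>\<^sup>2" if "j \<in> {1..4}" "\<tau> \<in> {0..\<delta>}" for j \<tau> y
          using mult_right_mono[OF Vb[OF that, of y] zero_le_power2[of \<tau>]] by (simp add: U_def abs_mult mult.commute)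
        show "(\<Sum>j=1..4::nat. 2 * K) \<le> M" unfolding sum4 by (rule M)
      qed
      show "\<exists>K. (\<forall>j\<in>{1..4}. \<forall>\<tau>\<in>{0..\<delta>}. \<forall>y. \<bar>Uy j \<tau> y\<bar> \<le> K j * \<tau>\<^sup>2) \<and> (\<Sum>j=1..4. K j) \<le> M"
      proof (intro exI[of _ "\<lambda>_. B1"] conjI ballI allI)
        show "\<bar>Uy j \<tau> y\<bar> \<le> B1 * \<tau>\<^sup>2" if "j \<in> {1..4}" "\<tau> \<in> {0..\<delta>}" for j \<tau> y
          using mult_right_mono[OF Vy(1)[OF that, of y] zero_le_power2[of \<tau>]] by (simp add: Uy_def abs_mult mult.commute)
        show "(\<Sum>j=1..4::nat. B1) \<le> M" unfolding sum4 by (rule M)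
      qed
      show "\<exists>K. (\<forall>j\<in>{1..4}. \<forall>\<tau>\<in>{0..\<delta>}. \<forall>y1 y2. \<bar>Uy j \<tau> y1 - Uy j \<tau> y2\<bar> \<le> K j * \<tau>\<^sup>2 * \<bar>y1 - y2\<bar>) \<and> (\<Sum>j=1..4. K j) \<le> M"
      proof (intro exI[of _ "\<lambda>_. B2"] conjI ballI allI)
        show "\<bar>Uy j \<tau> y1 - Uy j \<tau> y2\<bar> \<le> B2 * \<tau>\<^sup>2 * \<bar>y1 - y2\<bar>" if "j \<in> {1..4}" "\<tau> \<in> {0..\<delta>}" for j \<tau> y1 y2
        proof -
          have "\<bar>Uy j \<tau> y1 - Uy j \<tau> y2\<bar> = \<tau>\<^sup>2 * \<bar>Vy j \<tau> y1 - Vy j \<tau> y2\<bar>"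
            unfolding Uy_def right_diff_distrib[symmetric] abs_mult by simp
          also have "\<dots> \<le> \<tau>\<^sup>2 * (B2 * \<bar>y1 - y2\<bar>)" by (rule mult_left_mono[OF Vy(2)[OF that] zero_le_power2])
          finally show ?thesis by (simp only: mult_ac)
        qed
        show "(\<Sum>j=1..4::nat. B2) \<le> M" unfolding sum4 by (rule M)
      qed
    qed
    moreover have "hodograph_eqs c a \<phi>1 \<phi>2 \<psi>1 \<psi>2 lam \<tau> y (\<lambda>j. U j \<tau> y) (\<lambda>j. Ut j \<tau> y) (\<lambda>j. Uy j \<tau> y)" if \<tau>: "\<tau> \<in> {0<..\<delta>}" for \<tau> y
    proof -
      have \<tau>': "\<tau> \<in> {0..\<delta>}" "\<tau> \<in> {0..\<delta>1}" "\<tau> > 0" using \<tau> \<delta> by auto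
      have "\<tau> * K \<le> \<delta> * K" using \<tau>' K by (intro mult_right_mono) auto
      then have \<tau>K: "\<tau> * K \<le> 1 / 8" using \<delta>K by (rule order_trans)
      \<comment> \<open>The supremum bound puts \<tau> V back into the box over which the
        denominators are known to be positive.\<close>
      have "(\<lambda>j. \<tau> * V (j, \<tau>, y)) \<in> unit_box"
        by (rule scaled_in_box[OF K less_imp_le[OF \<tau>'(3)] \<tau>K]) (use Vb[OF _ \<tau>'(1)] in blast)
      then have w: "\<bar>\<tau> * V (1, \<tau>, y)\<bar> \<le> 1" "\<bar>\<tau> * V (2, \<tau>, y)\<bar> \<le> 1" unfolding unit_box_def by fastforce+
      have "R1 lam \<tau> y (\<lambda>j. \<tau> * V (j, \<tau>, y)) \<noteq> 0" "S1 lam \<tau> y (\<lambda>j. \<tau> * V (j, \<tau>, y)) \<noteq> 0"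
        using den[OF lam1 \<tau>'(2) w(1), of y] den[OF lam1 \<tau>'(2) w(2), of y] \<psi>0 unfolding R1_def S1_def by auto
      from hodograph_eqsI[OF \<tau>'(3) this, of "\<lambda>j. Ut j \<tau> y" "\<lambda>j. Uy j \<tau> y"]
      show ?thesis by (simp add: U_def Ut_def)
    qed
    ultimately show ?thesis by blast
  qed
  moreover have "1 / (8 * K) > 0" using K by simp
  ultimately show ?thesis using \<delta>(1) M(1) by blast
qed

end

theorem theorem1p3:
  fixes c a \<phi>2 \<psi>1 \<psi>2 :: "real \<Rightarrow> real" and \<phi>1 m0 \<psi>0 :: real
  assumes "smooth_fun c" and "smooth_fun a"
    and "\<forall>l \<in> {1,2,3::nat}. bounded (range ((deriv ^^ l) c))"
    and "\<forall>l \<in> {1,2,3::nat}. bounded (range ((deriv ^^ l) a))"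
    and "m0 > 0" and "\<forall>z. \<bar>a z\<bar> \<ge> m0"
    and "\<forall>z. deriv c z \<le> - m0"
    and "c \<phi>1 = 0"
    and "smooth_fun \<phi>2" and "smooth_fun \<psi>1" and "smooth_fun \<psi>2"
    and "\<forall>j \<in> {1..4::nat}. bounded (range ((deriv ^^ j) \<phi>2))"
    and "\<forall>k \<in> {0..3::nat}. bounded (range ((deriv ^^ k) \<psi>1))"
    and "\<forall>k \<in> {0..3::nat}. bounded (range ((deriv ^^ k) \<psi>2))"
    and "\<psi>0 > 0" and "\<forall>y. \<psi>1 y \<ge> \<psi>0"
  shows "\<exists>lam0 > 0. \<exists>\<delta> > 0. \<exists>M > 0. \<forall>lam. \<bar>lam\<bar> \<le> lam0 \<longrightarrow>
           (\<exists>U Ut Uy. class_F M \<delta> U Ut Uy \<and>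
              (\<forall>\<tau> \<in> {0<..\<delta>}. \<forall>y. hodograph_eqs c a \<phi>1 \<phi>2 \<psi>1 \<psi>2 lam \<tau> y
                  (\<lambda>j. U j \<tau> y) (\<lambda>j. Ut j \<tau> y) (\<lambda>j. Uy j \<tau> y)))"
proof -
  interpret hodograph_data c a \<phi>2 \<psi>1 \<psi>2 \<phi>1 m0 \<psi>0
    by (rule hodograph_data.intro) (fact assms)+
  show ?thesis by (rule hodograph_solution)
qed

end
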